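(* In the setting described in the context, let $c>\underline{c}$, where $$\underline{c}:=\frac{(\theta_0+\theta)^2+4\mu\theta}{4\mu\lambda_2(L)},$$ and let $\boldsymbol{\Omega}:=\{\boldsymbol{x}\in\mathbb{R}^{Nn}\mid \mathcal{R}\boldsymbol{x}\in\Omega\}$ and $\Xi:=\boldsymbol{\Omega}\times\mathbb{R}^{mN}\times\mathbb{R}^{mN}_{\geq 0}$. Consider the dynamics in the variable $\operatorname{col}(\boldsymbol{x},\boldsymbol{z},\boldsymbol{\lambda})$: $$\begin{aligned} \dot{\boldsymbol{x}}&=\mathcal{R}^\top\,\Pi_{\Omega}\bigl(\mathcal{R}\boldsymbol{x},\,-(\boldsymbol{F}(\boldsymbol{x})+\boldsymbol{\Lambda}^\top\boldsymbol{\lambda}+c\,\mathcal{R}\boldsymbol{L}_{\mathrm{x}}\boldsymbol{x})\bigr)+\mathcal{S}^\top\bigl(-c\,\mathcal{S}\boldsymbol{L}_{\mathrm{x}}\boldsymbol{x}\bigr),\\ \dot{\boldsymbol{z}}&=\boldsymbol{L}_{\lambda}\boldsymbol{\lambda},\\ \dot{\boldsymbol{\lambda}}&=\Pi_{\mathbb{R}^{Nm}_{\geq 0}}\bigl(\boldsymbol{\lambda},\,\boldsymbol{\Lambda}\mathcal{R}\boldsymbol{x}-\boldsymbol{b}-\boldsymbol{L}_{\lambda}\boldsymbol{\lambda}-\boldsymbol{L}_{\lambda}\boldsymbol{z}\bigr). \end{aligned}$$ For any initial condition in $\Xi$, these dynamics have a unique Carathéodory solution, which belongs to $\Xi$ for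 all $t\geq 0$. As $t\to\infty$ the solution converges to an equilibrium $\operatorname{col}(\bar{\boldsymbol{x}},\bar{\boldsymbol{z}},\bar{\boldsymbol{\lambda}})$ of the dynamics with $\bar{\boldsymbol{x}}=\mathbf{1}_N\otimes x^*$ and $\bar{\boldsymbol{\lambda}}=\mathbf{1}_N\otimes\lambda^*$, where the pair $(x^*,\lambda^* )\in\mathbb{R}^n\times\mathbb{R}^m$ satisfies the KKT conditions $$\mathbf{0}_n\in F(x^* )+A^\top\lambda^*+\mathrm{N}_{\Omega}(x^* ),\qquad \mathbf{0}_m\in-(Ax^*-b)+\mathrm{N}_{\mathbb{R}^m_{\geq 0}}(\lambda^* );$$ hence $x^*$ is the (unique) variational generalized Nash equilibrium (v-GNE) of the game.
   Context: **Game.** $\mathcal{I}=\{1,\dots,N\}$ is a set of agents (with $N\ge 2$). Agent $i$ has a decision variable $x_i\in\Omega_i\subseteq\mathbb{R}^{n_i}$; $n=\sum_i n_i$, $x=\operatorname{col}(x_1,\dots,x_N)\in\Omega=\Omega_1\times\cdots\times\Omega_N\subseteq\mathbb{R}^n$, where $\operatorname{col}$ denotes vertical stacking; $x_{-i}$ is the stack of all $x_j$, $j\neq i$. Agent $i$ has a cost function $J_i(x_i,x_{-i})$, $J_i:\mathbb{R}^n\to\mathbb{R}$. Given $A_i\in\mathbb{R}^{m\times n_i}$, $b_i\in\mathbb{R}^m$, let $A=[A_1,\dots,A_N]$, $b=\sum_i b_i$. The feasible set is $\mathcal{X}=\Omega\cap\{x\in\mathbb{R}^n\mid Ax\le b\}$.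 In the game, each agent $i$ solves $\min_{y_i} J_i(y_i,x_{-i})$ subject to $(y_i,x_{-i})\in\mathcal{X}$. A generalized Nash equilibrium is $x^*\in\mathcal{X}$ such that for every $i$, $x_i^*$ minimizes $J_i(y_i,x_{-i}^* )$ over $y_i$ with $(y_i,x^*_{-i})\in\mathcal{X}$. The pseudo-gradient is $F(x)=\operatorname{col}((\nabla_{x_i}J_i(x_i,x_{-i}))_{i\in\mathcal{I}})$. A v-GNE is an $x^*\in\mathcal{X}$ with $F(x^* )^\top(y-x^* )\ge 0$ for all $y\in\mathcal{X}$ (under the assumptions below, equivalently, $x^*$ satisfies the KKT conditions in the claim for some $\lambda^*\in\mathbb{R}^m$; the v-GNE exists and is unique). **Standing assumptions.** (1) Each $\Omega_i$ is nonempty, closed and convex; $\mathcal{X}$ is nonempty and satisfies Slater's constraint qualification; each $J_i$ is continuously differentiable and $J_i(\cdot,x_{-i})$ is convex for every $x_{-i}$. (2) For some $\mu,\theta_0>0$ and all $x,y\in\mathbb{R}^n$: $(x-y)^\top(F(x)-F(y))\ge\mu\|x-y\|^2$ and $\|F(x)-F(y)\|\le\theta_0\|x-y\|$. (3) The communication graph $\mathcal{G}(\mathcal{I},\mathcal{E})$ is undirected and connected, with symmetric weighted adjacency matrix $W=[w_{ij}]$ ($w_{ij}>0$ if $(i,j)\in\mathcal{E}$, $w_{ij}=0$ otherwise) and weighted symmetric Laplacian $L=\operatorname{diag}(W\mathbf{1}_N)-W\in\mathbb{R}^{N\times N}$. $\lambda_2(L)$ is its second smallest eigenvalue. **Estimates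 and stacked notation.** Each agent $i$ keeps a vector $\boldsymbol{x}^i=\operatorname{col}((\boldsymbol{x}^i_j)_{j\in\mathcal{I}})\in\mathbb{R}^n$, with $\boldsymbol{x}^i_j\in\mathbb{R}^{n_j}$ and $\boldsymbol{x}^i_i=x_i$; $\boldsymbol{x}^i_{-i}=\operatorname{col}((\boldsymbol{x}^i_j)_{j\ne i})$; also $\lambda_i\in\mathbb{R}^m_{\ge 0}$, $z_i\in\mathbb{R}^m$. $\boldsymbol{x}=\operatorname{col}((\boldsymbol{x}^i)_i)\in\mathbb{R}^{Nn}$, $\boldsymbol{\lambda}=\operatorname{col}((\lambda_i)_i)$, $\boldsymbol{z}=\operatorname{col}((z_i)_i)$, $\boldsymbol{b}=\operatorname{col}((b_i)_i)\in\mathbb{R}^{Nm}$. $\boldsymbol{\Lambda}=\operatorname{diag}(A_1,\dots,A_N)$ (block diagonal, $Nm\times n$), $\boldsymbol{L}_{\mathrm{x}}=L\otimes I_n$, $\boldsymbol{L}_\lambda=L\otimes I_m$. $\mathcal{R}_i\in\mathbb{R}^{n_i\times n}$ is the matrix selecting the $i$-th block (of dimension $n_i$) of a vector of $\mathbb{R}^n$, and $\mathcal{S}_i\in\mathbb{R}^{(n-n_i)\times n}$ the matrix removing it: $\mathcal{R}_i\boldsymbol{x}^i=x_i$, $\mathcal{S}_i\boldsymbol{x}^i=\boldsymbol{x}^i_{-i}$. $\mathcal{R}=\operatorname{diag}(\mathcal{R}_1,\dots,\mathcal{R}_N)$, $\mathcal{S}=\operatorname{diag}(\mathcal{S}_1,\dots,\mathcal{S}_N)$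 (block diagonal). The extended pseudo-gradient is $\boldsymbol{F}(\boldsymbol{x})=\operatorname{col}((\nabla_{x_i}J_i(x_i,\boldsymbol{x}^i_{-i}))_{i\in\mathcal{I}})$, $\boldsymbol{F}:\mathbb{R}^{Nn}\to\mathbb{R}^n$. $\theta$ denotes a Lipschitz constant of $\boldsymbol{F}$ with $\mu\le\theta\le\theta_0$ (such a constant exists under assumption (2)). **Convex-analytic notation.** For a closed convex set $S\subseteq\mathbb{R}^q$: $\mathrm{N}_S(x)=\{v\mid \sup_{y\in S}v^\top(y-x)\le 0\}$ if $x\in S$ and $\mathrm{N}_S(x)=\varnothing$ otherwise; for $x\in S$, $\mathrm{T}_S(x)=\overline{\bigcup_{\delta>0}\frac1\delta(S-x)}$, and $\Pi_S(x,v)$ is the Euclidean projection of $v$ onto $\mathrm{T}_S(x)$. $\mathbf{1}_N$ is the all-ones vector, $\mathbf{0}$ a zero vector. A Carathéodory solution is a locally absolutely continuous function on $[0,\infty)$ satisfying the differential equation for almost every $t$. An equilibrium is a point of $\Xi$ at which the right-hand side vanishes. *)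

theory Defs
  imports "HOL-Analysis.Analysis"
begin

text \<open>
  Block structure. Agents are the elements of a finite type 'N. The coordinates of the stacked
  decision vector are the elements of a finite type 'k, and own k is the agent that owns
  coordinate k; thus n is the cardinality of 'k, and the dimension of the space of agent i is the
  number of coordinates owned by i. That space is realised as a coordinate subspace of real^'k.
  A stack of N vectors of dimension n is a vector indexed by the product of 'N and 'k, and
  likewise for dimension m.
\<close>

definition block_space :: "('k::finite \<Rightarrow> 'N::finite) \<Rightarrow> 'N \<Rightarrow> (real^'k) set"
  where "block_space own i = {x. \<forall>k. own k \<noteq> i \<longrightarrow> x $ k = 0}"

definition block :: "('k::finite \<Rightarrow> 'N::finite) \<Rightarrow> 'N \<Rightarrow> real^'k \<Rightarrow> real^'k"
  where "block own i x = (\<chi> k. if own k = i then x $ k else 0)"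

text \<open>The vector with block i taken from y and all other blocks taken from x.\<close>

definition with_block :: "('k::finite \<Rightarrow> 'N::finite) \<Rightarrow> 'N \<Rightarrow> real^'k \<Rightarrow> real^'k \<Rightarrow> real^'k"
  where "with_block own i y x = (\<chi> k. if own k = i then y $ k else x $ k)"

definition stack_set :: "('k::finite \<Rightarrow> 'N::finite) \<Rightarrow> ('N \<Rightarrow> (real^'k) set) \<Rightarrow> (real^'k) set"
  where "stack_set own \<Omega>s = {x. \<forall>i. block own i x \<in> \<Omega>s i}"

definition kron_mat :: "real^'c^'r \<Rightarrow> real^'d^'s \<Rightarrow> real^('c \<times> 'd)^('r \<times> 's)"
  where "kron_mat A B = (\<chi> p q. A $ fst p $ fst q * B $ snd p $ snd q)"

definition kron_vec :: "real^'r \<Rightarrow> real^'s \<Rightarrow> real^('r \<times> 's)"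
  where "kron_vec u v = (\<chi> p. u $ fst p * v $ snd p)"

definition sel_mat :: "('k::finite \<Rightarrow> 'N::finite) \<Rightarrow> real^('N \<times> 'k)^'k"
  where "sel_mat own = (\<chi> k q. if q = (own k, k) then 1 else 0)"

text \<open>
  The matrix removing block i from the i-th estimate, for all i. The rows that belong to the
  removed coordinates, i.e. to the pairs (i, k) with own k = i, are kept as zero rows instead of
  being deleted. In the dynamics this matrix only occurs in the product (transpose S) (- c S Lx x), which is unaffected.
\<close>

definition rem_mat :: "('k::finite \<Rightarrow> 'N::finite) \<Rightarrow> real^('N \<times> 'k)^('N \<times> 'k)"
  where "rem_mat own = (\<chi> p q. if p = q \<and> own (snd p) \<noteq> fst p then 1 else 0)"

text \<open>
  A is the full m-by-n constraint matrix; its part with respect to agent i consists of the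
  columns k with own k = i.
\<close>

definition diag_blocks :: "('k::finite \<Rightarrow> 'N::finite) \<Rightarrow> real^'k^'m \<Rightarrow> real^'k^('N \<times> 'm)"
  where "diag_blocks own A = (\<chi> p k. if own k = fst p then A $ snd p $ k else 0)"

definition stack_vec :: "('N::finite \<Rightarrow> real^'m) \<Rightarrow> real^('N \<times> 'm)"
  where "stack_vec b = (\<chi> p. b (fst p) $ snd p)"

definition estimate :: "real^('N::finite \<times> 'k) \<Rightarrow> 'N \<Rightarrow> real^'k"
  where "estimate X i = (\<chi> k. X $ (i, k))"


definition grad :: "(real^'k \<Rightarrow> real) \<Rightarrow> real^'k \<Rightarrow> real^'k"
  where "grad f x = (THE D. GDERIV f x :> D)"

definition continuously_differentiable :: "(real^'k \<Rightarrow> real) \<Rightarrow> bool"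
  where "continuously_differentiable f \<longleftrightarrow>
    (\<forall>x. f differentiable (at x)) \<and> continuous_on UNIV (grad f)"

text \<open>The gradient of J i in the variable of agent i is block i of the full gradient of J i.\<close>

definition pseudo_grad :: "('k::finite \<Rightarrow> 'N::finite) \<Rightarrow> ('N \<Rightarrow> real^'k \<Rightarrow> real) \<Rightarrow> real^'k \<Rightarrow> real^'k"
  where "pseudo_grad own J x = (\<chi> k. grad (J (own k)) x $ k)"

definition ext_pseudo_grad ::
    "('k::finite \<Rightarrow> 'N::finite) \<Rightarrow> ('N \<Rightarrow> real^'k \<Rightarrow> real) \<Rightarrow> real^('N \<times> 'k) \<Rightarrow> real^'k"
  where "ext_pseudo_grad own J X = (\<chi> k. grad (J (own k)) (estimate X (own k)) $ k)"


definition laplacian :: "real^'N^'N \<Rightarrow> real^'N^'N"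
  where "laplacian W = (\<chi> i j. if i = j then (W *v 1) $ i else 0) - W"

definition eigenspace :: "real^'N^'N \<Rightarrow> real \<Rightarrow> (real^'N) set"
  where "eigenspace M e = {v. M *v v = e *\<^sub>R v}"

definition eigenvalues :: "real^'N^'N \<Rightarrow> real set"
  where "eigenvalues M = {e. \<exists>v. v \<noteq> 0 \<and> M *v v = e *\<^sub>R v}"

text \<open>
  For symmetric M: the list of eigenvalues in increasing order, each repeated as often as its
  multiplicity (for a symmetric matrix, geometric and algebraic multiplicity agree).
\<close>

definition sorted_eigenvalues :: "real^'N^'N \<Rightarrow> real list"
  where "sorted_eigenvalues M =
    sorted_list_of_multiset (\<Sum>e\<in>eigenvalues M. replicate_mset (dim (eigenspace M e)) e)"

definition second_eigenvalue :: "real^'N^'N \<Rightarrow> real"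
  where "second_eigenvalue M = sorted_eigenvalues M ! 1"


text \<open>
  The condition on the supremum is written pointwise because a real-valued supremum carries no
  information when the set is unbounded.
\<close>

definition normal_cone :: "'a::euclidean_space set \<Rightarrow> 'a \<Rightarrow> 'a set"
  where "normal_cone S x = (if x \<in> S then {v. \<forall>y\<in>S. v \<bullet> (y - x) \<le> 0} else {})"

text \<open>
  The defining formula of the tangent cone is used at every point, also outside S.
  Solutions are therefore not required to stay in S by definition.
\<close>

definition tangent_cone :: "'a::euclidean_space set \<Rightarrow> 'a \<Rightarrow> 'a set"
  where "tangent_cone S x = closure (\<Union>\<delta>\<in>{0<..}. (\<lambda>y. (1 / \<delta>) *\<^sub>R (y - x)) ` S)"

definition tangent_proj :: "'a::euclidean_space set \<Rightarrow> 'a \<Rightarrow> 'a \<Rightarrow> 'a"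
  where "tangent_proj S x v = closest_point (tangent_cone S x) v"

text \<open>Vectors of real^'q are ordered componentwise.\<close>

definition nonneg_orthant :: "(real^'q) set"
  where "nonneg_orthant = {v. 0 \<le> v}"


definition feasible_set ::
    "('k::finite \<Rightarrow> 'N::finite) \<Rightarrow> ('N \<Rightarrow> (real^'k) set) \<Rightarrow> real^'k^'m \<Rightarrow> ('N::finite \<Rightarrow> real^'m) \<Rightarrow> (real^'k) set"
  where "feasible_set own \<Omega>s A b = stack_set own \<Omega>s \<inter> {x. A *v x \<le> (\<Sum>i\<in>UNIV. b i)}"

text \<open>
  Slater's constraint qualification for affine inequality constraints: a feasible point in the
  relative interior of the abstract constraint set. It is implied by the existence of a point
  of the set at which all the affine inequalities are strict.
\<close>

definition slater ::
    "('k::finite \<Rightarrow> 'N::finite) \<Rightarrow> ('N \<Rightarrow> (real^'k) set) \<Rightarrow> real^'k^'m \<Rightarrow> ('N::finite \<Rightarrow> real^'m) \<Rightarrow> bool"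
  where "slater own \<Omega>s A b \<longleftrightarrow>
    (\<exists>x\<in>rel_interior (stack_set own \<Omega>s). A *v x \<le> (\<Sum>i\<in>UNIV. b i))"

definition v_GNE ::
    "('k::finite \<Rightarrow> 'N::finite) \<Rightarrow> ('N \<Rightarrow> real^'k \<Rightarrow> real) \<Rightarrow> ('N \<Rightarrow> (real^'k) set) \<Rightarrow> real^'k^'m \<Rightarrow>
     ('N::finite \<Rightarrow> real^'m) \<Rightarrow> real^'k \<Rightarrow> bool"
  where "v_GNE own J \<Omega>s A b x \<longleftrightarrow>
    x \<in> feasible_set own \<Omega>s A b \<and>
    (\<forall>y\<in>feasible_set own \<Omega>s A b. 0 \<le> pseudo_grad own J x \<bullet> (y - x))"

definition KKT ::
    "('k::finite \<Rightarrow> 'N::finite) \<Rightarrow> ('N \<Rightarrow> real^'k \<Rightarrow> real) \<Rightarrow> ('N \<Rightarrow> (real^'k) set) \<Rightarrow> real^'k^'m \<Rightarrow>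
     ('N::finite \<Rightarrow> real^'m) \<Rightarrow> real^'k \<Rightarrow> real^'m \<Rightarrow> bool"
  where "KKT own J \<Omega>s A b x l \<longleftrightarrow>
    0 \<in> (\<lambda>v. pseudo_grad own J x + transpose A *v l + v) ` normal_cone (stack_set own \<Omega>s) x \<and>
    0 \<in> (\<lambda>v. - (A *v x - (\<Sum>i\<in>UNIV. b i)) + v) ` normal_cone nonneg_orthant l"


type_synonym ('N, 'k, 'm) state =
  "(real^('N \<times> 'k)) \<times> (real^('N \<times> 'm)) \<times> (real^('N \<times> 'm))"

definition state_set ::
    "('k::finite \<Rightarrow> 'N::finite) \<Rightarrow> ('N \<Rightarrow> (real^'k) set) \<Rightarrow> ('N, 'k, 'm::finite) state set"
  where "state_set own \<Omega>s =
    {X. sel_mat own *v X \<in> stack_set own \<Omega>s} \<times> UNIV \<times> nonneg_orthant"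

text \<open>In the state (X, Z, Y), Y is the stack of the dual variables lambda.\<close>

definition dynamics ::
    "('k::finite \<Rightarrow> 'N::finite) \<Rightarrow> ('N \<Rightarrow> real^'k \<Rightarrow> real) \<Rightarrow> ('N \<Rightarrow> (real^'k) set) \<Rightarrow>
     real^'k^'m::finite \<Rightarrow> ('N \<Rightarrow> real^'m) \<Rightarrow> real^'N^'N \<Rightarrow> real \<Rightarrow>
     ('N, 'k, 'm) state \<Rightarrow> ('N, 'k, 'm) state"
  where "dynamics own J \<Omega>s A b L c = (\<lambda>(X, Z, Y).
    let R = sel_mat own;
        S = rem_mat own;
        \<Lambda> = diag_blocks own A;
        Lx = kron_mat L (mat 1 :: real^'k^'k);
        Ll = kron_mat L (mat 1 :: real^'m^'m)
    in (transpose R *v tangent_proj (stack_set own \<Omega>s) (R *v X)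
          (- (ext_pseudo_grad own J X + transpose \<Lambda> *v Y + c *\<^sub>R (R *v (Lx *v X))))
        + transpose S *v (- (c *\<^sub>R (S *v (Lx *v X)))),
        Ll *v Y,
        tangent_proj nonneg_orthant Y
          (\<Lambda> *v (R *v X) - stack_vec b - Ll *v Y - Ll *v Z)))"

definition equilibrium ::
    "('k::finite \<Rightarrow> 'N::finite) \<Rightarrow> ('N \<Rightarrow> real^'k \<Rightarrow> real) \<Rightarrow> ('N \<Rightarrow> (real^'k) set) \<Rightarrow>
     real^'k^'m::finite \<Rightarrow> ('N \<Rightarrow> real^'m) \<Rightarrow> real^'N^'N \<Rightarrow> real \<Rightarrow> ('N, 'k, 'm) state \<Rightarrow> bool"
  where "equilibrium own J \<Omega>s A b L c w \<longleftrightarrow>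
    w \<in> state_set own \<Omega>s \<and> dynamics own J \<Omega>s A b L c w = 0"

definition absolutely_continuous_on_interval ::
    "real \<Rightarrow> real \<Rightarrow> (real \<Rightarrow> 'a::real_normed_vector) \<Rightarrow> bool"
  where "absolutely_continuous_on_interval s t f \<longleftrightarrow>
    (\<forall>\<epsilon>>0. \<exists>\<delta>>0. \<forall>(n::nat) u v.
      (\<forall>j<n. s \<le> u j \<and> u j \<le> v j \<and> v j \<le> t) \<and>
      disjoint_family_on (\<lambda>j. {u j<..<v j}) {..<n} \<and>
      (\<Sum>j<n. v j - u j) < \<delta> \<longrightarrow>
      (\<Sum>j<n. norm (f (v j) - f (u j))) < \<epsilon>)"

text \<open>A solution on the half-line of nonnegative times; values at negative times are irrelevant.\<close>

definition caratheodory_solution ::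
    "('a::real_normed_vector \<Rightarrow> 'a) \<Rightarrow> (real \<Rightarrow> 'a) \<Rightarrow> bool"
  where "caratheodory_solution f w \<longleftrightarrow>
    (\<forall>T\<ge>0. absolutely_continuous_on_interval 0 T w) \<and>
    (AE t in lebesgue. 0 \<le> t \<longrightarrow> (w has_vector_derivative f (w t)) (at t within {0..}))"

end

theory Submission
  imports Defs
begin

text \<open>
  On the state set, which is closed and convex, the dynamics are the projection of a Lipschitz
  vector field onto the tangent cone. Such a projected system is solved by the projected Euler
  scheme: doubling of variables makes the halved steps a Cauchy sequence, the limit is a semigroup
  satisfying an evolution variational inequality, and its rescaled speed is monotone, which gives
  differentiability up to countably many times.

  The field is not monotone, but at consensus points the gain condition, combined with the spectral
  gap of the Laplacian, makes it strongly monotone in the decision variables. Hence the distance to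
  every equilibrium decreases along solutions. On an omega-limit orbit the distance is constant, so
  the decisions are frozen and the multipliers agree; they are then driven by a constant vector and,
  being bounded, become stationary along a sequence of times. This gives an equilibrium in the
  omega-limit set, and the decreasing distance to it forces convergence. Equilibria exist by a
  penalty argument for the KKT conditions.
\<close>

section \<open>Absolutely continuous functions\<close>

text \<open>What survives is one-sided: the drift minus its tangential part is a normal vector, and
  two such inequalities bound the growth of the distance between solutions by the Lipschitz constant
  of the drift. This works only inside the state set, while a solution is defined by a formula that
  makes sense outside as well; invariance must therefore be proved for arbitrary solutions before
  uniqueness. A strict Lyapunov function is not at hand: z can be shifted by any consensus vector
  without leaving equilibrium, and the energy decay does not see z at all. Hence the detour through
  limit orbits of constant distance. The bound on c comes from a quadratic form. With a the distance
  of the averaged estimate from the solution and p the norm of the disagreement, the decay rate is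
  at least \<open>\<mu> a^2 - (\<theta>\<^sub>0 + \<theta>) a p + (c \<lambda>2 - \<theta>)
  p^2\<close>, and the gain condition says exactly that this form is positive definite.\<close>

abbreviation "ac_on \<equiv> absolutely_continuous_on_interval"

abbreviation small_intervals :: "real \<Rightarrow> real \<Rightarrow> real \<Rightarrow> nat \<Rightarrow> (nat \<Rightarrow> real) \<Rightarrow> (nat \<Rightarrow> real) \<Rightarrow> bool"
  where "small_intervals s t d n u v \<equiv> (\<forall>j<n. s \<le> u j \<and> u j \<le> v j \<and> v j \<le> t) \<and>
    disjoint_family_on (\<lambda>j. {u j<..<v j}) {..<n} \<and> (\<Sum>j<n. v j - u j) < d"

text \<open>Serves the composites met later, such as squared norms and scaled differences: these are
  Lipschitz in the curve only on bounded sets, so the bound is required only between values taken on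
  the interval. The extra term \<open>v - u\<close> admits explicit dependence on time.\<close>

lemma ac_Lipschitz_pullback:
  fixes w :: "real \<Rightarrow> 'a::real_normed_vector" and g :: "real \<Rightarrow> 'b::real_normed_vector"
  assumes ac: "ac_on s t w"
    and C: "\<And>u v. s \<le> u \<Longrightarrow> u \<le> v \<Longrightarrow> v \<le> t \<Longrightarrow> norm (g v - g u) \<le> C * (norm (w v - w u) + (v - u))"
  shows "ac_on s t g"
  unfolding absolutely_continuous_on_interval_def
proof (intro allI impI)
  fix e :: real assume e: "0 < e"
  \<comment> \<open>\<open>C\<close> may be zero or negative; \<open>D\<close> is positive, so that
    \<open>e\<close> can be divided by it.\<close>
  define D where "D = max C 1"
  have D: "D > 0" "C \<le> D" unfolding D_def by auto
  have "e / (2 * D) > 0" using e D by simp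
  then obtain d where d: "d > 0"
    "\<And>n u v. small_intervals s t d n u v \<Longrightarrow>
      (\<Sum>j<n. norm (w (v j) - w (u j))) < e / (2 * D)"
    using ac unfolding absolutely_continuous_on_interval_def by blast
  show "\<exists>d>0. \<forall>n u v. small_intervals s t d n u v \<longrightarrow>
      (\<Sum>j<n. norm (g (v j) - g (u j))) < e"
  proof (intro exI[of _ "min d (e / (2 * D))"] conjI allI impI)
    show "0 < min d (e / (2 * D))" using d e D by simp
  next
    fix n :: nat and u v
    assume a: "small_intervals s t (min d (e / (2 * D))) n u v"
    have "(\<Sum>j<n. norm (g (v j) - g (u j))) \<le> (\<Sum>j<n. D * (norm (w (v j) - w (u j)) + (v j - u j)))"
    proof (rule sum_mono)
      fix j assume "j \<in> {..<n}"
      then have "norm (g (v j) - g (u j)) \<le> C * (norm (w (v j) - w (u j)) + (v j - u j))"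
        using a C by auto
      also have "\<dots> \<le> D * (norm (w (v j) - w (u j)) + (v j - u j))"
        using a \<open>j \<in> {..<n}\<close> D by (intro mult_right_mono) auto
      finally show "norm (g (v j) - g (u j)) \<le> D * (norm (w (v j) - w (u j)) + (v j - u j))" .
    qed
    also have "\<dots> = D * ((\<Sum>j<n. norm (w (v j) - w (u j))) + (\<Sum>j<n. v j - u j))"
      unfolding sum_distrib_left[symmetric] sum.distrib ..
    also have "\<dots> < D * (e / (2 * D) + e / (2 * D))"
      using d(2)[of n u v] a D by (intro mult_strict_left_mono add_strict_mono) auto
    also have "\<dots> = e" using D by simp
    finally show "(\<Sum>j<n. norm (g (v j) - g (u j))) < e" .
  qed
qed

lemma ac_Lipschitz:
  fixes g :: "real \<Rightarrow> 'b::real_normed_vector"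
  assumes "\<And>u v. s \<le> u \<Longrightarrow> u \<le> v \<Longrightarrow> v \<le> t \<Longrightarrow> norm (g v - g u) \<le> C * (v - u)"
  shows "ac_on s t g"
proof (rule ac_Lipschitz_pullback)
  show "ac_on s t (\<lambda>x. 0::real)"
    unfolding absolutely_continuous_on_interval_def by (auto intro!: exI[of _ 1])
qed (use assms in auto)

lemma ac_Pair:
  assumes u: "ac_on s t u" and w: "ac_on s t w"
  shows "ac_on s t (\<lambda>x. (u x, w x))"
  unfolding absolutely_continuous_on_interval_def
proof (intro allI impI)
  fix e :: real assume "e > 0"
  then have e: "e / 2 > 0" by simp
  obtain d1 where d1: "d1 > 0" "\<And>n a b. small_intervals s t d1 n a b \<Longrightarrow>
      (\<Sum>j<n. norm (u (b j) - u (a j))) < e / 2"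
    using u e unfolding absolutely_continuous_on_interval_def by meson
  obtain d2 where d2: "d2 > 0" "\<And>n a b. small_intervals s t d2 n a b \<Longrightarrow>
      (\<Sum>j<n. norm (w (b j) - w (a j))) < e / 2"
    using w e unfolding absolutely_continuous_on_interval_def by meson
  show "\<exists>d>0. \<forall>n a b. small_intervals s t d n a b \<longrightarrow>
      (\<Sum>j<n. norm ((u (b j), w (b j)) - (u (a j), w (a j)))) < e"
  proof (intro exI[of _ "min d1 d2"] conjI allI impI)
    fix n :: nat and a b
    assume *: "small_intervals s t (min d1 d2) n a b"
    have "(\<Sum>j<n. norm ((u (b j), w (b j)) - (u (a j), w (a j))))
        \<le> (\<Sum>j<n. norm (u (b j) - u (a j)) + norm (w (b j) - w (a j)))"
      by (intro sum_mono) (simp add: norm_Pair_le)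
    also have "\<dots> < e" using d1(2)[of n a b] d2(2)[of n a b] * by (simp add: sum.distrib)
    finally show "(\<Sum>j<n. norm ((u (b j), w (b j)) - (u (a j), w (a j)))) < e" .
  qed (use d1 d2 in simp)
qed

lemma ac_mono_interval:
  assumes ac: "ac_on a b f" and st: "a \<le> s" "t \<le> b"
  shows "ac_on s t f"
  unfolding absolutely_continuous_on_interval_def
proof (intro allI impI)
  fix e :: real assume "0 < e"
  then obtain d where d: "d > 0" "\<And>n u v. small_intervals a b d n u v \<Longrightarrow>
    (\<Sum>j<n. norm (f (v j) - f (u j))) < e"
    using ac unfolding absolutely_continuous_on_interval_def by meson
  show "\<exists>d>0. \<forall>n u v. small_intervals s t d n u v \<longrightarrow>
    (\<Sum>j<n. norm (f (v j) - f (u j))) < e"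
  proof (intro exI[of _ d] conjI allI impI d(1))
    fix n :: nat and u v
    assume *: "small_intervals s t d n u v"
    have "a \<le> u j \<and> u j \<le> v j \<and> v j \<le> b" if "j < n" for j
    proof -
      have "s \<le> u j" "v j \<le> t" "u j \<le> v j" using * that by blast+
      then show ?thesis using st by linarith
    qed
    then show "(\<Sum>j<n. norm (f (v j) - f (u j))) < e" using * by (intro d(2)) blast
  qed
qed

lemma ac_imp_continuous_on:
  assumes ac: "ac_on s t w"
  shows "continuous_on {s..t} w"
proof -
  { fix x e :: real assume x: "x \<in> {s..t}" and e: "e > 0"
    obtain d where d: "d > 0"
    "\<And>n u v. small_intervals s t d n u v \<Longrightarrow>
      (\<Sum>j<n. norm (w (v j) - w (u j))) < e"
      using ac e unfolding absolutely_continuous_on_interval_def by meson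
    have *: "norm (w v - w u) < e" if "s \<le> u" "u \<le> v" "v \<le> t" "v - u < d" for u v
      using d(2)[of "Suc 0" "\<lambda>_. u" "\<lambda>_. v"] that by (simp add: disjoint_family_on_def)
    have "dist (w y) (w x) < e" if "y \<in> {s..t}" "dist y x < d" for y
    proof (cases "y \<le> x")
      case True
      then show ?thesis using *[of y x] that x by (simp add: dist_norm norm_minus_commute)
    next
      case False
      then show ?thesis using *[of x y] that x by (simp add: dist_norm)
    qed
    then have "\<exists>d>0. \<forall>y\<in>{s..t}. dist y x < d \<longrightarrow> dist (w y) (w x) < e" using d(1) by blast }
  then show ?thesis unfolding continuous_on_iff by blast
qed

lemma ac_bounded:
  fixes w :: "real \<Rightarrow> 'a::real_normed_vector"
  assumes ac: "ac_on s t w"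
  obtains B where "B > 0" "\<And>x. x \<in> {s..t} \<Longrightarrow> norm (w x) \<le> B"
proof -
  have "bounded (w ` {s..t})"
    by (intro compact_imp_bounded compact_continuous_image ac_imp_continuous_on ac compact_Icc)
  then show ?thesis using that by (auto simp: bounded_pos)
qed

text \<open>Off the exceptional null set the derivative controls the increments of a gauge-fine
  division; the intervals tagged in the null set have small total length, so absolute continuity
  controls their contribution.\<close>

lemma ac_nonincreasing:
  fixes f :: "real \<Rightarrow> real"
  assumes ac: "ac_on a b f" and ab: "a \<le> b"
    and N: "N \<in> null_sets lebesgue"
    and D: "\<And>t. t \<in> {a..b} - N \<Longrightarrow> \<exists>D\<le>0. (f has_vector_derivative D) (at t within {a..b})"
  shows "f b \<le> f a"
proof (rule field_le_epsilon)
  \<comment> \<open>The error is split: \<open>e * (b - a)\<close> goes to the intervals tagged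
    outside \<open>N\<close>, one further \<open>e\<close> to those tagged in
    \<open>N\<close>.\<close>
  fix e0 :: real assume e0: "e0 > 0"
  define e where "e = e0 / (b - a + 1)"
  have e: "e > 0" using e0 ab unfolding e_def by simp
  have "e * (b - a + 1) = e0" using ab unfolding e_def by simp
  then have ee: "e * (b - a) + e = e0" by (simp add: distrib_left)
  obtain d where d: "d > 0"
    "\<And>n u v. small_intervals a b d n u v \<Longrightarrow>
      (\<Sum>j<n. norm (f (v j) - f (u j))) < e"
    using ac e unfolding absolutely_continuous_on_interval_def by meson
  obtain U where U': "open U" "N \<subseteq> U" "U - N \<in> lmeasurable" "emeasure lebesgue (U - N) < ennreal d"
    using sets_lebesgue_outer_open[OF _ d(1), of N] N by blast
  have "emeasure lebesgue U = emeasure lebesgue (U - N)"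
    using N U'(1) by (intro emeasure_Diff_null_set[symmetric]) auto
  then have "emeasure lebesgue U < ennreal d" using U' by simp
  then have "emeasure lebesgue U < \<infinity>" "enn2real (emeasure lebesgue U) < d"
    using d(1) by (cases "emeasure lebesgue U"; simp add: ennreal_less_iff)+
  then have U: "open U" "N \<subseteq> U" "U \<in> lmeasurable" "measure lebesgue U < d"
    using U'(1,2) by (auto simp: fmeasurable_def measure_def)
  \<comment> \<open>The gauge: at a tag in \<open>N\<close> the ball stays in \<open>U\<close>;
    elsewhere the nonpositive derivative gives increment bounds on either side of the tag, which are
    added over the two halves of an interval.\<close>
  have "\<exists>r>0. (t \<in> N \<longrightarrow> ball t r \<subseteq> U) \<and>
      (t \<in> {a..b} - N \<longrightarrow> (\<forall>y\<in>{a..b}. \<bar>y - t\<bar> < r \<longrightarrow> (y \<ge> t \<longrightarrow> f y - f t \<le> e * (y - t)) \<and>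
          (y \<le> t \<longrightarrow> f t - f y \<le> e * (t - y))))" for t
  proof (cases "t \<in> N")
    case True
    then show ?thesis using U(1,2) by (meson openE subsetD DiffE)
  next
    case False
    show ?thesis
    proof (cases "t \<in> {a..b}")
      case True
      obtain D where D: "D \<le> 0" "(f has_vector_derivative D) (at t within {a..b})"
        using D True False by blast
      then have "\<exists>r>0. \<forall>y\<in>{a..b}. norm (y - t) < r \<longrightarrow> norm (f y - f t - (y - t) *\<^sub>R D) \<le> e * norm (y - t)"
        using e unfolding has_vector_derivative_def has_derivative_within_alt by blast
      then obtain r where r: "r > 0" "\<And>y. y \<in> {a..b} \<Longrightarrow> \<bar>y - t\<bar> < r \<Longrightarrow> \<bar>f y - f t - (y - t) * D\<bar> \<le> e * \<bar>y - t\<bar>"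
        by auto
      have "(y \<ge> t \<longrightarrow> f y - f t \<le> e * (y - t)) \<and> (y \<le> t \<longrightarrow> f t - f y \<le> e * (t - y))"
        if "y \<in> {a..b}" "\<bar>y - t\<bar> < r" for y
      proof (intro conjI impI)
        assume "y \<ge> t"
        then have "(y - t) * D \<le> 0" using D by (simp add: mult_nonneg_nonpos)
        then show "f y - f t \<le> e * (y - t)" using r(2)[OF that] \<open>y \<ge> t\<close> by auto
      next
        assume "y \<le> t"
        then have "(y - t) * D \<ge> 0" using D by (simp add: mult_nonpos_nonpos)
        then show "f t - f y \<le> e * (t - y)" using r(2)[OF that] \<open>y \<le> t\<close> by auto
      qed
      then show ?thesis using r False by blast
    next
      case False
      then show ?thesis using \<open>t \<notin> N\<close> by (auto intro: exI[of _ 1])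
    qed
  qed
  then obtain r where r: "\<And>t. r t > 0" "\<And>t. t \<in> N \<Longrightarrow> ball t (r t) \<subseteq> U"
    "\<And>t y. t \<in> {a..b} - N \<Longrightarrow> y \<in> {a..b} \<Longrightarrow> \<bar>y - t\<bar> < r t \<Longrightarrow> y \<ge> t \<Longrightarrow> f y - f t \<le> e * (y - t)"
    "\<And>t y. t \<in> {a..b} - N \<Longrightarrow> y \<in> {a..b} \<Longrightarrow> \<bar>y - t\<bar> < r t \<Longrightarrow> y \<le> t \<Longrightarrow> f t - f y \<le> e * (t - y)"
    by metis
  have "gauge (\<lambda>t. ball t (r t))" using r(1) by (auto simp: gauge_def)
  then obtain p where p: "p tagged_division_of {a..b}" "(\<lambda>t. ball t (r t)) fine p"
    using fine_division_exists_real by blast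
  have fin: "finite p" using p by blast
  have K: "\<exists>u v. K = {u..v} \<and> a \<le> u \<and> u \<le> t \<and> t \<le> v \<and> v \<le> b \<and> {u..v} \<subseteq> ball t (r t)" if tK: "(t, K) \<in> p" for t K
  proof -
    have "t \<in> K" "K \<subseteq> {a..b}" "\<exists>u v. K = cbox u v"
      using p(1) tK by (auto simp: tagged_division_of_def tagged_partial_division_of_def)
    moreover have "K \<subseteq> ball t (r t)" using fineD[OF p(2) tK] by simp
    ultimately obtain u v where "K = {u..v}" "t \<in> {u..v}" "{u..v} \<subseteq> {a..b}" "{u..v} \<subseteq> ball t (r t)"
      by auto
    then show ?thesis by (intro exI[of _ u] exI[of _ v]) auto
  qed
  define p1 where "p1 = {q \<in> p. fst q \<in> N}"
  define p2 where "p2 = {q \<in> p. fst q \<notin> N}"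
  have p12: "p = p1 \<union> p2" "p1 \<inter> p2 = {}" "finite p1" "finite p2"
    using fin unfolding p1_def p2_def by auto
  have tot: "f b - f a = (\<Sum>(t, K)\<in>p. f (Sup K) - f (Inf K))"
    using additive_tagged_division_1[OF ab p(1), of f] by simp
  have totid: "b - a = (\<Sum>(t, K)\<in>p. Sup K - Inf K)"
    using additive_tagged_division_1[OF ab p(1), of "\<lambda>x. x"] by simp
  have s2: "(\<Sum>(t, K)\<in>p2. f (Sup K) - f (Inf K)) \<le> (\<Sum>(t, K)\<in>p2. e * (Sup K - Inf K))"
  proof (rule sum_mono, clarify)
    fix t K assume tK: "(t, K) \<in> p2"
    then obtain u v where uv: "K = {u..v}" "a \<le> u" "u \<le> t" "t \<le> v" "v \<le> b" "{u..v} \<subseteq> ball t (r t)"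
      using K unfolding p2_def by blast
    have t: "t \<in> {a..b} - N" using tK uv unfolding p2_def by auto
    have "u \<in> ball t (r t)" "v \<in> ball t (r t)" by (intro subsetD[OF uv(6)]; use uv in simp)+
    then have "f v - f t \<le> e * (v - t)" "f t - f u \<le> e * (t - u)"
      using r(3)[OF t, of v] r(4)[OF t, of u] uv by (auto simp: dist_real_def)
    then have "f v - f u \<le> e * (v - u)" by (simp add: algebra_simps)
    then show "f (Sup K) - f (Inf K) \<le> e * (Sup K - Inf K)" using uv by simp
  qed
  have s1: "(\<Sum>(t, K)\<in>p1. f (Sup K) - f (Inf K)) \<le> e"
  proof -
    obtain n :: nat and q where q: "bij_betw q {..<n} p1"
      using ex_bij_betw_nat_finite[OF p12(3)] by (auto simp: lessThan_atLeast0)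
    define u where "u = (\<lambda>j. Inf (snd (q j)))"
    define v where "v = (\<lambda>j. Sup (snd (q j)))"
    have qp: "q j \<in> p1" if "j < n" for j using q that by (auto simp: bij_betw_def)
    have quv: "snd (q j) = {u j..v j} \<and> a \<le> u j \<and> u j \<le> v j \<and> v j \<le> b \<and> {u j..v j} \<subseteq> U" if "j < n" for j
    proof -
      have "(fst (q j), snd (q j)) \<in> p" "fst (q j) \<in> N" using qp[OF that] unfolding p1_def by auto
      with K r(2) obtain u' v' where "snd (q j) = {u'..v'}" "a \<le> u'" "u' \<le> v'" "v' \<le> b" "{u'..v'} \<subseteq> U"
        by (meson order_trans)
      then show ?thesis unfolding u_def v_def by simp
    qed
    have disj: "{u i<..<v i} \<inter> {u j<..<v j} = {}" if "i < n" "j < n" "i \<noteq> j" for i j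
    proof -
      have "q i \<noteq> q j" using q that by (auto simp: bij_betw_def inj_on_def)
      moreover have "q i \<in> p" "q j \<in> p" using qp that unfolding p1_def by auto
      ultimately have "interior (snd (q i)) \<inter> interior (snd (q j)) = {}"
        using p(1) unfolding tagged_division_of_def tagged_partial_division_of_def
        by (metis prod.collapse)
      then show ?thesis using quv that by simp
    qed
    then have disj': "disjoint_family_on (\<lambda>j. {u j<..<v j}) {..<n}"
      by (auto simp: disjoint_family_on_def)
    \<comment> \<open>The open intervals are disjoint parts of \<open>U\<close>, so their total
      length is below the \<open>d\<close> of absolute continuity.\<close>
    have "(\<Sum>j<n. v j - u j) = (\<Sum>j<n. measure lebesgue {u j<..<v j})"
      using quv by (intro sum.cong) auto
    also have "\<dots> = measure lebesgue (\<Union>j\<in>{..<n}. {u j<..<v j})"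
      using disj' quv by (intro measure_finite_Union[symmetric]) (auto simp: top_unique)
    also have "\<dots> \<le> measure lebesgue U"
    proof (intro measure_mono_fmeasurable)
      show "(\<Union>j\<in>{..<n}. {u j<..<v j}) \<subseteq> U" using quv by fastforce
    qed (use U in auto)
    finally have "(\<Sum>j<n. norm (f (v j) - f (u j))) < e" using U(4) quv disj' by (intro d(2)) auto
    moreover have "(\<Sum>(t, K)\<in>p1. f (Sup K) - f (Inf K)) = (\<Sum>j<n. f (v j) - f (u j))"
      unfolding u_def v_def using sum.reindex_bij_betw[OF q, of "\<lambda>q. f (Sup (snd q)) - f (Inf (snd q))"]
      by (simp add: case_prod_beta)
    moreover have "(\<Sum>j<n. f (v j) - f (u j)) \<le> (\<Sum>j<n. norm (f (v j) - f (u j)))"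
      by (intro sum_mono) auto
    ultimately show ?thesis by linarith
  qed
  have "(\<Sum>(t, K)\<in>p2. e * (Sup K - Inf K)) \<le> (\<Sum>(t, K)\<in>p. e * (Sup K - Inf K))"
  proof (rule sum_mono2)
    show "finite p" by fact
    show "p2 \<subseteq> p" using p12 by auto
    fix x assume "x \<in> p - p2"
    then obtain t K' where tK: "x = (t, K')" "(t, K') \<in> p" by (cases x) auto
    from K[OF tK(2)] e show "0 \<le> (case x of (t, K) \<Rightarrow> e * (Sup K - Inf K))" using tK by auto
  qed
  also have "\<dots> = e * (b - a)" unfolding totid by (simp add: sum_distrib_left case_prod_beta)
  finally have "f b - f a \<le> e + e * (b - a)"
    using tot s1 s2 p12 by (simp add: sum.union_disjoint)
  then show "f b \<le> f a + e0" using ee by linarith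
qed

section \<open>Tangent cones and projections\<close>

lemma tangent_cone_eq:
  "tangent_cone S x = closure {r *\<^sub>R (y - x) |r y. r > 0 \<and> y \<in> S}"
proof -
  have "(\<Union>\<delta>\<in>{0<..}. (\<lambda>y. (1 / \<delta>) *\<^sub>R (y - x)) ` S) = {r *\<^sub>R (y - x) |r y. r > 0 \<and> y \<in> S}"
  proof (intro equalityI subsetI)
    fix v assume "v \<in> {r *\<^sub>R (y - x) |r y. r > 0 \<and> y \<in> S}"
    then obtain r y where "v = r *\<^sub>R (y - x)" "r > 0" "y \<in> S" by auto
    then have "v \<in> (\<lambda>y. (1 / (1 / r)) *\<^sub>R (y - x)) ` S" "1 / r \<in> {0<..}" by auto
    then show "v \<in> (\<Union>\<delta>\<in>{0<..}. (\<lambda>y. (1 / \<delta>) *\<^sub>R (y - x)) ` S)" by blast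
  next
    fix v assume "v \<in> (\<Union>\<delta>\<in>{0<..}. (\<lambda>y. (1 / \<delta>) *\<^sub>R (y - x)) ` S)"
    then obtain \<delta> y where "\<delta> > 0" "y \<in> S" "v = (1 / \<delta>) *\<^sub>R (y - x)" by auto
    then show "v \<in> {r *\<^sub>R (y - x) |r y. r > 0 \<and> y \<in> S}"
      by (intro CollectI exI[of _ "1 / \<delta>"] exI[of _ y]) auto
  qed
  then show ?thesis unfolding tangent_cone_def by simp
qed

lemma closed_tangent_cone: "closed (tangent_cone S x)"
  by (simp add: tangent_cone_def)

lemma tangent_cone_direction:
  assumes "y \<in> S" "r > 0" shows "r *\<^sub>R (y - x) \<in> tangent_cone S x"
  unfolding tangent_cone_eq using assms by (intro subsetD[OF closure_subset]) auto

lemma tangent_cone_nonempty: "S \<noteq> {} \<Longrightarrow> tangent_cone S x \<noteq> {}"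
  using tangent_cone_direction[of _ S 1 x] by auto

lemma tangent_cone_scaleR:
  assumes v: "v \<in> tangent_cone S x" and c: "c \<ge> 0" and S: "S \<noteq> {}"
  shows "c *\<^sub>R v \<in> tangent_cone S x"
proof (cases "c = 0")
  case True
  \<comment> \<open>When \<open>x\<close> lies outside \<open>S\<close>, zero is not a positive
    multiple of any \<open>y - x\<close>; it enters only through the closure.\<close>
  obtain y where y: "y \<in> S" using S by auto
  have "(\<lambda>n. inverse (real (Suc n)) *\<^sub>R (y - x)) \<longlonglongrightarrow> 0 *\<^sub>R (y - x)"
    by (intro tendsto_intros LIMSEQ_inverse_real_of_nat)
  moreover have "inverse (real (Suc n)) *\<^sub>R (y - x) \<in> tangent_cone S x" for n
    by (intro tangent_cone_direction y) simp
  ultimately have "0 *\<^sub>R (y - x) \<in> tangent_cone S x"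
    by (intro Lim_in_closed_set[OF closed_tangent_cone _ trivial_limit_sequentially]) auto
  then show ?thesis using True by simp
next
  case False
  then have c: "c > 0" using c by simp
  let ?U = "{r *\<^sub>R (y - x) |r y. r > 0 \<and> y \<in> S}"
  have "(\<lambda>u. c *\<^sub>R u) ` ?U \<subseteq> ?U"
  proof clarify
    fix r y assume "(0::real) < r" "y \<in> S"
    then show "\<exists>r' y'. c *\<^sub>R r *\<^sub>R (y - x) = r' *\<^sub>R (y' - x) \<and> 0 < r' \<and> y' \<in> S"
      using c by (intro exI[of _ "c * r"] exI[of _ y]) auto
  qed
  then have "closure ((\<lambda>u. c *\<^sub>R u) ` ?U) \<subseteq> closure ?U" by (rule closure_mono)
  then have "(\<lambda>u. c *\<^sub>R u) ` closure ?U \<subseteq> closure ?U"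
    using closure_scaleR[of c ?U] by simp
  then show ?thesis using v unfolding tangent_cone_eq by auto
qed

lemma convex_tangent_cone:
  assumes "convex S" shows "convex (tangent_cone S x)"
  unfolding tangent_cone_eq
proof (intro convex_closure convexI)
  fix a b u v :: real and p q
  assume p: "p \<in> {r *\<^sub>R (y - x) |r y. r > 0 \<and> y \<in> S}" and q: "q \<in> {r *\<^sub>R (y - x) |r y. r > 0 \<and> y \<in> S}"
    and uv: "0 \<le> u" "0 \<le> v" "u + v = 1"
  from p q obtain r y s z where pq: "p = r *\<^sub>R (y - x)" "r > 0" "y \<in> S" "q = s *\<^sub>R (z - x)" "s > 0" "z \<in> S"
    by auto
  \<comment> \<open>\<open>t\<close> is the total weight, and \<open>w\<close> is the convex
    combination of \<open>y\<close> and \<open>z\<close> for which the given point becomes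
    \<open>t *\<^sub>R (w - x)\<close>.\<close>
  define t where "t = u * r + v * s"
  have t: "t > 0" unfolding t_def
  proof (cases "u = 0")
    case True then show "u * r + v * s > 0" using uv pq by simp
  next
    case False then show "u * r + v * s > 0" using uv pq by (intro add_pos_nonneg) auto
  qed
  define w where "w = (u * r / t) *\<^sub>R y + (v * s / t) *\<^sub>R z"
  have "w \<in> S" unfolding w_def
  proof (rule convexD[OF assms pq(3,6)])
    show "u * r / t + v * s / t = 1" using t unfolding t_def by (simp add: add_divide_distrib[symmetric])
  qed (use uv pq t in auto)
  moreover have "u *\<^sub>R p + v *\<^sub>R q = t *\<^sub>R (w - x)"
  proof -
    have "t *\<^sub>R w = (u * r) *\<^sub>R y + (v * s) *\<^sub>R z" using t unfolding w_def by (simp add: scaleR_right_distrib)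
    then show ?thesis unfolding pq by (simp add: t_def algebra_simps)
  qed
  ultimately show "u *\<^sub>R p + v *\<^sub>R q \<in> {r *\<^sub>R (y - x) |r y. r > 0 \<and> y \<in> S}" using t by blast
qed

lemma tangent_cone_add:
  assumes "convex S" "v \<in> tangent_cone S x" "w \<in> tangent_cone S x"
  shows "v + w \<in> tangent_cone S x"
proof -
  have S: "S \<noteq> {}" using assms(2) by (auto simp: tangent_cone_def)
  have "(1/2) *\<^sub>R v + (1/2) *\<^sub>R w \<in> tangent_cone S x"
    using convex_tangent_cone[OF assms(1)] assms(2,3) by (rule convexD) auto
  then have "2 *\<^sub>R ((1/2) *\<^sub>R v + (1/2) *\<^sub>R w) \<in> tangent_cone S x"
    using S by (intro tangent_cone_scaleR) auto
  then show ?thesis by (simp add: scaleR_right_distrib)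
qed

text \<open>The affine map that sends \<open>x + d\<close> to \<open>y + f d\<close> carries
  \<open>S\<close> into \<open>S'\<close>, so generators of one cone go to generators of the other,
  and continuity extends this to the closures. This embeds the cones of the factors into that of the
  product state set.\<close>

lemma tangent_cone_linear_image:
  assumes f: "bounded_linear f" and S: "\<And>s. s \<in> S \<Longrightarrow> y + f (s - x) \<in> S'"
    and v: "v \<in> tangent_cone S x"
  shows "f v \<in> tangent_cone S' y"
proof -
  interpret f: bounded_linear f by fact
  let ?U = "{r *\<^sub>R (s - x) |r s. r > 0 \<and> s \<in> S}"
  have "f ` closure ?U \<subseteq> closure (f ` ?U)"
    by (intro image_closure_subset continuous_on_closure closure_subset
        linear_continuous_on f order_refl closed_closure)
  also have "\<dots> \<subseteq> tangent_cone S' y" unfolding tangent_cone_eq[of S']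
  proof (intro closure_mono, clarify)
    fix r s assume "(0::real) < r" "s \<in> S"
    then show "\<exists>r' s'. f (r *\<^sub>R (s - x)) = r' *\<^sub>R (s' - y) \<and> 0 < r' \<and> s' \<in> S'"
      using S by (intro exI[of _ r] exI[of _ "y + f (s - x)"]) (auto simp: f.scaleR)
  qed
  finally show ?thesis using v unfolding tangent_cone_eq[of S] by auto
qed

lemma normal_cone_tangent_cone:
  assumes n: "n \<in> normal_cone S x" and v: "v \<in> tangent_cone S x"
  shows "n \<bullet> v \<le> 0"
proof -
  have "closed {v. n \<bullet> v \<le> 0}" by (rule closed_halfspace_le)
  moreover have "{r *\<^sub>R (y - x) |r y. r > 0 \<and> y \<in> S} \<subseteq> {v. n \<bullet> v \<le> 0}"
    using n by (auto simp: normal_cone_def mult_nonneg_nonpos split: if_splits)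
  ultimately have "tangent_cone S x \<subseteq> {v. n \<bullet> v \<le> 0}"
    unfolding tangent_cone_eq by (intro closure_minimal)
  then show ?thesis using v by auto
qed

lemma tangent_proj_in:
  assumes "S \<noteq> {}" shows "tangent_proj S x g \<in> tangent_cone S x"
  unfolding tangent_proj_def
  by (intro closest_point_in_set closed_tangent_cone tangent_cone_nonempty assms)

text \<open>Moreau decomposition. The projection onto a cone can be tested with the multiples 0 and
  2 of itself, which gives orthogonality; the remaining inequality on the cone then says that the
  residual is normal.\<close>

lemma tangent_proj_normal:
  assumes S: "convex S" and x: "x \<in> S"
  shows "g - tangent_proj S x g \<in> normal_cone S x"
    and "(g - tangent_proj S x g) \<bullet> tangent_proj S x g = 0"
proof -
  let ?v = "tangent_proj S x g"
  have ne: "S \<noteq> {}" using x by auto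
  have dot: "(g - ?v) \<bullet> (y - ?v) \<le> 0" if "y \<in> tangent_cone S x" for y
    using closest_point_dot[OF convex_tangent_cone[OF S] closed_tangent_cone that]
    unfolding tangent_proj_def .
  have v: "?v \<in> tangent_cone S x" using ne by (rule tangent_proj_in)
  have "(g - ?v) \<bullet> (0 *\<^sub>R ?v - ?v) \<le> 0" "(g - ?v) \<bullet> (2 *\<^sub>R ?v - ?v) \<le> 0"
    by (intro dot tangent_cone_scaleR v ne; simp)+
  then show orth: "(g - ?v) \<bullet> ?v = 0" by (simp add: inner_diff_right)
  have "(g - ?v) \<bullet> (y - x) \<le> 0" if "y \<in> S" for y
    using dot[OF tangent_cone_direction[OF that, of 1 x]] orth by (simp add: inner_diff_right)
  then show "g - ?v \<in> normal_cone S x" using x by (simp add: normal_cone_def)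
qed

text \<open>Converse of the Moreau decomposition: tangency, normality of the residual and
  orthogonality identify the projection, so a candidate assembled from blocks is recognised without
  computing a closest point.\<close>

lemma tangent_proj_unique:
  assumes S: "convex S" and v: "v \<in> tangent_cone S x"
    and n: "g - v \<in> normal_cone S x" and o: "(g - v) \<bullet> v = 0"
  shows "tangent_proj S x g = v"
  unfolding tangent_proj_def
proof (rule closest_point_unique[OF convex_tangent_cone[OF S] closed_tangent_cone v, symmetric], intro ballI)
  fix y assume y: "y \<in> tangent_cone S x"
  have "(g - v) \<bullet> (y - v) \<le> 0"
    using normal_cone_tangent_cone[OF n y] o by (simp add: inner_diff_right)
  moreover have "(norm (g - y))\<^sup>2 = (norm (g - v))\<^sup>2 - 2 * ((g - v) \<bullet> (y - v)) + (norm (y - v))\<^sup>2"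
    by (simp add: power2_norm_eq_inner algebra_simps inner_commute)
  ultimately have "(norm (g - v))\<^sup>2 \<le> (norm (g - y))\<^sup>2" by (smt (verit) zero_le_power2)
  then show "dist g v \<le> dist g y" by (simp add: dist_norm)
qed

lemma tangent_proj_eq_0_iff:
  assumes "convex S" "x \<in> S"
  shows "tangent_proj S x g = 0 \<longleftrightarrow> g \<in> normal_cone S x"
proof
  assume "tangent_proj S x g = 0"
  then show "g \<in> normal_cone S x" using tangent_proj_normal(1)[OF assms, of g] by simp
next
  assume g: "g \<in> normal_cone S x"
  have "0 \<in> tangent_cone S x" using tangent_cone_direction[OF assms(2), of 1 x] by simp
  then show "tangent_proj S x g = 0" using g by (intro tangent_proj_unique assms) auto
qed

section \<open>Differential inequalities along absolutely continuous curves\<close>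

lemma norm_sq_has_derivative:
  fixes u :: "real \<Rightarrow> 'a::real_inner"
  assumes "(u has_vector_derivative d) (at t within T)"
  shows "((\<lambda>s. (norm (u s))\<^sup>2) has_vector_derivative (2 * (u t \<bullet> d))) (at t within T)"
proof -
  have "((\<lambda>s. u s \<bullet> u s) has_derivative (\<lambda>h. u t \<bullet> (h *\<^sub>R d) + (h *\<^sub>R d) \<bullet> u t)) (at t within T)"
    using assms unfolding has_vector_derivative_def by (intro has_derivative_inner)
  moreover have "u t \<bullet> (h *\<^sub>R d) + (h *\<^sub>R d) \<bullet> u t = h *\<^sub>R (2 * (u t \<bullet> d))" for h
    by (simp add: inner_commute[of d])
  ultimately show ?thesis unfolding has_vector_derivative_def power2_norm_eq_inner by (simp only:)
qed

lemma null_set_of_AE: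
  assumes "AE t in lebesgue. P t"
  obtains N where "N \<in> null_sets lebesgue" "\<And>t. t \<notin> N \<Longrightarrow> P t"
  using assms by (auto elim!: AE_E3)

text \<open>The derivative is taken relative to the half-line and then restricted to the interval;
  the right end point is put into the null set, so that estimates are needed only at times before
  \<open>t\<close>.\<close>

lemma ac_le_of_deriv_le_0:
  fixes f :: "real \<Rightarrow> real"
  assumes ac: "ac_on 0 T f"
    and st: "0 \<le> s" "s \<le> t" "t \<le> T"
    and D: "AE \<tau> in lebesgue. s \<le> \<tau> \<longrightarrow> \<tau> < t \<longrightarrow> (\<exists>D\<le>0. (f has_vector_derivative D) (at \<tau> within {0..}))"
  shows "f t \<le> f s"
proof -
  obtain N where N: "N \<in> null_sets lebesgue"
    "\<And>\<tau>. \<tau> \<notin> N \<Longrightarrow> s \<le> \<tau> \<Longrightarrow> \<tau> < t \<Longrightarrow> \<exists>D\<le>0. (f has_vector_derivative D) (at \<tau> within {0..})"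
    using null_set_of_AE[OF D] by metis
  show ?thesis
  proof (rule ac_nonincreasing[where f = f and a = s and b = t])
    show "ac_on s t f" by (rule ac_mono_interval[OF ac st(1,3)])
    have "{t} \<in> null_sets lebesgue" by (intro countable_imp_null_set_lborel[THEN null_sets_completionI]) auto
    then have "{t} \<union> N \<in> null_sets lebesgue" using N(1) by (rule null_sets.Un)
    then show "insert t N \<in> null_sets lebesgue" by simp
    fix \<tau> assume "\<tau> \<in> {s..t} - insert t N"
    then have "\<tau> \<notin> N" "s \<le> \<tau>" "\<tau> < t" using st by auto
    then obtain D where "D \<le> 0" "(f has_vector_derivative D) (at \<tau> within {0..})" using N(2) by blast
    then show "\<exists>D\<le>0. (f has_vector_derivative D) (at \<tau> within {s..t})"
      using st by (auto intro!: exI[of _ D] intro: has_vector_derivative_within_subset)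
  qed (use st in auto)
qed

text \<open>The squared norm has derivative \<open>2 * (z \<tau> \<bullet> d)\<close>, so it becomes
  nonincreasing after adding \<open>2 * c * \<tau>\<close>. With \<open>c = 0\<close> this yields
  contraction and constancy, with positive \<open>c\<close> strict decay.\<close>

lemma ac_energy_decay:
  fixes z :: "real \<Rightarrow> 'a::real_inner"
  assumes ac: "ac_on 0 T z"
    and st: "0 \<le> s" "s \<le> t" "t \<le> T"
    and D: "AE \<tau> in lebesgue. s \<le> \<tau> \<longrightarrow> \<tau> < t \<longrightarrow>
      (\<exists>d. (z has_vector_derivative d) (at \<tau> within {0..}) \<and> z \<tau> \<bullet> d \<le> - c)"
  shows "(norm (z t))\<^sup>2 + 2 * c * (t - s) \<le> (norm (z s))\<^sup>2"
proof -
  define f where "f \<tau> = (norm (z \<tau>))\<^sup>2 + 2 * c * \<tau>" for \<tau>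
  obtain B where B: "B > 0" "\<And>x. x \<in> {0..T} \<Longrightarrow> norm (z x) \<le> B" using ac_bounded[OF ac] by metis
  have "f t \<le> f s"
  proof (rule ac_le_of_deriv_le_0[where f = f and T = T and s = s and t = t])
    show "ac_on 0 T f"
    proof (rule ac_Lipschitz_pullback[OF ac, where C = "2 * B + 2 * \<bar>c\<bar>"])
      fix u v :: real assume uv: "0 \<le> u" "u \<le> v" "v \<le> T"
      let ?a = "z v" and ?b = "z u"
      have "norm (f v - f u) \<le> \<bar>norm ?a - norm ?b\<bar> * (norm ?a + norm ?b) + 2 * \<bar>c\<bar> * (v - u)"
      proof -
        have "f v - f u = (norm ?a - norm ?b) * (norm ?a + norm ?b) + 2 * c * (v - u)"
          unfolding f_def by (simp add: power2_eq_square algebra_simps)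
        also have "\<bar>\<dots>\<bar> \<le> \<bar>(norm ?a - norm ?b) * (norm ?a + norm ?b)\<bar> + \<bar>2 * c * (v - u)\<bar>" by (rule abs_triangle_ineq)
        finally show ?thesis using uv by (simp add: abs_mult)
      qed
      also have "\<bar>norm ?a - norm ?b\<bar> * (norm ?a + norm ?b) \<le> norm (?a - ?b) * (2 * B)"
        using B(2)[of u] B(2)[of v] uv by (intro mult_mono norm_triangle_ineq3) auto
      also have "norm (?a - ?b) * (2 * B) + 2 * \<bar>c\<bar> * (v - u) \<le> (2 * B + 2 * \<bar>c\<bar>) * (norm (?a - ?b) + (v - u))"
      proof -
        have "0 \<le> 2 * \<bar>c\<bar> * norm (?a - ?b) + 2 * B * (v - u)" using B(1) uv by (intro add_nonneg_nonneg mult_nonneg_nonneg) auto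
        then show ?thesis by (simp add: algebra_simps)
      qed
      finally show "norm (f v - f u) \<le> (2 * B + 2 * \<bar>c\<bar>) * (norm (?a - ?b) + (v - u))" by simp
    qed
    show "AE \<tau> in lebesgue. s \<le> \<tau> \<longrightarrow> \<tau> < t \<longrightarrow> (\<exists>D\<le>0. (f has_vector_derivative D) (at \<tau> within {0..}))"
      using D
    proof (rule AE_mp, intro AE_I2 impI)
      fix \<tau> assume "s \<le> \<tau> \<longrightarrow> \<tau> < t \<longrightarrow> (\<exists>d. (z has_vector_derivative d) (at \<tau> within {0..}) \<and> z \<tau> \<bullet> d \<le> - c)"
        "s \<le> \<tau>" "\<tau> < t"
      then obtain d where d: "(z has_vector_derivative d) (at \<tau> within {0..})" "z \<tau> \<bullet> d \<le> - c" by blast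
      have "((\<lambda>\<tau>. 2 * c * \<tau>) has_vector_derivative 2 * c) (at \<tau> within {0..})"
        by (auto intro!: derivative_eq_intros simp: has_real_derivative_iff_has_vector_derivative[symmetric])
      then have "(f has_vector_derivative (2 * (z \<tau> \<bullet> d) + 2 * c)) (at \<tau> within {0..})"
        unfolding f_def by (intro has_vector_derivative_add norm_sq_has_derivative d)
      then show "\<exists>D\<le>0. (f has_vector_derivative D) (at \<tau> within {0..})"
        using d(2) by (intro exI[of _ "2 * (z \<tau> \<bullet> d) + 2 * c"]) auto
    qed
  qed (use st in auto)
  then show ?thesis unfolding f_def by (simp add: algebra_simps)
qed

text \<open>The distance to S cannot grow along directions of the tangent cone, which is also meaningful
  at points outside S.\<close>

lemma stays_in_closed_convex:
  fixes u :: "real \<Rightarrow> 'a::euclidean_space"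
  assumes S: "closed S" "convex S"
    and ac: "\<And>T. T \<ge> 0 \<Longrightarrow> ac_on 0 T u"
    and D: "AE t in lebesgue. 0 \<le> t \<longrightarrow> (\<exists>d\<in>tangent_cone S (u t). (u has_vector_derivative d) (at t within {0..}))"
    and u0: "u 0 \<in> S" and t: "t \<ge> 0"
  shows "u t \<in> S"
proof -
  have ne: "S \<noteq> {}" using u0 by auto
  define P where "P = closest_point S"
  have P: "P x \<in> S" for x unfolding P_def by (rule closest_point_in_set[OF S(1) ne])
  have Ple: "norm (x - P x) \<le> norm (x - y)" if "y \<in> S" for x y
    unfolding P_def using closest_point_le[OF S(1) that, of x] by (simp add: dist_norm)
  have Plip: "norm (P x - P y) \<le> norm (x - y)" for x y
    unfolding P_def using closest_point_lipschitz[OF S(2,1) ne, of x y] by (simp add: dist_norm)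
  define f where "f s = (norm (u s - P (u s)))\<^sup>2" for s
  obtain B where B: "B > 0" "\<And>s. s \<in> {0..t} \<Longrightarrow> norm (u s) \<le> B" using ac_bounded[OF ac[OF t]] by metis
  \<comment> \<open>The pairing of \<open>x - P x\<close> with \<open>y - x\<close> is the one with
    \<open>y - P x\<close>, which is nonpositive, minus the squared distance. This holds wherever
    \<open>x\<close> lies.\<close>
  have cone: "(x - P x) \<bullet> d \<le> 0" if "d \<in> tangent_cone S x" for x d
  proof -
    have "{r *\<^sub>R (y - x) |r y. r > 0 \<and> y \<in> S} \<subseteq> {v. (x - P x) \<bullet> v \<le> 0}"
    proof clarify
      fix r :: real and y assume "r > 0" "y \<in> S"
      have "(x - P x) \<bullet> (y - P x) \<le> 0"
        using closest_point_dot[OF S(2,1) \<open>y \<in> S\<close>] unfolding P_def .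
      moreover have "(x - P x) \<bullet> (y - x) = (x - P x) \<bullet> (y - P x) - (x - P x) \<bullet> (x - P x)"
        by (simp add: algebra_simps)
      ultimately have "(x - P x) \<bullet> (y - x) \<le> 0" by (smt (verit) inner_ge_zero)
      then show "(x - P x) \<bullet> r *\<^sub>R (y - x) \<le> 0" using \<open>r > 0\<close> by (simp add: mult_nonneg_nonpos)
    qed
    then have "tangent_cone S x \<subseteq> {v. (x - P x) \<bullet> v \<le> 0}"
      unfolding tangent_cone_eq by (intro closure_minimal closed_halfspace_le)
    then show ?thesis using that by auto
  qed
  \<comment> \<open>The squared distance is differentiable everywhere. Its first-order error is at
    most \<open>(norm (y - x))\<^sup>2\<close>: from above by comparing with \<open>P x\<close>,
    from below by comparing with \<open>P y\<close> and using that \<open>P\<close> is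
    nonexpansive.\<close>
  have der: "((\<lambda>x. (norm (x - P x))\<^sup>2) has_derivative (\<lambda>h. 2 * ((x - P x) \<bullet> h))) (at x within X)" for x X
    unfolding has_derivative_within_alt
  proof (intro conjI allI impI)
    show "bounded_linear (\<lambda>h. 2 * ((x - P x) \<bullet> h))"
      by (intro bounded_linear_const_mult bounded_linear_inner_right)
    fix e :: real assume "e > 0"
    have "norm ((norm (y - P y))\<^sup>2 - (norm (x - P x))\<^sup>2 - 2 * ((x - P x) \<bullet> (y - x))) \<le> (norm (y - x))\<^sup>2" for y
    proof -
      have "(norm (y - P y))\<^sup>2 \<le> (norm (y - P x))\<^sup>2" "(norm (x - P x))\<^sup>2 \<le> (norm (x - P y))\<^sup>2"
        by (intro power_mono Ple P norm_ge_zero)+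
      moreover have "(norm (y - P x))\<^sup>2 = (norm (x - P x))\<^sup>2 + 2 * ((x - P x) \<bullet> (y - x)) + (norm (y - x))\<^sup>2"
        by (simp add: power2_norm_eq_inner algebra_simps inner_commute)
      moreover have "(norm (y - P y))\<^sup>2 = (norm (x - P y))\<^sup>2 + 2 * ((x - P x) \<bullet> (y - x))
          - 2 * ((P y - P x) \<bullet> (y - x)) + (norm (y - x))\<^sup>2"
        by (simp add: power2_norm_eq_inner algebra_simps inner_commute)
      moreover have "(P y - P x) \<bullet> (y - x) \<le> norm (y - x) * norm (y - x)"
        using norm_cauchy_schwarz[of "P y - P x" "y - x"] mult_right_mono[OF Plip[of y x] norm_ge_zero[of "y - x"]]
        by linarith
      ultimately show ?thesis by (simp add: power2_eq_square)
    qed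
    moreover have "(norm (y - x))\<^sup>2 \<le> e * norm (y - x)" if "norm (y - x) < e" for y
      using that by (auto simp: power2_eq_square intro: mult_right_mono)
    ultimately show "\<exists>d>0. \<forall>y\<in>X. norm (y - x) < d \<longrightarrow>
        norm ((norm (y - P y))\<^sup>2 - (norm (x - P x))\<^sup>2 - 2 * ((x - P x) \<bullet> (y - x))) \<le> e * norm (y - x)"
      using \<open>e > 0\<close> by (intro exI[of _ e] conjI ballI impI) (blast intro: order_trans)+
  qed
  have "f t \<le> f 0"
  proof (rule ac_le_of_deriv_le_0[where f = f and T = t and s = 0 and t = t])
    show "ac_on 0 t f"
    proof (rule ac_Lipschitz_pullback[OF ac[OF t], where C = "4 * (B + norm (P 0))"])
      fix r s assume rs: "0 \<le> r" "r \<le> s" "s \<le> t"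
      have b: "norm (u q - P (u q)) \<le> 2 * (B + norm (P 0))" if "0 \<le> q" "q \<le> t" for q
      proof -
        have "norm (P (u q) - P 0) \<le> norm (u q - 0)" by (rule Plip)
        moreover have "norm (u q) \<le> B" using B that by simp
        moreover have "norm (P (u q)) \<le> norm (P (u q) - P 0) + norm (P 0)" by norm
        moreover have "norm (u q - P (u q)) \<le> norm (u q) + norm (P (u q))" by norm
        ultimately show ?thesis using norm_ge_zero[of "P 0"] by (smt (verit) diff_zero)
      qed
      let ?a = "u s - P (u s)" and ?b = "u r - P (u r)"
      have d: "\<bar>norm ?a - norm ?b\<bar> \<le> norm (u s - u r)"
      proof -
        have "norm ?a \<le> norm (u s - P (u r))" "norm ?b \<le> norm (u r - P (u s))" by (intro Ple P)+
        then show ?thesis by norm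
      qed
      have "norm (f s - f r) = \<bar>norm ?a - norm ?b\<bar> * (norm ?a + norm ?b)"
        unfolding f_def by (simp add: power2_eq_square square_diff_square_factored abs_mult)
      also have "\<dots> \<le> norm (u s - u r) * (4 * (B + norm (P 0)))"
        using b[of s] b[of r] rs d by (intro mult_mono) auto
      also have "\<dots> \<le> (norm (u s - u r) + (s - r)) * (4 * (B + norm (P 0)))"
        using rs B(1) by (intro mult_right_mono) auto
      finally show "norm (f s - f r) \<le> 4 * (B + norm (P 0)) * (norm (u s - u r) + (s - r))"
        by (simp add: mult.commute)
    qed
    show "AE s in lebesgue. 0 \<le> s \<longrightarrow> s < t \<longrightarrow> (\<exists>D\<le>0. (f has_vector_derivative D) (at s within {0..}))"
      using D
    proof (rule AE_mp, intro AE_I2 impI)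
      fix s assume "0 \<le> s \<longrightarrow> (\<exists>d\<in>tangent_cone S (u s). (u has_vector_derivative d) (at s within {0..}))" "0 \<le> s"
      then obtain d where d: "d \<in> tangent_cone S (u s)" "(u has_vector_derivative d) (at s within {0..})" by blast
      have "((\<lambda>s. (norm (u s - P (u s)))\<^sup>2) has_derivative (\<lambda>h. 2 * ((u s - P (u s)) \<bullet> (h *\<^sub>R d)))) (at s within {0..})"
        using has_derivative_compose[OF d(2)[unfolded has_vector_derivative_def] der] by simp
      then have "(f has_vector_derivative (2 * ((u s - P (u s)) \<bullet> d))) (at s within {0..})"
        unfolding has_vector_derivative_def f_def by (simp add: algebra_simps)
      then show "\<exists>D\<le>0. (f has_vector_derivative D) (at s within {0..})"
        using cone[OF d(1)] by (intro exI[of _ "2 * ((u s - P (u s)) \<bullet> d)"]) auto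
    qed
  qed (use t in auto)
  then have "norm (u t - P (u t)) = 0" using u0 unfolding f_def P_def by (simp add: closest_point_self)
  then show ?thesis using P[of "u t"] by simp
qed

section \<open>Projected Euler scheme\<close>

text \<open>Identifies the limit of difference quotients without compactness. The approximate normal
  inequality, tested along directions into \<open>S\<close>, makes \<open>d \<bullet> v\<close>
  asymptotically at least the squared norm of the projection \<open>v\<close>; the speed bound gives
  the matching upper bound for the norm of \<open>d\<close>. Expanding the square then forces
  \<open>d\<close> to \<open>v\<close>.\<close>

lemma tangent_proj_tendsto:
  fixes d :: "'b \<Rightarrow> 'a::euclidean_space"
  assumes S: "convex S" and x: "x \<in> S"
    and normal: "\<And>s \<epsilon>. s \<in> S \<Longrightarrow> \<epsilon> > 0 \<Longrightarrow> \<forall>\<^sub>F \<tau> in F. (g - d \<tau>) \<bullet> (s - x) < \<epsilon>"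
    and speed: "\<forall>\<^sub>F \<tau> in F. norm (d \<tau>) \<le> b \<tau>" and b: "(b \<longlongrightarrow> norm (tangent_proj S x g)) F"
  shows "(d \<longlongrightarrow> tangent_proj S x g) F"
proof -
  define v where "v = tangent_proj S x g"
  have gv: "(g - v) \<bullet> v = 0" and vT: "v \<in> tangent_cone S x"
    using tangent_proj_normal(2)[OF S x] tangent_proj_in x unfolding v_def by blast+
  have lower: "\<forall>\<^sub>F \<tau> in F. d \<tau> \<bullet> v > (norm v)\<^sup>2 - e" if e: "e > 0" for e
  proof -
    \<comment> \<open>\<open>v\<close> lies only in the closure of the rays, so it is replaced by a
      ray \<open>w\<close>; \<open>B\<close> eventually bounds \<open>g - d \<tau>\<close>, which
      keeps the cost of the replacement at \<open>e / 2\<close>.\<close>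
    define B where "B = norm g + norm v + 1"
    have B: "B > 0" unfolding B_def by (simp add: add_nonneg_pos)
    obtain w where w: "w \<in> {r *\<^sub>R (y - x) |r y. r > 0 \<and> y \<in> S}" "dist w v < e / (2 * B)"
      using vT e B unfolding tangent_cone_eq closure_approachable by (meson divide_pos_pos mult_pos_pos zero_less_numeral)
    then obtain r s where rs: "w = r *\<^sub>R (s - x)" "r > 0" "s \<in> S" by auto
    have "\<forall>\<^sub>F \<tau> in F. b \<tau> < norm v + 1" using order_tendstoD(2)[OF b, of "norm v + 1"] v_def by simp
    moreover have "\<forall>\<^sub>F \<tau> in F. (g - d \<tau>) \<bullet> (s - x) < e / (2 * r)" using rs e by (intro normal) auto
    ultimately show ?thesis using speed
    proof eventually_elim
      case (elim \<tau>)
      have "(g - d \<tau>) \<bullet> v = r * ((g - d \<tau>) \<bullet> (s - x)) + (g - d \<tau>) \<bullet> (v - w)"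
        by (simp add: rs inner_diff_right)
      moreover have "r * ((g - d \<tau>) \<bullet> (s - x)) < e / 2"
        using elim(2) rs(2) by (simp add: field_simps)
      moreover have "(g - d \<tau>) \<bullet> (v - w) \<le> e / 2"
      proof -
        have "norm (g - d \<tau>) \<le> B" using elim norm_triangle_ineq4[of g "d \<tau>"] unfolding B_def by linarith
        moreover have "norm (v - w) \<le> e / (2 * B)" using w(2) by (simp add: dist_norm norm_minus_commute)
        ultimately have "norm (g - d \<tau>) * norm (v - w) \<le> B * (e / (2 * B))" using B by (intro mult_mono) auto
        then show ?thesis using B norm_cauchy_schwarz[of "g - d \<tau>" "v - w"] by simp
      qed
      ultimately have "(g - d \<tau>) \<bullet> v < e" by linarith
      moreover have "g \<bullet> v = (norm v)\<^sup>2" using gv by (simp add: inner_diff_left power2_norm_eq_inner)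
      ultimately show ?case by (simp add: inner_diff_left)
    qed
  qed
  have "((\<lambda>\<tau>. (norm (d \<tau> - v))\<^sup>2) \<longlongrightarrow> 0) F"
  proof (rule tendstoI)
    fix e :: real assume e: "e > 0"
    have "((\<lambda>\<tau>. (b \<tau>)\<^sup>2) \<longlongrightarrow> (norm v)\<^sup>2) F" unfolding v_def by (intro tendsto_intros b)
    then have "\<forall>\<^sub>F \<tau> in F. (b \<tau>)\<^sup>2 < (norm v)\<^sup>2 + e / 2" using e by (intro order_tendstoD) auto
    moreover have "\<forall>\<^sub>F \<tau> in F. d \<tau> \<bullet> v > (norm v)\<^sup>2 - e / 4" using e by (intro lower) auto
    ultimately show "\<forall>\<^sub>F \<tau> in F. dist ((norm (d \<tau> - v))\<^sup>2) 0 < e" using speed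
    proof eventually_elim
      case (elim \<tau>)
      have "(norm (d \<tau>))\<^sup>2 \<le> (b \<tau>)\<^sup>2" using elim(3) by (intro power_mono) auto
      moreover have "(norm (d \<tau> - v))\<^sup>2 = (norm (d \<tau>))\<^sup>2 - 2 * (d \<tau> \<bullet> v) + (norm v)\<^sup>2"
        by (simp add: power2_norm_eq_inner algebra_simps inner_commute)
      ultimately have "(norm (d \<tau> - v))\<^sup>2 < e" using elim by linarith
      then show ?case by simp
    qed
  qed
  then have "((\<lambda>\<tau>. sqrt ((norm (d \<tau> - v))\<^sup>2)) \<longlongrightarrow> sqrt 0) F" by (rule tendsto_real_sqrt)
  then have "((\<lambda>\<tau>. d \<tau> - v) \<longlongrightarrow> 0) F" by (simp add: tendsto_norm_zero_iff)
  then show ?thesis unfolding v_def by (simp add: LIM_zero_iff)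
qed

locale projected_field =
  fixes S :: "'a::euclidean_space set" and g :: "'a \<Rightarrow> 'a" and K :: real
  assumes S: "closed S" "convex S" "S \<noteq> {}" and K: "K \<ge> 0"
    and Lip: "\<And>x y. norm (g x - g y) \<le> K * norm (x - y)"
begin

abbreviation field where "field x \<equiv> tangent_proj S x (g x)"

text \<open>The step projects onto \<open>S\<close> itself, not onto a tangent cone: iterates stay
  in \<open>S\<close>, and since the closest point map is nonexpansive, a step is Lipschitz with
  constant \<open>1 + h * K\<close>.\<close>

definition euler_step where "euler_step h x = closest_point S (x + h *\<^sub>R g x)"

definition euler where "euler h k = (euler_step h ^^ k)"

lemma euler_0 [simp]: "euler h 0 x = x" by (simp add: euler_def)
lemma euler_Suc: "euler h (Suc k) x = euler_step h (euler h k x)" by (simp add: euler_def)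
lemma euler_Suc': "euler h (Suc k) x = euler h k (euler_step h x)" by (simp add: euler_def funpow_swap1)
lemma euler_add: "euler h (k + l) x = euler h k (euler h l x)" by (simp add: euler_def funpow_add)

lemma euler_step_in: "euler_step h x \<in> S"
  unfolding euler_step_def by (rule closest_point_in_set[OF S(1,3)])

lemma euler_in: "x \<in> S \<Longrightarrow> euler h k x \<in> S"
  by (cases k) (auto simp: euler_Suc euler_step_in)

lemma euler_step_Lipschitz:
  assumes h: "h \<ge> 0"
  shows "norm (euler_step h x - euler_step h y) \<le> (1 + h * K) * norm (x - y)"
proof -
  have "norm (euler_step h x - euler_step h y) \<le> norm ((x + h *\<^sub>R g x) - (y + h *\<^sub>R g y))"
    unfolding euler_step_def using closest_point_lipschitz[OF S(2,1,3)] by (simp add: dist_norm)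
  also have "\<dots> = norm ((x - y) + h *\<^sub>R (g x - g y))" by (simp add: algebra_simps)
  also have "\<dots> \<le> norm (x - y) + h * norm (g x - g y)"
    using norm_triangle_ineq[of "x - y" "h *\<^sub>R (g x - g y)"] h by simp
  also have "\<dots> \<le> norm (x - y) + h * (K * norm (x - y))"
    by (intro add_left_mono mult_left_mono Lip h)
  finally show ?thesis by (simp add: algebra_simps)
qed

lemma euler_Lipschitz:
  assumes h: "h \<ge> 0"
  shows "norm (euler h k x - euler h k y) \<le> (1 + h * K) ^ k * norm (x - y)"
proof (induction k)
  case (Suc k)
  have "norm (euler h (Suc k) x - euler h (Suc k) y) \<le> (1 + h * K) * norm (euler h k x - euler h k y)"
    unfolding euler_Suc by (rule euler_step_Lipschitz[OF h])
  also have "\<dots> \<le> (1 + h * K) * ((1 + h * K) ^ k * norm (x - y))"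
    using h K by (intro mult_left_mono Suc) auto
  finally show ?case by (simp add: algebra_simps)
qed auto

lemma power_le_exp:
  assumes "h \<ge> 0" "h * real k \<le> T" "c \<ge> 0"
  shows "(1 + h * c) ^ k \<le> exp (c * T)"
proof -
  have "(1 + h * c) ^ k \<le> exp (h * c) ^ k" using assms by (intro power_mono exp_ge_add_one_self) auto
  also have "\<dots> = exp (c * (h * real k))" by (simp add: exp_of_nat_mult[symmetric] algebra_simps)
  also have "\<dots> \<le> exp (c * T)" using assms by (simp add: mult_left_mono)
  finally show ?thesis .
qed

lemma norm_field_le: "x \<in> S \<Longrightarrow> norm (field x) \<le> norm (g x)"
proof -
  assume x: "x \<in> S"
  have "(norm (field x))\<^sup>2 = g x \<bullet> field x"
    using tangent_proj_normal(2)[OF S(2) x, of "g x"] by (simp add: inner_diff_left power2_norm_eq_inner)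
  also have "\<dots> \<le> norm (g x) * norm (field x)" by (rule norm_cauchy_schwarz)
  finally show ?thesis by (cases "field x = 0") (auto simp: power2_eq_square)
qed

text \<open>Optimality of the closest point, tested with \<open>x\<close>, gives a bound through
  \<open>g x\<close>; the part of \<open>g x\<close> normal at \<open>x\<close> only helps, which
  leaves the projected field. The sharp bound by \<open>field x\<close> instead of
  \<open>g x\<close> is what later identifies derivatives.\<close>

lemma euler_step_speed:
  assumes h: "h \<ge> 0" and x: "x \<in> S"
  shows "norm (euler_step h x - x) \<le> h * norm (field x)"
proof -
  let ?y = "euler_step h x"
  have "(x + h *\<^sub>R g x - ?y) \<bullet> (x - ?y) \<le> 0"
    unfolding euler_step_def by (rule closest_point_dot[OF S(2,1) x])
  moreover have "(x + h *\<^sub>R g x - ?y) \<bullet> (x - ?y) = (norm (?y - x))\<^sup>2 - h * (g x \<bullet> (?y - x))"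
    by (simp add: power2_norm_eq_inner algebra_simps)
  moreover have "(g x - field x) \<bullet> (?y - x) \<le> 0"
    using tangent_proj_normal(1)[OF S(2) x, of "g x"] euler_step_in x by (simp add: normal_cone_def)
  then have "h * (g x \<bullet> (?y - x)) \<le> h * (field x \<bullet> (?y - x))"
    using h by (intro mult_left_mono) (auto simp: inner_diff_left)
  moreover have "h * (field x \<bullet> (?y - x)) \<le> h * (norm (field x) * norm (?y - x))"
    using h by (intro mult_left_mono norm_cauchy_schwarz)
  ultimately have "norm (?y - x) * norm (?y - x) \<le> (h * norm (field x)) * norm (?y - x)"
    by (simp add: power2_eq_square algebra_simps)
  then show ?thesis using h by (cases "?y = x") auto
qed

text \<open>The increment of a later step compares the images of \<open>euler_step h x\<close> and
  \<open>x\<close> under an iterated Euler map, hence is at most \<open>exp (K * T)\<close> times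
  the first increment.\<close>

lemma euler_speed_field:
  assumes h: "h \<ge> 0" and x: "x \<in> S" and T: "h * real k \<le> T"
  shows "norm (euler h k x - x) \<le> h * real k * exp (K * T) * norm (field x)"
  using T
proof (induction k)
  case (Suc k)
  have k: "h * real k \<le> T" using Suc.prems h by (simp add: algebra_simps)
  have "norm (euler h (Suc k) x - euler h k x) \<le> (1 + h * K) ^ k * norm (euler_step h x - x)"
    unfolding euler_Suc' by (rule euler_Lipschitz[OF h])
  also have "\<dots> \<le> exp (K * T) * (h * norm (field x))"
    using h k K x by (intro mult_mono power_le_exp euler_step_speed) auto
  finally have "norm (euler h (Suc k) x - euler h k x) \<le> exp (K * T) * (h * norm (field x))" .
  moreover have "norm (euler h (Suc k) x - x) \<le> norm (euler h (Suc k) x - euler h k x) + norm (euler h k x - x)"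
    by norm
  ultimately show ?case using Suc.IH[OF k] by (simp add: algebra_simps)
qed auto

lemma euler_g_bound:
  assumes h: "h \<ge> 0" and x: "x \<in> S" and T: "h * real k \<le> T"
  shows "norm (g (euler h k x)) \<le> exp (K * T) * norm (g x)"
proof -
  have "norm (g (euler h k x)) \<le> (1 + h * K) ^ k * norm (g x)"
  proof (induction k)
    case (Suc k)
    let ?y = "euler h k x"
    have "norm (g (euler_step h ?y)) \<le> norm (g ?y) + norm (g (euler_step h ?y) - g ?y)" by norm
    also have "norm (g (euler_step h ?y) - g ?y) \<le> K * norm (euler_step h ?y - ?y)" by (rule Lip)
    also have "\<dots> \<le> K * (h * norm (g ?y))"
    proof (intro mult_left_mono K)
      have "h * norm (field ?y) \<le> h * norm (g ?y)" by (intro mult_left_mono h norm_field_le euler_in x)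
      then show "norm (euler_step h ?y - ?y) \<le> h * norm (g ?y)"
        using euler_step_speed[OF h euler_in[OF x]] by (rule order_trans[rotated])
    qed
    also have "norm (g ?y) + K * (h * norm (g ?y)) = (1 + h * K) * norm (g ?y)" by (simp add: algebra_simps)
    also have "\<dots> \<le> (1 + h * K) * ((1 + h * K) ^ k * norm (g x))"
      using h K by (intro mult_left_mono Suc) auto
    finally show ?case by (simp add: euler_Suc algebra_simps)
  qed auto
  also have "\<dots> \<le> exp (K * T) * norm (g x)" by (intro mult_right_mono power_le_exp h T K norm_ge_zero)
  finally show ?thesis .
qed

text \<open>A bound for \<open>g\<close> along every Euler orbit from \<open>x\<close> up to time
  \<open>T\<close>, independent of the step size by \<open>euler_g_bound\<close>; it serves as a
  Lipschitz constant in time for the approximations and for their limit.\<close>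

definition speed_bound where "speed_bound T x = exp (K * T) * norm (g x)"

lemma speed_bound_nonneg: "speed_bound T x \<ge> 0" unfolding speed_bound_def by simp

lemma euler_increment:
  assumes h: "h \<ge> 0" and x: "x \<in> S" and kl: "k \<le> l" and T: "h * real l \<le> T"
  shows "norm (euler h l x - euler h k x) \<le> h * real (l - k) * speed_bound T x"
  using kl T
proof (induction l rule: dec_induct)
  case (step l)
  let ?y = "euler h l x"
  have l: "h * real l \<le> T" using step h by (simp add: algebra_simps)
  have "norm (euler_step h ?y - ?y) \<le> h * norm (field ?y)" by (intro euler_step_speed h euler_in x)
  also have "\<dots> \<le> h * norm (g ?y)" by (intro mult_left_mono h norm_field_le euler_in x)
  also have "\<dots> \<le> h * speed_bound T x"
    unfolding speed_bound_def by (intro mult_left_mono h euler_g_bound x l)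
  finally have "norm (euler_step h ?y - ?y) \<le> h * speed_bound T x" .
  moreover have "norm (euler_step h ?y - euler h k x) \<le> norm (euler_step h ?y - ?y) + norm (?y - euler h k x)" by norm
  moreover have "h * real (Suc l - k) * speed_bound T x = h * speed_bound T x + h * real (l - k) * speed_bound T x"
    using step by (simp add: Suc_diff_le algebra_simps)
  ultimately show ?case using step.IH[OF l] by (simp add: euler_Suc)
qed auto

text \<open>A discrete form of the evolution variational inequality, which survives the limit.\<close>

lemma euler_evi:
  assumes h: "h \<ge> 0" and x: "x \<in> S" and kl: "k \<le> l" and T: "h * real l \<le> T" and s: "s \<in> S"
    and G: "G = speed_bound T x" and \<tau>: "\<tau> = h * real (l - k)" and y: "y = euler h k x"
  shows "(norm (euler h l x - s))\<^sup>2 - (norm (y - s))\<^sup>2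
    \<le> 2 * \<tau> * (g y \<bullet> (y - s)) + 2 * \<tau>\<^sup>2 * (G\<^sup>2 + K * G * norm (y - s))"
  using kl T unfolding \<tau>
proof (induction l rule: dec_induct)
  case base
  then show ?case using y by simp
next
  case (step l)
  have l: "h * real l \<le> T" using step h by (simp add: algebra_simps)
  define \<sigma> where "\<sigma> = h * real (l - k)"
  have "\<sigma> \<ge> 0" using h unfolding \<sigma>_def by simp
  moreover have "h * real (Suc l - k) = \<sigma> + h"
    using step(1) unfolding \<sigma>_def by (simp add: Suc_diff_le distrib_left)
  ultimately have \<sigma>: "\<sigma> \<ge> 0" "h * real (Suc l - k) = \<sigma> + h" .
  let ?z = "euler h l x" let ?w = "euler h (Suc l) x"
  have G0: "G \<ge> 0" unfolding G by (rule speed_bound_nonneg)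
  \<comment> \<open>The projection inequality is tested with \<open>s\<close>; polarisation turns it
    into a bound on the change of the squared distance.\<close>
  have "(?z + h *\<^sub>R g ?z - ?w) \<bullet> (s - ?w) \<le> 0"
    unfolding euler_Suc euler_step_def by (rule closest_point_dot[OF S(2,1) s])
  then have "(norm (?w - s))\<^sup>2 - (norm (?z - s))\<^sup>2 \<le> 2 * h * (g ?z \<bullet> (?w - s)) - (norm (?w - ?z))\<^sup>2"
    by (simp add: power2_norm_eq_inner algebra_simps inner_commute)
  then have 1: "(norm (?w - s))\<^sup>2 - (norm (?z - s))\<^sup>2 \<le> 2 * h * (g ?z \<bullet> (?w - s))"
    using zero_le_power2[of "norm (?w - ?z)"] by linarith
  \<comment> \<open>The drift is frozen at the starting point \<open>y\<close>; the errors are of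
    order \<open>\<sigma> + h\<close> per unit of time and add up to the term quadratic in the
    elapsed time.\<close>
  have "g ?z \<bullet> (?w - s) = g y \<bullet> (y - s) + (g ?z - g y) \<bullet> (y - s) + g ?z \<bullet> (?w - y)"
    by (simp add: algebra_simps)
  also have "(g ?z - g y) \<bullet> (y - s) \<le> (K * (\<sigma> * G)) * norm (y - s)"
  proof -
    have "norm (g ?z - g y) \<le> K * norm (?z - y)" by (rule Lip)
    also have "\<dots> \<le> K * (\<sigma> * G)" unfolding \<sigma>_def G y
      using step by (intro mult_left_mono K euler_increment h x l) auto
    finally have "norm (g ?z - g y) * norm (y - s) \<le> (K * (\<sigma> * G)) * norm (y - s)" by (intro mult_right_mono) auto
    then show ?thesis using norm_cauchy_schwarz[of "g ?z - g y" "y - s"] by linarith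
  qed
  also have "g ?z \<bullet> (?w - y) \<le> G * ((\<sigma> + h) * G)"
  proof -
    have "norm (?w - y) \<le> (\<sigma> + h) * G" unfolding \<sigma>(2)[symmetric] G y
      using step by (intro euler_increment h x) auto
    moreover have "norm (g ?z) \<le> G" unfolding G speed_bound_def by (intro euler_g_bound h x l)
    ultimately have "norm (g ?z) * norm (?w - y) \<le> G * ((\<sigma> + h) * G)" using G0 by (intro mult_mono) auto
    then show ?thesis using norm_cauchy_schwarz[of "g ?z" "?w - y"] by linarith
  qed
  finally have "2 * h * (g ?z \<bullet> (?w - s)) \<le> 2 * h * (g y \<bullet> (y - s) + K * (\<sigma> * G) * norm (y - s) + G * ((\<sigma> + h) * G))"
    using h by (intro mult_left_mono) auto
  with 1 step.IH[OF l] have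
    "(norm (?w - s))\<^sup>2 - (norm (y - s))\<^sup>2 \<le> 2 * (\<sigma> + h) * (g y \<bullet> (y - s))
      + 2 * (\<sigma>\<^sup>2 + h * (\<sigma> + h)) * G\<^sup>2 + 2 * (\<sigma>\<^sup>2 + h * \<sigma>) * (K * G * norm (y - s))"
    unfolding \<sigma>_def[symmetric] by (simp add: algebra_simps power2_eq_square)
  also have "\<dots> \<le> 2 * (\<sigma> + h) * (g y \<bullet> (y - s)) + 2 * (\<sigma> + h)\<^sup>2 * G\<^sup>2 + 2 * (\<sigma> + h)\<^sup>2 * (K * G * norm (y - s))"
    using \<sigma> h K G0 by (intro add_mono mult_right_mono mult_left_mono) (auto simp: power2_eq_square algebra_simps)
  finally show ?case unfolding \<sigma>(2) by (simp add: algebra_simps)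
qed

end

context projected_field begin

text \<open>One Euler step of size h against two of size h/2: testing each inequality with the other
  endpoint (doubling of variables) leaves an error of order h squared in the squared distance.\<close>

lemma euler_halving_step:
  assumes h: "0 \<le> h" "h \<le> 1" and x: "x \<in> S" and T: "h * real (Suc k) \<le> T"
    and G: "G = speed_bound T x"
  shows "(norm (euler h (Suc k) x - euler (h/2) (2 * Suc k) x))\<^sup>2
    \<le> (1 + h * (2 * K)) * (norm (euler h k x - euler (h/2) (2 * k) x))\<^sup>2
      + 2 * h\<^sup>2 * (3 * G\<^sup>2 + K * G * (4 * T * G + G))"
proof -
  let ?a = "euler h k x" and ?a' = "euler h (Suc k) x"
  let ?b = "euler (h/2) (2 * k) x" and ?b' = "euler (h/2) (2 * Suc k) x"
  have h2: "h / 2 \<ge> 0" and Tk: "h * real k \<le> T" and T2: "h / 2 * real (2 * Suc k) \<le> T"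
    and T2k: "h / 2 * real (2 * k) \<le> T"
    using h T by (auto simp: algebra_simps)
  have G0: "G \<ge> 0" unfolding G by (rule speed_bound_nonneg)
  have aS: "?a \<in> S" "?b' \<in> S" by (intro euler_in x)+
  \<comment> \<open>The large step from \<open>?a\<close> is tested at \<open>?b'\<close>, the two
    small steps from \<open>?b\<close> at \<open>?a\<close>; in the sum the distance between
    \<open>?a\<close> and \<open>?b'\<close> cancels.\<close>
  have "(norm (?a' - ?b'))\<^sup>2 - (norm (?a - ?b'))\<^sup>2
      \<le> 2 * (h * real (Suc k - k)) * (g ?a \<bullet> (?a - ?b')) + 2 * (h * real (Suc k - k))\<^sup>2 * (G\<^sup>2 + K * G * norm (?a - ?b'))"
    by (rule euler_evi[OF h(1) x _ T aS(2) G refl refl]) simp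
  then have 1: "(norm (?a' - ?b'))\<^sup>2 - (norm (?a - ?b'))\<^sup>2
      \<le> 2 * h * (g ?a \<bullet> (?a - ?b')) + 2 * h\<^sup>2 * (G\<^sup>2 + K * G * norm (?a - ?b'))" by simp
  have "(norm (?b' - ?a))\<^sup>2 - (norm (?b - ?a))\<^sup>2
      \<le> 2 * (h / 2 * real (2 * Suc k - 2 * k)) * (g ?b \<bullet> (?b - ?a))
        + 2 * (h / 2 * real (2 * Suc k - 2 * k))\<^sup>2 * (G\<^sup>2 + K * G * norm (?b - ?a))"
    by (rule euler_evi[OF h2 x _ T2 aS(1) G refl refl]) simp
  then have 2: "(norm (?b' - ?a))\<^sup>2 - (norm (?b - ?a))\<^sup>2
      \<le> 2 * h * (g ?b \<bullet> (?b - ?a)) + 2 * h\<^sup>2 * (G\<^sup>2 + K * G * norm (?b - ?a))" by simp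
  have "norm (?a - x) \<le> T * G"
  proof -
    have "norm (?a - euler h 0 x) \<le> h * real (k - 0) * speed_bound T x"
      by (rule euler_increment[OF h(1) x _ Tk]) simp
    also have "\<dots> \<le> T * G" unfolding G using Tk by (intro mult_right_mono speed_bound_nonneg) simp
    finally show ?thesis by simp
  qed
  moreover have "norm (?b - x) \<le> T * G"
  proof -
    have "norm (?b - euler (h/2) 0 x) \<le> h / 2 * real (2 * k - 0) * speed_bound T x"
      by (rule euler_increment[OF h2 x _ T2k]) simp
    also have "\<dots> \<le> T * G" unfolding G using T2k by (intro mult_right_mono speed_bound_nonneg) simp
    finally show ?thesis by simp
  qed
  moreover have bb: "norm (?b' - ?b) \<le> h * G"
  proof -
    have "norm (?b' - ?b) \<le> h / 2 * real (2 * Suc k - 2 * k) * speed_bound T x"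
      by (rule euler_increment[OF h2 x _ T2]) simp
    then show ?thesis unfolding G by simp
  qed
  moreover have "h * G \<le> G" using h G0 by (simp add: mult_left_le_one_le)
  moreover have "norm (?b - ?a) \<le> norm (?a - x) + norm (?b - x)" "norm (?a - ?b') \<le> norm (?a - x) + norm (?b - x) + norm (?b' - ?b)" by norm+
  ultimately have "norm (?a - ?b') + norm (?b - ?a) \<le> 4 * (T * G) + G" by linarith
  then have "norm (?a - ?b') + norm (?b - ?a) \<le> 4 * T * G + G" by (simp add: mult.assoc)
  then have "2 * h\<^sup>2 * (2 * G\<^sup>2 + K * G * (norm (?a - ?b') + norm (?b - ?a))) \<le> 2 * h\<^sup>2 * (2 * G\<^sup>2 + K * G * (4 * T * G + G))"
    using K G0 by (intro mult_left_mono add_left_mono) auto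
  moreover have "2 * h * (g ?a \<bullet> (?a - ?b') + g ?b \<bullet> (?b - ?a)) \<le> 2 * h * (K * (norm (?a - ?b))\<^sup>2 + h * G\<^sup>2)"
  proof (rule mult_left_mono)
    \<comment> \<open>Up to the term with \<open>?b - ?b'\<close>, which has norm at most
      \<open>h * G\<close>, the two drifts combine into a pairing controlled by the Lipschitz
      constant.\<close>
    have "g ?a \<bullet> (?a - ?b') + g ?b \<bullet> (?b - ?a) = (g ?a - g ?b) \<bullet> (?a - ?b) + g ?a \<bullet> (?b - ?b')"
      by (simp add: algebra_simps)
    also have "(g ?a - g ?b) \<bullet> (?a - ?b) \<le> K * (norm (?a - ?b))\<^sup>2"
      using norm_cauchy_schwarz[of "g ?a - g ?b" "?a - ?b"] mult_right_mono[OF Lip[of ?a ?b], of "norm (?a - ?b)"]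
      by (simp add: power2_eq_square mult.assoc)
    also have "g ?a \<bullet> (?b - ?b') \<le> G * (h * G)"
    proof -
      have "norm (g ?a) \<le> G" unfolding G speed_bound_def by (intro euler_g_bound h x Tk)
      then have "norm (g ?a) * norm (?b - ?b') \<le> G * (h * G)"
        using bb G0 by (intro mult_mono) (auto simp: norm_minus_commute)
      then show ?thesis using norm_cauchy_schwarz[of "g ?a" "?b - ?b'"] by linarith
    qed
    finally show "g ?a \<bullet> (?a - ?b') + g ?b \<bullet> (?b - ?a) \<le> K * (norm (?a - ?b))\<^sup>2 + h * G\<^sup>2"
      by (simp add: power2_eq_square algebra_simps)
  qed (use h in simp)
  moreover have "(norm (?b' - ?a))\<^sup>2 = (norm (?a - ?b'))\<^sup>2" "(norm (?b - ?a))\<^sup>2 = (norm (?a - ?b))\<^sup>2"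
    by (simp_all add: norm_minus_commute)
  ultimately have "(norm (?a' - ?b'))\<^sup>2 \<le> (norm (?a - ?b))\<^sup>2 + 2 * h * (K * (norm (?a - ?b))\<^sup>2 + h * G\<^sup>2)
      + 2 * h\<^sup>2 * (2 * G\<^sup>2 + K * G * (4 * T * G + G))"
    using 1 2 by (simp add: distrib_left)
  also have "\<dots> = (1 + h * (2 * K)) * (norm (?a - ?b))\<^sup>2 + 2 * h\<^sup>2 * (3 * G\<^sup>2 + K * G * (4 * T * G + G))"
    by (simp add: algebra_simps power2_eq_square)
  finally show ?thesis .
qed

text \<open>Discrete Gronwall: errors of order \<open>h\<^sup>2\<close> over at most
  \<open>T / h\<close> steps, each amplified by \<open>1 + h * (2 * K)\<close>, leave a squared
  distance of order \<open>h\<close>.\<close>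

lemma euler_halving:
  assumes h: "0 \<le> h" "h \<le> 1" and x: "x \<in> S" and T: "h * real k \<le> T"
    and G: "G = speed_bound T x" and C: "C = exp (2 * K * T) * T * (2 * (3 * G\<^sup>2 + K * G * (4 * T * G + G)))"
  shows "(norm (euler h k x - euler (h/2) (2 * k) x))\<^sup>2 \<le> h * C"
proof -
  define c where "c = 2 * (3 * G\<^sup>2 + K * G * (4 * T * G + G))"
  have T0: "T \<ge> 0" using T h by (smt (verit) mult_nonneg_nonneg of_nat_0_le_iff)
  have "G \<ge> 0" unfolding G by (rule speed_bound_nonneg)
  then have c: "c \<ge> 0" unfolding c_def using K T0 by (intro mult_nonneg_nonneg add_nonneg_nonneg) auto
  have "(norm (euler h j x - euler (h/2) (2 * j) x))\<^sup>2 \<le> real j * h\<^sup>2 * c * (1 + h * (2 * K)) ^ j"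
    if "j \<le> k" for j using that
  proof (induction j)
    case (Suc j)
    have "h * real (Suc j) \<le> h * real k" using Suc.prems h by (intro mult_left_mono) auto
    with T have Tj: "h * real (Suc j) \<le> T" by linarith
    have "(norm (euler h (Suc j) x - euler (h/2) (2 * Suc j) x))\<^sup>2
       \<le> (1 + h * (2 * K)) * (norm (euler h j x - euler (h/2) (2 * j) x))\<^sup>2 + h\<^sup>2 * c"
      using euler_halving_step[OF h x Tj G] unfolding c_def
      by (simp only: mult.left_commute[of 2 "h\<^sup>2"] mult.assoc)
    also have "\<dots> \<le> (1 + h * (2 * K)) * (real j * h\<^sup>2 * c * (1 + h * (2 * K)) ^ j) + h\<^sup>2 * c * (1 + h * (2 * K)) ^ Suc j"
    proof (intro add_mono mult_left_mono)
      have "1 \<le> (1 + h * (2 * K)) ^ Suc j" using h K by (intro one_le_power) auto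
      then show "h\<^sup>2 * c \<le> h\<^sup>2 * c * (1 + h * (2 * K)) ^ Suc j" using c mult_left_mono[of 1 _ "h\<^sup>2 * c"] by simp
    qed (use Suc h K in auto)
    also have "\<dots> = real (Suc j) * h\<^sup>2 * c * (1 + h * (2 * K)) ^ Suc j" by (simp add: algebra_simps)
    finally show ?case .
  qed auto
  from this[OF order_refl] have "(norm (euler h k x - euler (h/2) (2 * k) x))\<^sup>2 \<le> real k * h\<^sup>2 * c * (1 + h * (2 * K)) ^ k" .
  also have "\<dots> = h * ((h * real k) * (c * (1 + h * (2 * K)) ^ k))" by (simp add: power2_eq_square algebra_simps)
  also have "\<dots> \<le> h * (T * (c * exp (2 * K * T)))"
    using h T T0 c K by (intro mult_left_mono mult_mono power_le_exp) auto
  also have "\<dots> = h * C" unfolding C c_def by (simp add: algebra_simps)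
  finally show ?thesis .
qed

text \<open>The number of full steps of length \<open>1 / 2 ^ n\<close> that fit before time
  \<open>t\<close>. Dyadic lengths make each grid a refinement of the previous one, which is what
  the halving estimate compares.\<close>

definition grid :: "nat \<Rightarrow> real \<Rightarrow> nat" where "grid n t = nat \<lfloor>2 ^ n * t\<rfloor>"

lemma grid_le: "t \<ge> 0 \<Longrightarrow> 1 / 2 ^ n * real (grid n t) \<le> t"
  unfolding grid_def by (simp add: field_simps)

lemma grid_gt: "1 / 2 ^ n * real (grid n t) > t - 1 / 2 ^ n"
proof -
  have "real (grid n t) > 2 ^ n * t - 1" unfolding grid_def by linarith
  then have "1 / 2 ^ n * (2 ^ n * t - 1) < 1 / 2 ^ n * real (grid n t)" by (intro mult_strict_left_mono) auto
  then show ?thesis by (simp add: right_diff_distrib)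
qed

lemma grid_mono: "s \<le> t \<Longrightarrow> grid n s \<le> grid n t"
  unfolding grid_def by (intro nat_mono floor_mono) simp

lemma grid_tendsto: assumes "t \<ge> 0" shows "(\<lambda>n. 1 / 2 ^ n * real (grid n t)) \<longlonglongrightarrow> t"
proof (rule tendsto_sandwich)
  show "\<forall>\<^sub>F n in sequentially. t - (1 / 2) ^ n \<le> 1 / 2 ^ n * real (grid n t)"
    using grid_gt by (auto intro!: always_eventually less_imp_le simp: power_divide)
  show "\<forall>\<^sub>F n in sequentially. 1 / 2 ^ n * real (grid n t) \<le> t" using grid_le[OF assms] by simp
  show "(\<lambda>n. t - (1 / 2) ^ n) \<longlonglongrightarrow> t"
    by (rule tendsto_eq_intros refl LIMSEQ_realpow_zero | simp)+
qed simp

definition approx where "approx n t x = euler (1 / 2 ^ n) (grid n t) x"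

lemma grid_Suc: "t \<ge> 0 \<Longrightarrow> grid (Suc n) t = 2 * grid n t \<or> grid (Suc n) t = Suc (2 * grid n t)"
proof -
  assume t: "t \<ge> 0"
  define m where "m = \<lfloor>2 ^ n * t\<rfloor>"
  have m: "m \<ge> 0" unfolding m_def using t by simp
  have "of_int m \<le> 2 ^ n * t" "2 ^ n * t < of_int m + 1" unfolding m_def by linarith+
  then have "\<lfloor>2 ^ Suc n * t\<rfloor> = 2 * m \<or> \<lfloor>2 ^ Suc n * t\<rfloor> = 2 * m + 1" by (simp add: floor_eq_iff) linarith
  then show ?thesis using m unfolding grid_def m_def[symmetric] by auto
qed

text \<open>Halving controls the square, so consecutive levels differ by the order of
  \<open>sqrt (1 / 2 ^ n)\<close>, plus at most one extra half step by \<open>grid_Suc\<close>. Both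
  are dominated by a geometric series with ratio \<open>sqrt (1 / 2)\<close>.\<close>

lemma approx_convergent:
  assumes t: "t \<ge> 0" and x: "x \<in> S" shows "convergent (\<lambda>n. approx n t x)"
proof -
  define G where "G = speed_bound t x"
  define C where "C = exp (2 * K * t) * t * (2 * (3 * G\<^sup>2 + K * G * (4 * t * G + G)))"
  have G0: "G \<ge> 0" unfolding G_def by (rule speed_bound_nonneg)
  have C0: "C \<ge> 0" unfolding C_def using t K G0 by (intro mult_nonneg_nonneg add_nonneg_nonneg) auto
  define r where "r = sqrt (1 / 2)"
  have r: "0 < r" "r < 1" "\<And>n. r ^ n = sqrt (1 / 2 ^ n)" "\<And>n. (1 / 2) ^ n \<le> r ^ n"
  proof -
    show "0 < r" "r < 1" unfolding r_def by (auto simp: real_sqrt_lt_1_iff)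
    show "r ^ n = sqrt (1 / 2 ^ n)" for n unfolding r_def by (simp add: real_sqrt_power[symmetric] power_divide)
    have "1 / 2 \<le> r" unfolding r_def by (rule real_le_rsqrt) (simp add: power2_eq_square)
    then show "(1 / 2) ^ n \<le> r ^ n" for n by (intro power_mono) auto
  qed
  have bound: "norm (approx (Suc n) t x - approx n t x) \<le> (sqrt C + G) * r ^ n" for n
  proof -
    let ?h = "1 / 2 ^ n :: real"
    have h: "?h \<ge> 0" "?h \<le> 1" "1 / 2 ^ Suc n = ?h / 2" by auto
    have Suc_le: "?h / 2 * real (grid (Suc n) t) \<le> t" using grid_le[OF t, of "Suc n"] by simp
    have kl: "2 * grid n t \<le> grid (Suc n) t" "grid (Suc n) t - 2 * grid n t \<le> 1" using grid_Suc[OF t, of n] by auto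
    have "norm (euler (?h / 2) (grid (Suc n) t) x - euler (?h / 2) (2 * grid n t) x)
        \<le> ?h / 2 * real (grid (Suc n) t - 2 * grid n t) * G"
      unfolding G_def by (rule euler_increment[OF _ x kl(1) Suc_le]) simp
    also have "\<dots> \<le> ?h * 1 * G"
      using kl(2) G0 by (intro mult_right_mono mult_mono) (auto simp: field_simps)
    also have "\<dots> \<le> G * r ^ n" using mult_left_mono[OF r(4)[of n] G0] by (simp add: power_divide)
    finally have 1: "norm (euler (?h / 2) (grid (Suc n) t) x - euler (?h / 2) (2 * grid n t) x) \<le> G * r ^ n" .
    have "(norm (euler ?h (grid n t) x - euler (?h / 2) (2 * grid n t) x))\<^sup>2 \<le> ?h * C"
      by (rule euler_halving[OF h(1,2) x grid_le[OF t] G_def C_def])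
    then have "norm (euler ?h (grid n t) x - euler (?h / 2) (2 * grid n t) x) \<le> sqrt (?h * C)" by (rule real_le_rsqrt)
    also have "\<dots> = sqrt C * r ^ n" unfolding r(3) by (simp add: real_sqrt_mult real_sqrt_divide)
    finally have 2: "norm (euler ?h (grid n t) x - euler (?h / 2) (2 * grid n t) x) \<le> sqrt C * r ^ n" .
    have "norm (approx (Suc n) t x - approx n t x) \<le> G * r ^ n + sqrt C * r ^ n"
      using norm_diff_triangle_le[OF 1 2[unfolded norm_minus_commute[of "euler ?h (grid n t) x"]]]
      unfolding approx_def h(3) .
    then show ?thesis by (simp add: algebra_simps)
  qed
  have "summable (\<lambda>n. (sqrt C + G) * r ^ n)" using r by (intro summable_mult summable_geometric) simp
  then have "summable (\<lambda>n. approx (Suc n) t x - approx n t x)"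
    by (rule summable_comparison_test'[where N = 0]) (rule bound)
  then have "convergent (\<lambda>n. (approx n t x - approx 0 t x) + approx 0 t x)"
    by (intro convergent_add convergent_const) (simp add: summable_iff_convergent sum_lessThan_telescope[of "\<lambda>n. approx n t x"])
  then show ?thesis by simp
qed

section \<open>The limit semigroup and its variational inequality\<close>

definition flow where "flow t x = lim (\<lambda>n. approx n t x)"

lemma approx_tendsto: "t \<ge> 0 \<Longrightarrow> x \<in> S \<Longrightarrow> (\<lambda>n. approx n t x) \<longlonglongrightarrow> flow t x"
  unfolding flow_def using approx_convergent by (simp add: convergent_LIMSEQ_iff)

lemma flow_in: assumes "t \<ge> 0" "x \<in> S" shows "flow t x \<in> S"
  using S(1) _ approx_tendsto[OF assms]
  by (rule closed_sequentially) (simp add: approx_def euler_in assms)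

lemma flow_0: "x \<in> S \<Longrightarrow> flow 0 x = x"
  by (simp add: flow_def approx_def grid_def)

lemma flow_Lipschitz:
  assumes t: "t \<ge> 0" and "x \<in> S" "y \<in> S"
  shows "norm (flow t x - flow t y) \<le> exp (K * t) * norm (x - y)"
proof (rule tendsto_upperbound)
  show "(\<lambda>n. norm (approx n t x - approx n t y)) \<longlonglongrightarrow> norm (flow t x - flow t y)"
    by (intro tendsto_intros approx_tendsto assms)
  have "norm (approx n t x - approx n t y) \<le> exp (K * t) * norm (x - y)" for n
  proof -
    have "norm (approx n t x - approx n t y) \<le> (1 + 1 / 2 ^ n * K) ^ grid n t * norm (x - y)"
      unfolding approx_def by (rule euler_Lipschitz) simp
    also have "\<dots> \<le> exp (K * t) * norm (x - y)"
      using grid_le[OF t] K by (intro mult_right_mono power_le_exp) auto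
    finally show ?thesis .
  qed
  then show "\<forall>\<^sub>F n in sequentially. norm (approx n t x - approx n t y) \<le> exp (K * t) * norm (x - y)" by simp
qed simp

lemma flow_speed_field:
  assumes t: "t \<ge> 0" and x: "x \<in> S"
  shows "norm (flow t x - x) \<le> t * exp (K * t) * norm (field x)"
proof (rule tendsto_upperbound)
  show "(\<lambda>n. norm (approx n t x - x)) \<longlonglongrightarrow> norm (flow t x - x)"
    by (intro tendsto_intros approx_tendsto assms)
  have "norm (approx n t x - x) \<le> t * exp (K * t) * norm (field x)" for n
  proof -
    have "norm (approx n t x - x) \<le> 1 / 2 ^ n * real (grid n t) * exp (K * t) * norm (field x)"
      unfolding approx_def by (rule euler_speed_field[OF _ x grid_le[OF t]]) simp
    also have "\<dots> \<le> t * exp (K * t) * norm (field x)"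
      using grid_le[OF t, of n] by (intro mult_right_mono) auto
    finally show ?thesis .
  qed
  then show "\<forall>\<^sub>F n in sequentially. norm (approx n t x - x) \<le> t * exp (K * t) * norm (field x)" by simp
qed simp

lemma g_tendsto: "(f \<longlongrightarrow> l) F \<Longrightarrow> ((\<lambda>n. g (f n)) \<longlongrightarrow> g l) F"
proof -
  assume f: "(f \<longlongrightarrow> l) F"
  have "((\<lambda>n. K * norm (f n - l)) \<longlongrightarrow> K * norm (l - l)) F" by (intro tendsto_intros f)
  then have "((\<lambda>n. K * norm (f n - l)) \<longlongrightarrow> 0) F" by simp
  then have "((\<lambda>n. g (f n) - g l) \<longlongrightarrow> 0) F"
    by (rule Lim_null_comparison[rotated]) (simp add: Lip)
  then show ?thesis by (simp add: LIM_zero_iff)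
qed

lemma flow_g_bound:
  assumes t: "0 \<le> t" "t \<le> T" and x: "x \<in> S"
  shows "norm (g (flow t x)) \<le> speed_bound T x"
proof (rule tendsto_upperbound)
  show "(\<lambda>n. norm (g (approx n t x))) \<longlonglongrightarrow> norm (g (flow t x))"
    by (intro tendsto_intros g_tendsto approx_tendsto t x)
  have "1 / 2 ^ n * real (grid n t) \<le> T" for n using grid_le[OF t(1), of n] t(2) by linarith
  then show "\<forall>\<^sub>F n in sequentially. norm (g (approx n t x)) \<le> speed_bound T x"
    unfolding approx_def speed_bound_def by (intro always_eventually allI euler_g_bound x) auto
qed simp

lemma
  assumes t: "0 \<le> t" "t \<le> t'" "t' \<le> T" and x: "x \<in> S"
  shows flow_increment: "norm (flow t' x - flow t x) \<le> (t' - t) * speed_bound T x"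
    and flow_evi: "s \<in> S \<Longrightarrow> G = speed_bound T x \<Longrightarrow> y = flow t x \<Longrightarrow>
      (norm (flow t' x - s))\<^sup>2 - (norm (y - s))\<^sup>2
        \<le> 2 * (t' - t) * (g y \<bullet> (y - s)) + 2 * (t' - t)\<^sup>2 * (G\<^sup>2 + K * G * norm (y - s))"
proof -
  have t0: "0 \<le> t'" using t by linarith
  define \<tau> where "\<tau> n = 1 / 2 ^ n * real (grid n t' - grid n t)" for n
  have "\<tau> = (\<lambda>n. 1 / 2 ^ n * real (grid n t') - 1 / 2 ^ n * real (grid n t))"
    using grid_mono[OF t(2)] unfolding \<tau>_def by (simp add: of_nat_diff right_diff_distrib)
  then have \<tau>: "\<tau> \<longlonglongrightarrow> t' - t" by (simp only:) (intro tendsto_diff grid_tendsto t t0)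
  have T: "1 / 2 ^ n * real (grid n t') \<le> T" for n using grid_le[OF t0, of n] t(3) by linarith
  show "norm (flow t' x - flow t x) \<le> (t' - t) * speed_bound T x"
  proof (rule tendsto_le)
    show "(\<lambda>n. norm (approx n t' x - approx n t x)) \<longlonglongrightarrow> norm (flow t' x - flow t x)"
      by (intro tendsto_intros approx_tendsto t t0 x)
    show "(\<lambda>n. \<tau> n * speed_bound T x) \<longlonglongrightarrow> (t' - t) * speed_bound T x"
      by (intro tendsto_intros \<tau>)
    show "\<forall>\<^sub>F n in sequentially. norm (approx n t' x - approx n t x) \<le> \<tau> n * speed_bound T x"
      unfolding approx_def \<tau>_def
      by (intro always_eventually allI euler_increment x grid_mono t T) simp
  qed simp
  assume s: "s \<in> S" and G: "G = speed_bound T x" and y: "y = flow t x"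
  show "(norm (flow t' x - s))\<^sup>2 - (norm (y - s))\<^sup>2
        \<le> 2 * (t' - t) * (g y \<bullet> (y - s)) + 2 * (t' - t)\<^sup>2 * (G\<^sup>2 + K * G * norm (y - s))"
    unfolding y
  proof (rule tendsto_le)
    show "(\<lambda>n. (norm (approx n t' x - s))\<^sup>2 - (norm (approx n t x - s))\<^sup>2)
        \<longlonglongrightarrow> (norm (flow t' x - s))\<^sup>2 - (norm (flow t x - s))\<^sup>2"
      by (intro tendsto_intros approx_tendsto t t0 x)
    show "(\<lambda>n. 2 * \<tau> n * (g (approx n t x) \<bullet> (approx n t x - s))
          + 2 * (\<tau> n)\<^sup>2 * (G\<^sup>2 + K * G * norm (approx n t x - s)))
        \<longlonglongrightarrow> 2 * (t' - t) * (g (flow t x) \<bullet> (flow t x - s))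
          + 2 * (t' - t)\<^sup>2 * (G\<^sup>2 + K * G * norm (flow t x - s))"
      by (intro tendsto_intros g_tendsto approx_tendsto t t0 x \<tau>)
    show "\<forall>\<^sub>F n in sequentially. (norm (approx n t' x - s))\<^sup>2 - (norm (approx n t x - s))\<^sup>2
        \<le> 2 * \<tau> n * (g (approx n t x) \<bullet> (approx n t x - s))
          + 2 * (\<tau> n)\<^sup>2 * (G\<^sup>2 + K * G * norm (approx n t x - s))"
      unfolding approx_def
      by (intro always_eventually allI euler_evi[OF _ x _ T s G \<tau>_def refl] grid_mono t) simp
  qed simp
qed

lemma grid_add:
  assumes "s \<ge> 0" "t \<ge> 0"
  shows "grid n s + grid n t \<le> grid n (s + t)" "grid n (s + t) \<le> grid n s + grid n t + 1"
proof -
  have "\<lfloor>2 ^ n * s\<rfloor> \<ge> 0" "\<lfloor>2 ^ n * t\<rfloor> \<ge> 0" using assms by simp_all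
  moreover have "\<lfloor>2 ^ n * (s + t)\<rfloor> \<ge> \<lfloor>2 ^ n * s\<rfloor> + \<lfloor>2 ^ n * t\<rfloor>"
    "\<lfloor>2 ^ n * (s + t)\<rfloor> \<le> \<lfloor>2 ^ n * s\<rfloor> + \<lfloor>2 ^ n * t\<rfloor> + 1"
    unfolding distrib_left by linarith+
  ultimately show "grid n s + grid n t \<le> grid n (s + t)" "grid n (s + t) \<le> grid n s + grid n t + 1"
    unfolding grid_def by linarith+
qed

text \<open>The grids for \<open>s\<close> and \<open>t\<close> together miss at most one step of
  the grid for \<open>s + t\<close>, and the stability of the Euler map transfers the error made at
  time \<open>t\<close>; both contributions vanish in the limit.\<close>

lemma flow_add:
  assumes s: "s \<ge> 0" and t: "t \<ge> 0" and x: "x \<in> S"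
  shows "flow (s + t) x = flow s (flow t x)"
proof (rule LIMSEQ_unique)
  show "(\<lambda>n. approx n (s + t) x) \<longlonglongrightarrow> flow (s + t) x" using s t x by (intro approx_tendsto) auto
  have st: "s + t \<ge> 0" using s t by simp
  define e where "e n = 1 / 2 ^ n * speed_bound (s + t) x + exp (K * s) * norm (approx n t x - flow t x)" for n
  have "(\<lambda>n. (1 / 2) ^ n * speed_bound (s + t) x + exp (K * s) * norm (approx n t x - flow t x))
      \<longlonglongrightarrow> 0 * speed_bound (s + t) x + exp (K * s) * norm (flow t x - flow t x)"
    by (intro tendsto_intros approx_tendsto t x LIMSEQ_realpow_zero) auto
  then have e: "e \<longlonglongrightarrow> 0" unfolding e_def by (simp add: power_divide)
  have "norm (approx n (s + t) x - approx n s (flow t x)) \<le> e n" for n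
  proof -
    let ?h = "1 / 2 ^ n :: real"
    let ?z = "euler ?h (grid n s + grid n t) x"
    have "norm (approx n (s + t) x - ?z) \<le> ?h * real (grid n (s + t) - (grid n s + grid n t)) * speed_bound (s + t) x"
      unfolding approx_def by (rule euler_increment[OF _ x grid_add(1)[OF s t] grid_le[OF st]]) simp
    also have "\<dots> \<le> ?h * 1 * speed_bound (s + t) x"
      using grid_add(2)[OF s t, of n] by (intro mult_right_mono mult_left_mono speed_bound_nonneg) auto
    finally have 1: "norm (approx n (s + t) x - ?z) \<le> ?h * speed_bound (s + t) x" by simp
    have "norm (?z - approx n s (flow t x)) \<le> (1 + ?h * K) ^ grid n s * norm (approx n t x - flow t x)"
      unfolding approx_def euler_add by (rule euler_Lipschitz) simp
    also have "\<dots> \<le> exp (K * s) * norm (approx n t x - flow t x)"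
      using grid_le[OF s] K by (intro mult_right_mono power_le_exp) auto
    finally show ?thesis using norm_diff_triangle_le[OF 1] unfolding e_def by blast
  qed
  then have "(\<lambda>n. approx n (s + t) x - approx n s (flow t x)) \<longlonglongrightarrow> 0"
    by (intro Lim_null_comparison[OF _ e] always_eventually) blast
  from tendsto_add[OF this approx_tendsto[OF s flow_in[OF t x]]]
  show "(\<lambda>n. approx n (s + t) x) \<longlonglongrightarrow> flow s (flow t x)" by simp
qed

text \<open>Covers quotients from both sides. Forward, it is the variational inequality divided by
  the elapsed time. Backward, that inequality is based at \<open>flow t' x\<close>, and moving the
  base to \<open>flow t x\<close> costs further terms of the same order; the constants 3 and 2 and
  the summand \<open>G * T\<close> leave room for them.\<close>

lemma flow_quotient_normal:
  assumes t: "0 \<le> t" "0 \<le> t'" "t \<le> T" "t' \<le> T" "t \<noteq> t'" and x: "x \<in> S" and s: "s \<in> S"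
    and G: "G = speed_bound T x"
  shows "(g (flow t x) - (flow t' x - flow t x) /\<^sub>R (t' - t)) \<bullet> (s - flow t x)
    \<le> \<bar>t' - t\<bar> * (3 * G\<^sup>2 + 2 * K * G * (norm (flow t x - s) + G * T))"
proof -
  have main: "(g a - d) \<bullet> (s - a) \<le> \<sigma> * (G\<^sup>2 + K * G * norm (a - s))"
    if r: "0 \<le> r" "r < r'" "r' \<le> T" and \<sigma>: "\<sigma> = r' - r" and a: "a = flow r x" and d: "flow r' x = a + \<sigma> *\<^sub>R d"
    for r r' \<sigma> a d
  proof -
    have "(norm (flow r' x - s))\<^sup>2 - (norm (a - s))\<^sup>2
        \<le> 2 * \<sigma> * (g a \<bullet> (a - s)) + 2 * \<sigma>\<^sup>2 * (G\<^sup>2 + K * G * norm (a - s))"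
      unfolding \<sigma> using flow_evi[OF r(1) less_imp_le[OF r(2)] r(3) x s G a] .
    moreover have "(norm (flow r' x - s))\<^sup>2 - (norm (a - s))\<^sup>2 = 2 * \<sigma> * (d \<bullet> (a - s)) + (norm (\<sigma> *\<^sub>R d))\<^sup>2"
      unfolding d power2_norm_eq_inner by (simp add: algebra_simps inner_commute)
    ultimately have "2 * \<sigma> * (d \<bullet> (a - s)) \<le> 2 * \<sigma> * (g a \<bullet> (a - s)) + 2 * \<sigma>\<^sup>2 * (G\<^sup>2 + K * G * norm (a - s))"
      using zero_le_power2[of "norm (\<sigma> *\<^sub>R d)"] by linarith
    then have "\<sigma> * ((g a - d) \<bullet> (s - a)) \<le> \<sigma> * (\<sigma> * (G\<^sup>2 + K * G * norm (a - s)))"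
      by (simp add: algebra_simps power2_eq_square)
    then show ?thesis using r \<sigma> by (simp add: mult_le_cancel_left_pos)
  qed
  have G0: "G \<ge> 0" unfolding G by (rule speed_bound_nonneg)
  have T0: "T \<ge> 0" using t by linarith
  let ?u = "flow t x" and ?w = "flow t' x"
  define d where "d = (?w - ?u) /\<^sub>R (t' - t)"
  show ?thesis
  proof (cases "t < t'")
    case True
    have "?w = ?u + (t' - t) *\<^sub>R d" unfolding d_def using True by simp
    from main[OF t(1) True t(4) refl refl this]
    have "(g ?u - d) \<bullet> (s - ?u) \<le> (t' - t) * (G\<^sup>2 + K * G * norm (?u - s))" .
    also have "\<dots> \<le> \<bar>t' - t\<bar> * (3 * G\<^sup>2 + 2 * K * G * (norm (?u - s) + G * T))"
    proof (rule mult_mono)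
      have "G\<^sup>2 \<le> 3 * G\<^sup>2" by simp
      moreover have "K * G * norm (?u - s) \<le> 2 * K * G * (norm (?u - s) + G * T)"
        using K G0 T0 by (intro mult_mono) auto
      ultimately show "G\<^sup>2 + K * G * norm (?u - s) \<le> 3 * G\<^sup>2 + 2 * K * G * (norm (?u - s) + G * T)" by linarith
    qed (use K G0 True in auto)
    finally show ?thesis unfolding d_def .
  next
    case False
    then have tt: "t' < t" using t by simp
    define \<tau> where "\<tau> = t - t'"
    have \<tau>: "\<tau> > 0" "\<tau> \<le> T" unfolding \<tau>_def using tt t by auto
    have "\<tau> *\<^sub>R d = - ((t' - t) *\<^sub>R d)" unfolding \<tau>_def by (simp flip: scaleR_minus_left)
    also have "(t' - t) *\<^sub>R d = ?w - ?u" unfolding d_def using tt by simp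
    finally have d: "?u = ?w + \<tau> *\<^sub>R d" by simp
    have 1: "(g ?w - d) \<bullet> (s - ?w) \<le> \<tau> * (G\<^sup>2 + K * G * norm (?w - s))"
      by (rule main[OF t(2) tt t(3) \<tau>_def refl d])
    have inc: "norm (?u - ?w) \<le> \<tau> * G" unfolding \<tau>_def G using tt t by (intro flow_increment x) auto
    then have dG: "norm d \<le> G" using d \<tau> by (simp add: mult_le_cancel_left_pos)
    have gG: "norm (g ?u) \<le> G" unfolding G by (intro flow_g_bound t x)
    have ws: "norm (?w - s) \<le> norm (?u - s) + G * T"
    proof -
      have "norm (?w - s) \<le> norm (?u - s) + norm (?u - ?w)" by norm
      moreover have "\<tau> * G \<le> G * T" using \<tau> G0 mult_left_mono[of \<tau> T G] by (simp add: mult.commute)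
      ultimately show ?thesis using inc by linarith
    qed
    have "(g ?u - d) \<bullet> (s - ?u) = (g ?w - d) \<bullet> (s - ?w) + (g ?u - g ?w) \<bullet> (s - ?w) + (g ?u - d) \<bullet> (?w - ?u)"
      by (simp add: algebra_simps)
    also have "(g ?u - g ?w) \<bullet> (s - ?w) \<le> \<tau> * (K * G * norm (?w - s))"
    proof -
      have "norm (g ?u - g ?w) \<le> K * (\<tau> * G)" using Lip[of ?u ?w] mult_left_mono[OF inc K] by linarith
      then have "norm (g ?u - g ?w) * norm (s - ?w) \<le> K * (\<tau> * G) * norm (s - ?w)" by (intro mult_right_mono) auto
      then show ?thesis using norm_cauchy_schwarz[of "g ?u - g ?w" "s - ?w"]
        by (simp add: norm_minus_commute algebra_simps)
    qed
    also have "(g ?u - d) \<bullet> (?w - ?u) \<le> \<tau> * (2 * G\<^sup>2)"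
    proof -
      have "norm (g ?u - d) \<le> 2 * G" using dG gG norm_triangle_ineq4[of "g ?u" d] by linarith
      then have "norm (g ?u - d) * norm (?w - ?u) \<le> 2 * G * (\<tau> * G)"
        using inc G0 by (intro mult_mono) (auto simp: norm_minus_commute)
      then show ?thesis using norm_cauchy_schwarz[of "g ?u - d" "?w - ?u"]
        by (simp add: power2_eq_square algebra_simps)
    qed
    finally have "(g ?u - d) \<bullet> (s - ?u) \<le> \<tau> * (3 * G\<^sup>2 + 2 * K * G * norm (?w - s))"
      using 1 by (simp add: algebra_simps)
    also have "\<dots> \<le> \<tau> * (3 * G\<^sup>2 + 2 * K * G * (norm (?u - s) + G * T))"
      using \<tau> K G0 ws by (intro mult_left_mono add_left_mono) auto
    finally show ?thesis unfolding d_def \<tau>_def using tt by simp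
  qed
qed

end

section \<open>Differentiability and uniqueness of the flow\<close>

lemma norm_quotient_le:
  assumes "h \<noteq> 0" "norm v \<le> \<bar>h\<bar> * c" shows "norm (v /\<^sub>R h) \<le> c"
  using assms by (simp add: field_simps)

lemma has_vector_derivative_quotient_iff:
  "(f has_vector_derivative D) (at x within T) \<longleftrightarrow>
    ((\<lambda>y. (f y - f x) /\<^sub>R (y - x)) \<longlongrightarrow> D) (at x within T)"
proof -
  have "((\<lambda>y. (f y - f x) /\<^sub>R (y - x)) \<longlongrightarrow> D) (at x within T) \<longleftrightarrow>
      ((\<lambda>y. norm ((f y - f x) /\<^sub>R (y - x) - D)) \<longlongrightarrow> 0) (at x within T)"
    by (simp add: tendsto_norm_zero_iff LIM_zero_iff)
  also have "\<dots> \<longleftrightarrow> ((\<lambda>y. norm (f y - f x - (y - x) *\<^sub>R D) / norm (y - x)) \<longlongrightarrow> 0) (at x within T)"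
  proof (rule filterlim_cong[OF refl refl])
    have "norm ((f y - f x) /\<^sub>R (y - x) - D) = norm (f y - f x - (y - x) *\<^sub>R D) / norm (y - x)" if "y \<noteq> x" for y
    proof -
      have "(f y - f x) /\<^sub>R (y - x) - D = (f y - f x - (y - x) *\<^sub>R D) /\<^sub>R (y - x)"
        using that by (simp add: scaleR_diff_right)
      then show ?thesis by (simp only: norm_scaleR) (simp add: divide_inverse mult.commute)
    qed
    then show "\<forall>\<^sub>F y in at x within T. norm ((f y - f x) /\<^sub>R (y - x) - D) = norm (f y - f x - (y - x) *\<^sub>R D) / norm (y - x)"
      by (auto simp: eventually_at_filter intro: always_eventually)
  qed
  also have "\<dots> \<longleftrightarrow> (f has_vector_derivative D) (at x within T)"
    unfolding has_vector_derivative_def has_derivative_iff_norm by (simp add: bounded_linear_scaleR_left)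
  finally show ?thesis ..
qed

context projected_field begin

lemma quotient_normal_eventually:
  assumes t: "t \<ge> 0" and x: "x \<in> S" and s: "s \<in> S" and e: "e > 0"
  shows "\<forall>\<^sub>F t' in at t within {0..}. (g (flow t x) - (flow t' x - flow t x) /\<^sub>R (t' - t)) \<bullet> (s - flow t x) < e"
proof -
  define G where "G = speed_bound (t + 1) x"
  define C where "C = 3 * G\<^sup>2 + 2 * K * G * (norm (flow t x - s) + G * (t + 1))"
  have "((\<lambda>t'. \<bar>t' - t\<bar> * C) \<longlongrightarrow> \<bar>t - t\<bar> * C) (at t within {0..})" by (intro tendsto_intros)
  then have "\<forall>\<^sub>F t' in at t within {0..}. \<bar>t' - t\<bar> * C < e" using e by (intro order_tendstoD) auto
  moreover have "\<forall>\<^sub>F t' in at t within {0..}. t' \<in> {0..} \<and> t' \<noteq> t \<and> t' \<le> t + 1"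
  proof -
    have "\<forall>\<^sub>F t' in at t within {0..}. t' \<in> {0..} \<and> t' \<noteq> t" by (simp add: eventually_at_filter)
    moreover have "\<forall>\<^sub>F t' in at t within {0..}. t' < t + 1"
      by (rule order_tendstoD[OF tendsto_ident_at]) simp
    ultimately show ?thesis by eventually_elim auto
  qed
  ultimately show ?thesis
  proof eventually_elim
    case (elim t')
    then have "(g (flow t x) - (flow t' x - flow t x) /\<^sub>R (t' - t)) \<bullet> (s - flow t x) \<le> \<bar>t' - t\<bar> * C"
      unfolding C_def by (intro flow_quotient_normal t x s G_def) auto
    with elim show ?case by linarith
  qed
qed

text \<open>From the right at time 0 the speed bound \<open>exp (K * h) * norm (field x)\<close>
  tends to the norm of the field, so the limit criterion applies at every point of \<open>S\<close>,
  with no exceptional set.\<close>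

lemma flow_right_derivative:
  assumes x: "x \<in> S"
  shows "((\<lambda>h. flow h x) has_vector_derivative field x) (at 0 within {0..})"
proof -
  have "((\<lambda>h. (flow h x - x) /\<^sub>R (h - 0)) \<longlongrightarrow> field x) (at 0 within {0..})"
  proof (rule tangent_proj_tendsto[OF S(2) x])
    show "\<forall>\<^sub>F h in at 0 within {0..}. (g x - (flow h x - x) /\<^sub>R (h - 0)) \<bullet> (s - x) < e"
      if "s \<in> S" "e > 0" for s e
      using quotient_normal_eventually[OF order_refl x that] flow_0[OF x] by simp
    have "((\<lambda>h. exp (K * h) * norm (field x)) \<longlongrightarrow> exp (K * 0) * norm (field x)) (at 0 within {0..})"
      by (intro tendsto_intros)
    then show "((\<lambda>h. exp (K * h) * norm (field x)) \<longlongrightarrow> norm (field x)) (at 0 within {0..})" by simp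
    have "norm ((flow h x - x) /\<^sub>R (h - 0)) \<le> exp (K * h) * norm (field x)" if "h > 0" for h
      using flow_speed_field[OF less_imp_le[OF that] x] that by (intro norm_quotient_le) (auto simp: mult.assoc)
    then show "\<forall>\<^sub>F h in at 0 within {0..}. norm ((flow h x - x) /\<^sub>R (h - 0)) \<le> exp (K * h) * norm (field x)"
      by (auto simp: eventually_at_filter intro: always_eventually)
  qed
  then show ?thesis unfolding has_vector_derivative_quotient_iff by (simp add: flow_0[OF x])
qed

text \<open>\<open>flow t\<close> commutes with a short flow and is Lipschitz with constant
  \<open>exp (K * t)\<close>, so it magnifies initial difference quotients by at most this factor;
  both sides then pass to the right derivatives.\<close>

lemma norm_field_flow_le:
  assumes t: "t \<ge> 0" and x: "x \<in> S"
  shows "norm (field (flow t x)) \<le> exp (K * t) * norm (field x)"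
proof -
  have lim: "((\<lambda>h. norm ((flow h y - y) /\<^sub>R h)) \<longlongrightarrow> norm (field y)) (at 0 within {0..})" if "y \<in> S" for y
  proof (rule tendsto_norm)
    show "((\<lambda>h. (flow h y - y) /\<^sub>R h) \<longlongrightarrow> field y) (at 0 within {0..})"
      using flow_right_derivative[OF that] unfolding has_vector_derivative_quotient_iff
      by (simp add: flow_0[OF that])
  qed
  show ?thesis
  proof (rule tendsto_le)
    show "((\<lambda>h. exp (K * t) * norm ((flow h x - x) /\<^sub>R h)) \<longlongrightarrow> exp (K * t) * norm (field x)) (at 0 within {0..})"
      by (intro tendsto_intros lim x)
    show "((\<lambda>h. norm ((flow h (flow t x) - flow t x) /\<^sub>R h)) \<longlongrightarrow> norm (field (flow t x))) (at 0 within {0..})"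
      by (intro lim flow_in t x)
    have "norm ((flow h (flow t x) - flow t x) /\<^sub>R h) \<le> exp (K * t) * norm ((flow h x - x) /\<^sub>R h)" if "h > 0" for h
    proof -
      have "flow h (flow t x) = flow t (flow h x)"
        using flow_add[OF _ t x, of h] flow_add[OF t _ x, of h] that by (simp add: add.commute)
      then have "norm (flow h (flow t x) - flow t x) \<le> exp (K * t) * norm (flow h x - x)"
        using flow_Lipschitz[OF t flow_in[OF _ x] x, of h] that by simp
      then have "norm ((flow h (flow t x) - flow t x) /\<^sub>R h) \<le> exp (K * t) * norm (flow h x - x) / h"
        using that by (intro norm_quotient_le) auto
      then show ?thesis using that by (simp add: divide_inverse_commute mult.left_commute)
    qed
    then show "\<forall>\<^sub>F h in at 0 within {0..}. norm ((flow h (flow t x) - flow t x) /\<^sub>R h) \<le> exp (K * t) * norm ((flow h x - x) /\<^sub>R h)"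
      by (auto simp: eventually_at_filter intro: always_eventually)
    show "at (0::real) within {0..} \<noteq> bot" by (simp add: at_within_Ici_at_right)
  qed
qed

text \<open>The rescaled speed is nonincreasing, so it is continuous up to countably many times. At its
  points of continuity left difference quotients are not longer than the projected field, which
  identifies their limit.\<close>

lemma flow_has_vector_derivative:
  assumes x: "x \<in> S" and t: "t \<ge> 0"
    and cont: "continuous (at t within {0..}) (\<lambda>t. - (exp (- K * t) * norm (field (flow t x))))"
  shows "((\<lambda>t. flow t x) has_vector_derivative field (flow t x)) (at t within {0..})"
proof -
  define N where "N t = norm (field (flow t x))" for t
  have "((\<lambda>t'. exp (K * t') * (- (- (exp (- K * t') * N t')))) \<longlongrightarrow> exp (K * t) * (- (- (exp (- K * t) * N t)))) (at t within {0..})"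
    unfolding N_def by (rule tendsto_mult[OF _ tendsto_minus[OF cont[unfolded continuous_within]]]) (intro tendsto_intros)
  moreover have "exp (K * s) * (- (- (exp (- K * s) * N s))) = N s" for s by (simp add: exp_minus)
  ultimately have N: "(N \<longlongrightarrow> N t) (at t within {0..})" by (simp only:)
  \<comment> \<open>A quotient is bounded through the field at the earlier of the two times; the
    maximum covers both orders, and continuity of \<open>N\<close> at \<open>t\<close> makes it tend
    to \<open>N t\<close>.\<close>
  define b where "b t' = exp (K * \<bar>t' - t\<bar>) * max (N t) (N t')" for t'
  have "(b \<longlongrightarrow> exp (K * \<bar>t - t\<bar>) * max (N t) (N t)) (at t within {0..})"
    unfolding b_def by (intro tendsto_intros N)
  then have b: "(b \<longlongrightarrow> N t) (at t within {0..})" by simp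
  have speed: "norm ((flow t' x - flow t x) /\<^sub>R (t' - t)) \<le> b t'" if "t' \<ge> 0" "t' \<noteq> t" for t'
  proof -
    have main: "norm (flow (r + h) x - flow r x) \<le> h * (exp (K * h) * N r)" if "r \<ge> 0" "h > 0" for r h
      using flow_speed_field[OF _ flow_in[OF that(1) x], of h] flow_add[OF _ that(1) x, of h] that
      unfolding N_def by (simp add: add.commute mult.assoc)
    have "norm (flow t' x - flow t x) \<le> \<bar>t' - t\<bar> * b t'"
    proof (cases "t < t'")
      case True
      have "(t' - t) * (exp (K * (t' - t)) * N t) \<le> (t' - t) * (exp (K * (t' - t)) * max (N t) (N t'))"
        using True by (intro mult_left_mono) auto
      moreover have "norm (flow t' x - flow t x) \<le> (t' - t) * (exp (K * (t' - t)) * N t)"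
        using main[OF t, of "t' - t"] True by simp
      ultimately have "norm (flow t' x - flow t x) \<le> (t' - t) * (exp (K * (t' - t)) * max (N t) (N t'))" by linarith
      then show ?thesis using True unfolding b_def by simp
    next
      case False
      then have "t' < t" using that by simp
      have "(t - t') * (exp (K * (t - t')) * N t') \<le> (t - t') * (exp (K * (t - t')) * max (N t) (N t'))"
        using \<open>t' < t\<close> by (intro mult_left_mono) auto
      moreover have "norm (flow t x - flow t' x) \<le> (t - t') * (exp (K * (t - t')) * N t')"
        using main[OF \<open>t' \<ge> 0\<close>, of "t - t'"] \<open>t' < t\<close> by simp
      ultimately have "norm (flow t x - flow t' x) \<le> (t - t') * (exp (K * (t - t')) * max (N t) (N t'))" by linarith
      then show ?thesis using \<open>t' < t\<close> unfolding b_def by (simp add: norm_minus_commute)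
    qed
    then show ?thesis using that by (intro norm_quotient_le) auto
  qed
  have "((\<lambda>t'. (flow t' x - flow t x) /\<^sub>R (t' - t)) \<longlongrightarrow> field (flow t x)) (at t within {0..})"
  proof (rule tangent_proj_tendsto[OF S(2) flow_in[OF t x]])
    show "\<forall>\<^sub>F t' in at t within {0..}. norm ((flow t' x - flow t x) /\<^sub>R (t' - t)) \<le> b t'"
      using speed by (auto simp: eventually_at_filter intro: always_eventually)
  qed (use quotient_normal_eventually[OF t x] b N_def in auto)
  then show ?thesis unfolding has_vector_derivative_quotient_iff .
qed

proposition flow_caratheodory:
  assumes x: "x \<in> S"
  shows "caratheodory_solution field (\<lambda>t. flow t x)"
  unfolding caratheodory_solution_def
proof (intro conjI allI impI)
  fix T :: real assume "T \<ge> 0"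
  show "ac_on 0 T (\<lambda>t. flow t x)"
    using flow_increment[OF _ _ _ x, of _ _ T] by (intro ac_Lipschitz[where C = "speed_bound T x"]) (simp add: mult.commute)
next
  \<comment> \<open>The minus sign turns the nonincreasing rescaled speed into an increasing
    function, whose discontinuities are countable.\<close>
  define f where "f t = - (exp (- K * t) * norm (field (flow t x)))" for t
  have "mono_on {0..} f"
  proof (rule mono_onI)
    fix r s :: real assume rs: "r \<in> {0..}" "s \<in> {0..}" "r \<le> s"
    have "flow s x = flow (s - r) (flow r x)" using flow_add[of "s - r" r x] rs x by simp
    then have "norm (field (flow s x)) \<le> exp (K * (s - r)) * norm (field (flow r x))"
      using norm_field_flow_le[of "s - r" "flow r x"] flow_in[OF _ x, of r] rs by simp
    then have "exp (- K * s) * norm (field (flow s x)) \<le> exp (- K * s) * (exp (K * (s - r)) * norm (field (flow r x)))"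
      by (intro mult_left_mono) auto
    also have "\<dots> = exp (- K * r) * norm (field (flow r x))"
      by (simp add: mult.assoc[symmetric] exp_add[symmetric] algebra_simps)
    finally show "f r \<le> f s" unfolding f_def by simp
  qed
  then have "countable {a \<in> {0..}. \<not> continuous (at a within {0..}) f}" by (rule mono_on_ctble_discont)
  then have "{a \<in> {0..}. \<not> continuous (at a within {0..}) f} \<in> null_sets lebesgue"
    by (intro null_sets_completionI countable_imp_null_set_lborel)
  then show "AE t in lebesgue. 0 \<le> t \<longrightarrow> ((\<lambda>t. flow t x) has_vector_derivative field (flow t x)) (at t within {0..})"
    by (rule AE_I') (use flow_has_vector_derivative[OF x] in \<open>auto simp: f_def[abs_def]\<close>)
qed

text \<open>At points of \<open>S\<close> the normal parts removed by the projection can only bring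
  the curves together, so the Lipschitz constant of \<open>g\<close> controls the growth of the
  distance; the factor \<open>exp (- K * s)\<close> absorbs this growth and leaves a nonincreasing
  norm.\<close>

lemma caratheodory_contraction:
  assumes u: "caratheodory_solution field u" "\<And>t. t \<ge> 0 \<Longrightarrow> u t \<in> S"
    and w: "caratheodory_solution field w" "\<And>t. t \<ge> 0 \<Longrightarrow> w t \<in> S"
    and t: "t \<ge> 0"
  shows "norm (u t - w t) \<le> exp (K * t) * norm (u 0 - w 0)"
proof -
  define z where "z s = exp (- K * s) *\<^sub>R (u s - w s)" for s
  have acu: "ac_on 0 t u" "ac_on 0 t w"
    using u(1) w(1) t unfolding caratheodory_solution_def by auto
  have ac: "ac_on 0 t (\<lambda>s. (u s, w s))" by (rule ac_Pair[OF acu])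
  obtain B where B: "B > 0" "\<And>x. x \<in> {0..t} \<Longrightarrow> norm (u x, w x) \<le> B" using ac_bounded[OF ac] by metis
  have acz: "ac_on 0 t z"
  proof (rule ac_Lipschitz_pullback[OF ac, where C = "2 + 2 * B * K"])
    fix r s :: real assume rs: "0 \<le> r" "r \<le> s" "s \<le> t"
    let ?p = "norm ((u s, w s) - (u r, w r))"
    have "norm (u r) \<le> B" "norm (w r) \<le> B"
      using B(2)[of r] rs norm_fst_le[of "u r" "w r"] norm_snd_le[of "w r" "u r"] by auto
    then have bd: "norm (u r - w r) \<le> 2 * B" using norm_triangle_ineq4[of "u r" "w r"] by linarith
    have "norm (u s - u r) \<le> ?p" "norm (w s - w r) \<le> ?p"
      using norm_fst_le[of "u s - u r" "w s - w r"] norm_snd_le[of "w s - w r" "u s - u r"] by auto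
    then have inc: "norm ((u s - w s) - (u r - w r)) \<le> 2 * ?p" by norm
    have e: "\<bar>exp (- K * s) - exp (- K * r)\<bar> \<le> K * (s - r)"
    proof -
      have "exp (- K * s) = exp (- K * r) * exp (- (K * (s - r)))" by (simp add: exp_add[symmetric] algebra_simps)
      moreover have "1 - K * (s - r) \<le> exp (- (K * (s - r)))" using exp_ge_add_one_self[of "- (K * (s - r))"] by simp
      moreover have "exp (- (K * (s - r))) \<le> 1" using K rs by simp
      moreover have "exp (- K * r) \<le> 1" using K rs by simp
      ultimately have "\<bar>exp (- K * s) - exp (- K * r)\<bar> = exp (- K * r) * (1 - exp (- (K * (s - r))))"
        by (simp add: abs_mult algebra_simps abs_if mult_le_cancel_left1)
      also have "\<dots> \<le> 1 * (K * (s - r))"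
        using \<open>exp (- K * r) \<le> 1\<close> \<open>1 - K * (s - r) \<le> exp (- (K * (s - r)))\<close> \<open>exp (- (K * (s - r))) \<le> 1\<close>
        by (intro mult_mono) auto
      finally show ?thesis by simp
    qed
    have "z s - z r = exp (- K * s) *\<^sub>R ((u s - w s) - (u r - w r)) + (exp (- K * s) - exp (- K * r)) *\<^sub>R (u r - w r)"
      unfolding z_def by (simp add: algebra_simps)
    also have "norm \<dots> \<le> exp (- K * s) * norm ((u s - w s) - (u r - w r)) + \<bar>exp (- K * s) - exp (- K * r)\<bar> * norm (u r - w r)"
      by (intro order_trans[OF norm_triangle_ineq]) simp
    also have "\<dots> \<le> 1 * (2 * ?p) + K * (s - r) * (2 * B)"
      using K rs inc bd e by (intro add_mono mult_mono) auto
    also have "\<dots> \<le> (2 + 2 * B * K) * (?p + (s - r))"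
    proof -
      have "0 \<le> 2 * B * K * ?p + 2 * (s - r)" using B(1) K rs by (intro add_nonneg_nonneg mult_nonneg_nonneg) auto
      then show ?thesis by (simp add: algebra_simps)
    qed
    finally show "norm (z s - z r) \<le> (2 + 2 * B * K) * (?p + (s - r))" .
  qed
  have "AE s in lebesgue. (0 \<le> s \<longrightarrow> (u has_vector_derivative field (u s)) (at s within {0..}))
      \<and> (0 \<le> s \<longrightarrow> (w has_vector_derivative field (w s)) (at s within {0..}))"
    using u(1) w(1) unfolding caratheodory_solution_def by (simp only: AE_conj_iff)
  then have "AE s in lebesgue. 0 \<le> s \<longrightarrow> s < t \<longrightarrow>
      (\<exists>d. (z has_vector_derivative d) (at s within {0..}) \<and> z s \<bullet> d \<le> - 0)"
  proof (rule AE_mp, intro AE_I2 impI)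
    fix s assume "(0 \<le> s \<longrightarrow> (u has_vector_derivative field (u s)) (at s within {0..}))
      \<and> (0 \<le> s \<longrightarrow> (w has_vector_derivative field (w s)) (at s within {0..}))" and s: "0 \<le> s"
    then have der: "(u has_vector_derivative field (u s)) (at s within {0..})"
      "(w has_vector_derivative field (w s)) (at s within {0..})" by auto
    define d where "d = exp (- K * s) *\<^sub>R (field (u s) - field (w s)) + (- K * exp (- K * s)) *\<^sub>R (u s - w s)"
    have "((\<lambda>s. exp (- K * s)) has_real_derivative (- K * exp (- K * s))) (at s within {0..})"
      by (auto intro!: derivative_eq_intros)
    then have "(z has_vector_derivative d) (at s within {0..})"
      unfolding z_def d_def by (intro has_vector_derivative_scaleR has_vector_derivative_diff der)
    moreover have "z s \<bullet> d \<le> 0"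
    proof -
      have cS: "convex S" using projected_field_axioms by (simp add: projected_field_def)
      have S: "u s \<in> S" "w s \<in> S" using u(2) w(2) s by auto
      have "(g (u s) - field (u s)) \<bullet> (w s - u s) \<le> 0" "(g (w s) - field (w s)) \<bullet> (u s - w s) \<le> 0"
        using tangent_proj_normal(1)[OF cS S(1), of "g (u s)"]
          tangent_proj_normal(1)[OF cS S(2), of "g (w s)"] S by (auto simp: normal_cone_def)
      then have "(u s - w s) \<bullet> (field (u s) - field (w s)) \<le> (g (u s) - g (w s)) \<bullet> (u s - w s)"
        by (simp add: algebra_simps inner_commute)
      also have "\<dots> \<le> norm (g (u s) - g (w s)) * norm (u s - w s)" by (rule norm_cauchy_schwarz)
      also have "\<dots> \<le> K * norm (u s - w s) * norm (u s - w s)" by (intro mult_right_mono Lip norm_ge_zero)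
      finally have *: "(u s - w s) \<bullet> (field (u s) - field (w s)) - K * ((u s - w s) \<bullet> (u s - w s)) \<le> 0"
        by (simp add: dot_square_norm power2_eq_square)
      have "z s \<bullet> d = (exp (- K * s))\<^sup>2 * ((u s - w s) \<bullet> (field (u s) - field (w s)) - K * ((u s - w s) \<bullet> (u s - w s)))"
        unfolding z_def d_def inner_add_right inner_scaleR_left inner_scaleR_right
        by (simp only: power2_eq_square algebra_simps)
      then show ?thesis using * by (simp add: mult_nonneg_nonpos)
    qed
    ultimately show "\<exists>d. (z has_vector_derivative d) (at s within {0..}) \<and> z s \<bullet> d \<le> - 0" by auto
  qed
  then have "(norm (z t))\<^sup>2 + 2 * 0 * (t - 0) \<le> (norm (z 0))\<^sup>2" by (intro ac_energy_decay[OF acz _ t]) auto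
  then have "norm (z t) \<le> norm (z 0)" using power2_le_imp_le[OF _ norm_ge_zero] by simp
  then have "exp (K * t) * norm (z t) \<le> exp (K * t) * norm (u 0 - w 0)" unfolding z_def by (intro mult_left_mono) auto
  moreover have "exp (K * t) * norm (z t) = norm (u t - w t)"
    unfolding z_def by (simp add: mult.assoc[symmetric] exp_add[symmetric])
  ultimately show ?thesis by simp
qed

proposition caratheodory_unique:
  assumes u: "caratheodory_solution field u" "\<And>t. t \<ge> 0 \<Longrightarrow> u t \<in> S" and t: "t \<ge> 0"
  shows "u t = flow t (u 0)"
proof -
  have u0: "u 0 \<in> S" using u(2)[of 0] by simp
  have "norm (u t - flow t (u 0)) \<le> exp (K * t) * norm (u 0 - flow 0 (u 0))"
    using caratheodory_contraction[OF u flow_caratheodory[OF u0] _ t] flow_in u0 by simp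
  then show ?thesis by (simp add: flow_0[OF u0])
qed

end

section \<open>Convergence of dissipative flows\<close>

context projected_field begin

lemma ac_flow:
  assumes "x \<in> S" "T \<ge> 0" shows "ac_on 0 T (\<lambda>t. flow t x)"
  using flow_caratheodory[OF assms(1)] assms(2) unfolding caratheodory_solution_def by blast

text \<open>\<open>q\<close> is a lower bound for the dissipation relative to \<open>e\<close>.
  Projecting \<open>g\<close> can only decrease its pairing with \<open>flow \<tau> x - e\<close>,
  since the removed part is normal; hence the squared distance falls at rate at least twice
  \<open>q\<close>. A positive value of \<open>q\<close> would persist for a short time by
  continuity and contradict a constant distance.\<close>

lemma
  assumes e: "e \<in> S" and diss: "\<And>x. x \<in> S \<Longrightarrow> (x - e) \<bullet> g x \<le> - q x"
    and q: "continuous_on UNIV q" "\<And>x. x \<in> S \<Longrightarrow> 0 \<le> q x" and x: "x \<in> S"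
  shows flow_nonexpanding: "\<And>t. t \<ge> 0 \<Longrightarrow> norm (flow t x - e) \<le> norm (x - e)"
    and dissipation_vanishes: "\<And>t. t \<ge> 0 \<Longrightarrow> (\<And>s. s \<ge> 0 \<Longrightarrow> norm (flow s x - e) = norm (x - e)) \<Longrightarrow> q (flow t x) = 0"
proof -
  have ac: "ac_on 0 T (\<lambda>t. flow t x - e)" if "T \<ge> 0" for T
    by (rule ac_Lipschitz_pullback[OF ac_flow[OF x that], where C = 1]) auto
  have decay: "(norm (flow t x - e))\<^sup>2 + 2 * c * (t - s) \<le> (norm (flow s x - e))\<^sup>2"
    if st: "0 \<le> s" "s \<le> t" and c: "\<And>\<tau>. s \<le> \<tau> \<Longrightarrow> \<tau> < t \<Longrightarrow> c \<le> q (flow \<tau> x)" for s t c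
  proof (rule ac_energy_decay[OF ac[of t]])
    have "AE \<tau> in lebesgue. 0 \<le> \<tau> \<longrightarrow> ((\<lambda>t. flow t x) has_vector_derivative field (flow \<tau> x)) (at \<tau> within {0..})"
      using flow_caratheodory[OF x] unfolding caratheodory_solution_def by blast
    then show "AE \<tau> in lebesgue. s \<le> \<tau> \<longrightarrow> \<tau> < t \<longrightarrow>
      (\<exists>d. ((\<lambda>t. flow t x - e) has_vector_derivative d) (at \<tau> within {0..}) \<and> (flow \<tau> x - e) \<bullet> d \<le> - c)"
    proof (rule AE_mp, intro AE_I2 impI)
      fix \<tau> assume "0 \<le> \<tau> \<longrightarrow> ((\<lambda>t. flow t x) has_vector_derivative field (flow \<tau> x)) (at \<tau> within {0..})"
        and \<tau>: "s \<le> \<tau>" "\<tau> < t"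
      then have der: "((\<lambda>t. flow t x - e) has_vector_derivative field (flow \<tau> x)) (at \<tau> within {0..})"
        using st by (auto intro: derivative_eq_intros)
      have u: "flow \<tau> x \<in> S" using st \<tau> by (intro flow_in x) auto
      have "(g (flow \<tau> x) - field (flow \<tau> x)) \<bullet> (e - flow \<tau> x) \<le> 0"
        using tangent_proj_normal(1)[OF S(2) u] e u by (simp add: normal_cone_def)
      then have "(flow \<tau> x - e) \<bullet> field (flow \<tau> x) \<le> (flow \<tau> x - e) \<bullet> g (flow \<tau> x)"
        by (simp add: algebra_simps inner_commute)
      with diss[OF u] c[OF \<tau>] der
      show "\<exists>d. ((\<lambda>t. flow t x - e) has_vector_derivative d) (at \<tau> within {0..}) \<and> (flow \<tau> x - e) \<bullet> d \<le> - c"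
        by (intro exI[of _ "field (flow \<tau> x)"]) auto
    qed
  qed (use st in auto)
  show le: "norm (flow t x - e) \<le> norm (x - e)" if "t \<ge> 0" for t
  proof (rule power2_le_imp_le)
    show "(norm (flow t x - e))\<^sup>2 \<le> (norm (x - e))\<^sup>2"
      using decay[of 0 t 0] q(2) flow_in x that by (simp add: flow_0)
  qed simp
  show "q (flow t x) = 0" if t: "t \<ge> 0" and const: "\<And>s. s \<ge> 0 \<Longrightarrow> norm (flow s x - e) = norm (x - e)" for t
  proof (rule ccontr)
    assume "q (flow t x) \<noteq> 0"
    then have pos: "q (flow t x) > 0" using q(2)[OF flow_in[OF t x]] by simp
    have "continuous_on {0..t+1} (\<lambda>t. flow t x - e)" using t by (intro ac_imp_continuous_on ac) simp
    from continuous_on_add[OF this continuous_on_const[of _ e]]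
    have "continuous_on {0..t+1} (\<lambda>t. flow t x)" by simp
    then have "continuous_on {0..t+1} (\<lambda>\<tau>. q (flow \<tau> x))"
      by (intro continuous_on_compose2[OF q(1)]) auto
    then have "\<exists>d>0. \<forall>\<tau>\<in>{0..t+1}. dist \<tau> t < d \<longrightarrow> dist (q (flow \<tau> x)) (q (flow t x)) < q (flow t x) / 2"
      using t pos unfolding continuous_on_iff by (metis atLeastAtMost_iff half_gt_zero le_add_same_cancel1 zero_le_one)
    then obtain d where d: "d > 0" "\<And>\<tau>. \<tau> \<in> {0..t+1} \<Longrightarrow> dist \<tau> t < d \<Longrightarrow> dist (q (flow \<tau> x)) (q (flow t x)) < q (flow t x) / 2"
      by blast
    define r where "r = min d 1"
    have r: "r > 0" using d unfolding r_def by simp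
    have "q (flow t x) / 2 \<le> q (flow \<tau> x)" if "t \<le> \<tau>" "\<tau> < t + r" for \<tau>
    proof -
      have "\<bar>q (flow \<tau> x) - q (flow t x)\<bar> < q (flow t x) / 2"
        using d(2)[of \<tau>] that t unfolding r_def dist_real_def by auto
      then show ?thesis by linarith
    qed
    then have "(norm (flow (t + r) x - e))\<^sup>2 + 2 * (q (flow t x) / 2) * ((t + r) - t) \<le> (norm (flow t x - e))\<^sup>2"
      using t r by (intro decay) auto
    moreover have "q (flow t x) * r > 0" using pos r by simp
    ultimately show False using const[of "t + r"] const[of t] t r by simp
  qed
qed

text \<open>As long as the speed is at least \<epsilon>, the linear functional \<open>h\<close>
  grows along the orbit at rate at least \<open>\<epsilon>\<^sup>2\<close>, which a bounded orbit
  cannot sustain. So the speed tends to zero along some times, and a limit point of the orbit at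
  such times is stationary.\<close>

lemma flow_stationary_limit:
  assumes x: "x \<in> S" and B: "\<And>t. t \<ge> 0 \<Longrightarrow> norm (flow t x) \<le> B"
    and h: "AE t in lebesgue. 0 \<le> t \<longrightarrow> (norm (field (flow t x)))\<^sup>2 \<le> h \<bullet> field (flow t x)"
  obtains e s where "e \<in> S" "g e \<in> normal_cone S e" "\<And>n. s n \<ge> 0" "(\<lambda>n. flow (s n) x) \<longlonglongrightarrow> e"
proof -
  have slow: "\<exists>t\<ge>0. norm (field (flow t x)) < \<epsilon>" if \<epsilon>: "\<epsilon> > 0" for \<epsilon>
  proof (rule ccontr)
    assume "\<not> ?thesis"
    then have fast: "\<epsilon> \<le> norm (field (flow t x))" if "t \<ge> 0" for t using that by (auto simp: not_less)
    define f where "f t = - (h \<bullet> flow t x) + \<epsilon>\<^sup>2 * t" for t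
    have f: "f T \<le> f 0" if T: "T \<ge> 0" for T
    proof (rule ac_le_of_deriv_le_0[where f = f and T = T and s = 0 and t = T])
      show "ac_on 0 T f"
      proof (rule ac_Lipschitz_pullback[OF ac_flow[OF x T], where C = "norm h + \<epsilon>\<^sup>2"])
        fix u v :: real assume uv: "0 \<le> u" "u \<le> v" "v \<le> T"
        have "f v - f u = - (h \<bullet> (flow v x - flow u x)) + \<epsilon>\<^sup>2 * (v - u)" unfolding f_def by (simp add: algebra_simps)
        also have "norm \<dots> \<le> norm h * norm (flow v x - flow u x) + \<epsilon>\<^sup>2 * (v - u)"
          using Cauchy_Schwarz_ineq2[of h "flow v x - flow u x"] uv
          by (intro order_trans[OF norm_triangle_ineq] add_mono) (auto simp: abs_mult)
        also have "\<dots> \<le> (norm h + \<epsilon>\<^sup>2) * (norm (flow v x - flow u x) + (v - u))"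
        proof -
          have "0 \<le> norm h * (v - u) + \<epsilon>\<^sup>2 * norm (flow v x - flow u x)"
            using uv by (intro add_nonneg_nonneg mult_nonneg_nonneg) auto
          then show ?thesis by (simp add: algebra_simps)
        qed
        finally show "norm (f v - f u) \<le> (norm h + \<epsilon>\<^sup>2) * (norm (flow v x - flow u x) + (v - u))" .
      qed
      have "AE t in lebesgue. (0 \<le> t \<longrightarrow> ((\<lambda>t. flow t x) has_vector_derivative field (flow t x)) (at t within {0..}))
          \<and> (0 \<le> t \<longrightarrow> (norm (field (flow t x)))\<^sup>2 \<le> h \<bullet> field (flow t x))"
        using flow_caratheodory[OF x] h unfolding caratheodory_solution_def by (simp only: AE_conj_iff)
      then show "AE t in lebesgue. 0 \<le> t \<longrightarrow> t < T \<longrightarrow> (\<exists>D\<le>0. (f has_vector_derivative D) (at t within {0..}))"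
      proof (rule AE_mp, intro AE_I2 impI)
        fix t assume "(0 \<le> t \<longrightarrow> ((\<lambda>t. flow t x) has_vector_derivative field (flow t x)) (at t within {0..}))
          \<and> (0 \<le> t \<longrightarrow> (norm (field (flow t x)))\<^sup>2 \<le> h \<bullet> field (flow t x))" and t: "0 \<le> t"
        then have der: "((\<lambda>t. flow t x) has_vector_derivative field (flow t x)) (at t within {0..})"
          and hv: "(norm (field (flow t x)))\<^sup>2 \<le> h \<bullet> field (flow t x)" by auto
        have "((\<lambda>t. \<epsilon>\<^sup>2 * t) has_vector_derivative \<epsilon>\<^sup>2) (at t within {0..})"
          by (auto intro!: derivative_eq_intros simp: has_real_derivative_iff_has_vector_derivative[symmetric])
        then have "(f has_vector_derivative (- (h \<bullet> field (flow t x)) + \<epsilon>\<^sup>2)) (at t within {0..})"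
          unfolding f_def
          by (intro has_vector_derivative_add has_vector_derivative_minus
              bounded_linear.has_vector_derivative[OF bounded_linear_inner_right der])
        moreover have "\<epsilon>\<^sup>2 \<le> (norm (field (flow t x)))\<^sup>2" using fast[OF t] \<epsilon> by (intro power_mono) auto
        ultimately show "\<exists>D\<le>0. (f has_vector_derivative D) (at t within {0..})"
          using hv by (intro exI[of _ "- (h \<bullet> field (flow t x)) + \<epsilon>\<^sup>2"]) auto
      qed
    qed (use T in auto)
    have hB: "\<bar>h \<bullet> flow t x\<bar> \<le> norm h * B" if "t \<ge> 0" for t
      using Cauchy_Schwarz_ineq2[of h "flow t x"] mult_left_mono[OF B[OF that] norm_ge_zero[of h]] by linarith
    \<comment> \<open>By time \<open>T\<close> the growth \<open>2 * norm h * B + 1\<close> exceeds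
      the largest possible variation of \<open>h\<close> on the orbit.\<close>
    define T where "T = (2 * norm h * B + 1) / \<epsilon>\<^sup>2"
    have "B \<ge> 0" using B[of 0] norm_ge_zero[of "flow 0 x"] by linarith
    then have T: "T \<ge> 0" "\<epsilon>\<^sup>2 * T = 2 * norm h * B + 1" unfolding T_def using \<epsilon> by auto
    have "\<epsilon>\<^sup>2 * T \<le> h \<bullet> flow T x - h \<bullet> flow 0 x" using f[OF T(1)] unfolding f_def by simp
    then show False using hB[OF T(1)] hB[of 0] T(2) by (simp add: abs_le_iff)
  qed
  have "\<exists>t\<ge>0. norm (field (flow t x)) < inverse (real (Suc n))" for n by (rule slow) simp
  then obtain t where t: "\<And>n. t n \<ge> 0" "\<And>n. norm (field (flow (t n) x)) < inverse (real (Suc n))" by metis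
  have "bounded (range (\<lambda>n. flow (t n) x))" using B t(1) by (intro boundedI) blast
  then obtain e r where r: "strict_mono (r :: nat \<Rightarrow> nat)" "((\<lambda>n. flow (t n) x) \<circ> r) \<longlonglongrightarrow> e"
    using bounded_imp_convergent_subsequence by blast
  have lim: "(\<lambda>n. flow (t (r n)) x) \<longlonglongrightarrow> e" using r(2) by (simp add: o_def)
  have inS: "flow (t (r n)) x \<in> S" for n by (intro flow_in t x)
  have e: "e \<in> S" using S(1) _ lim by (rule closed_sequentially) (rule inS)
  have "(\<lambda>n. field (flow (t n) x)) \<longlonglongrightarrow> 0"
    by (rule Lim_null_comparison[OF _ LIMSEQ_inverse_real_of_nat])
      (intro always_eventually allI less_imp_le t)
  then have v: "(\<lambda>n. field (flow (t (r n)) x)) \<longlonglongrightarrow> 0" using r(1) by (rule LIMSEQ_subseq_LIMSEQ[unfolded o_def])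
  \<comment> \<open>The field may jump at \<open>e\<close>, so stationarity is not obtained by
    passing to the limit in it; the normal inequality is closed and survives.\<close>
  have "g e \<bullet> (y - e) \<le> 0" if y: "y \<in> S" for y
  proof (rule tendsto_upperbound)
    show "(\<lambda>n. (g (flow (t (r n)) x) - field (flow (t (r n)) x)) \<bullet> (y - flow (t (r n)) x)) \<longlonglongrightarrow> g e \<bullet> (y - e)"
      using tendsto_inner[OF tendsto_diff[OF g_tendsto[OF lim] v] tendsto_diff[OF tendsto_const[of y] lim]] by simp
    show "\<forall>\<^sub>F n in sequentially. (g (flow (t (r n)) x) - field (flow (t (r n)) x)) \<bullet> (y - flow (t (r n)) x) \<le> 0"
      using tangent_proj_normal(1)[OF S(2) inS] y inS by (auto simp: normal_cone_def)
  qed simp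
  then have "g e \<in> normal_cone S e" using e by (simp add: normal_cone_def)
  then show ?thesis using that[of e "\<lambda>n. t (r n)"] e t(1) lim by blast
qed

text \<open>An omega-limit point keeps a constant distance to every equilibrium, hence its own orbit
  accumulates at some equilibrium, which is then an omega-limit point at nonincreasing distance.\<close>

proposition flow_converges:
  assumes x: "x \<in> S" and Eq: "Eq \<noteq> {}"
    and dec: "\<And>e y t. e \<in> Eq \<Longrightarrow> y \<in> S \<Longrightarrow> t \<ge> 0 \<Longrightarrow> norm (flow t y - e) \<le> norm (y - e)"
    and inv: "\<And>e y. e \<in> Eq \<Longrightarrow> y \<in> S \<Longrightarrow> (\<And>t. t \<ge> 0 \<Longrightarrow> norm (flow t y - e) = norm (y - e))
      \<Longrightarrow> \<exists>e'\<in>Eq. \<exists>s. (\<forall>n. s n \<ge> 0) \<and> (\<lambda>n::nat. flow (s n) y) \<longlonglongrightarrow> e'"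
  shows "\<exists>e\<in>Eq. ((\<lambda>t. flow t x) \<longlongrightarrow> e) at_top"
proof -
  have anti: "norm (flow t x - e) \<le> norm (flow s x - e)" if "e \<in> Eq" "0 \<le> s" "s \<le> t" for e s t
  proof -
    have "flow t x = flow (t - s) (flow s x)" using flow_add[of "t - s" s x] that x by simp
    then show ?thesis using dec[OF that(1) flow_in[OF that(2) x], of "t - s"] that by simp
  qed
  obtain e where e: "e \<in> Eq" using Eq by blast
  define r where "r t = norm (flow t x - e)" for t
  define \<rho> where "\<rho> = (INF t\<in>{0..}. r t)"
  have bdd: "bdd_below (r ` {0..})" unfolding r_def by (intro bdd_belowI[of _ 0]) auto
  have r: "(r \<longlongrightarrow> \<rho>) at_top"
  proof (rule tendstoI)
    fix \<epsilon> :: real assume "\<epsilon> > 0"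
    have "\<exists>v\<in>r ` {0..}. v < \<rho> + \<epsilon>" unfolding \<rho>_def
      using \<open>\<epsilon> > 0\<close> bdd by (subst cInf_less_iff[symmetric]) auto
    then obtain t0 where t0: "t0 \<ge> 0" "r t0 < \<rho> + \<epsilon>" by auto
    have "dist (r t) \<rho> < \<epsilon>" if "t \<ge> t0" for t
    proof -
      have "\<rho> \<le> r t" unfolding \<rho>_def using that t0 by (intro cINF_lower bdd) auto
      moreover have "r t \<le> r t0" unfolding r_def using anti[OF e t0(1) that] .
      ultimately show ?thesis using t0 by (simp add: dist_real_def)
    qed
    then show "\<forall>\<^sub>F t in at_top. dist (r t) \<rho> < \<epsilon>" by (auto simp: eventually_at_top_linorder)
  qed
  have "bounded (range (\<lambda>n. flow (real n) x))"
  proof (rule boundedI)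
    fix y assume "y \<in> range (\<lambda>n. flow (real n) x)"
    then obtain n where "y = flow (real n) x" by auto
    moreover have "norm (flow (real n) x) \<le> norm (flow (real n) x - e) + norm e" by norm
    ultimately show "norm y \<le> norm (x - e) + norm e" using dec[OF e x, of "real n"] by auto
  qed
  then obtain y \<phi> where \<phi>: "strict_mono (\<phi> :: nat \<Rightarrow> nat)" "((\<lambda>n. flow (real n) x) \<circ> \<phi>) \<longlonglongrightarrow> y"
    using bounded_imp_convergent_subsequence by blast
  have lim: "(\<lambda>n. flow (real (\<phi> n)) x) \<longlonglongrightarrow> y" using \<phi>(2) by (simp add: o_def)
  have y: "y \<in> S" using S(1) _ lim by (rule closed_sequentially) (simp add: flow_in x)
  have shift: "(\<lambda>n. flow (s + real (\<phi> n)) x) \<longlonglongrightarrow> flow s y" if s: "s \<ge> 0" for s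
  proof -
    have b: "norm (flow (s + real (\<phi> n)) x - flow s y) \<le> exp (K * s) * norm (flow (real (\<phi> n)) x - y)" for n
      using flow_Lipschitz[OF s flow_in[OF _ x] y, of "real (\<phi> n)"] flow_add[OF s _ x, of "real (\<phi> n)"] by simp
    have "(\<lambda>n. exp (K * s) * norm (flow (real (\<phi> n)) x - y)) \<longlonglongrightarrow> exp (K * s) * norm (y - y)"
      by (intro tendsto_intros lim)
    then have "(\<lambda>n. exp (K * s) * norm (flow (real (\<phi> n)) x - y)) \<longlonglongrightarrow> 0" by simp
    then have "(\<lambda>n. flow (s + real (\<phi> n)) x - flow s y) \<longlonglongrightarrow> 0"
      by (rule Lim_null_comparison[rotated]) (simp add: b)
    then show ?thesis by (simp add: LIM_zero_iff)
  qed
  have \<phi>_top: "filterlim (\<lambda>n. s + real (\<phi> n)) at_top sequentially" for s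
    by (intro filterlim_tendsto_add_at_top[OF tendsto_const] filterlim_compose[OF filterlim_real_sequentially]
        filterlim_subseq \<phi>)
  \<comment> \<open>Shifted subsequences of one convergent distance share its limit, so the whole
    orbit of the limit point \<open>y\<close> stays at distance \<rho>.\<close>
  have const: "norm (flow s y - e) = \<rho>" if "s \<ge> 0" for s
  proof (rule LIMSEQ_unique)
    show "(\<lambda>n. norm (flow (s + real (\<phi> n)) x - e)) \<longlonglongrightarrow> norm (flow s y - e)"
      by (intro tendsto_intros shift that)
    show "(\<lambda>n. norm (flow (s + real (\<phi> n)) x - e)) \<longlonglongrightarrow> \<rho>"
      using filterlim_compose[OF r \<phi>_top[of s]] unfolding r_def .
  qed
  have "norm (flow t y - e) = norm (y - e)" if "t \<ge> 0" for t
    using const[OF that] const[of 0] by (simp add: flow_0[OF y])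
  then obtain e' s where e': "e' \<in> Eq" "\<And>n::nat. s n \<ge> 0" "(\<lambda>n. flow (s n) y) \<longlonglongrightarrow> e'"
    using inv[OF e y] by blast
  \<comment> \<open>Via \<open>flow (s k) y\<close> the orbit of \<open>x\<close> comes within
    \<epsilon> of \<open>e'\<close> at some time; the nonincreasing distance to \<open>e'\<close>
    keeps it there afterwards.\<close>
  have "((\<lambda>t. flow t x) \<longlongrightarrow> e') at_top"
  proof (rule tendstoI)
    fix \<epsilon> :: real assume "\<epsilon> > 0"
    then obtain k where k: "dist (flow (s k) y) e' < \<epsilon> / 2"
      using tendstoD[OF e'(3), of "\<epsilon> / 2"] unfolding eventually_sequentially by (meson half_gt_zero order_refl)
    obtain n where n: "dist (flow (s k + real (\<phi> n)) x) (flow (s k) y) < \<epsilon> / 2"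
      using tendstoD[OF shift[OF e'(2)[of k]], of "\<epsilon> / 2"] \<open>\<epsilon> > 0\<close> unfolding eventually_sequentially
      by (meson half_gt_zero order_refl)
    have "dist (flow t x) e' < \<epsilon>" if "t \<ge> s k + real (\<phi> n)" for t
    proof -
      have "dist (flow t x) e' \<le> dist (flow (s k + real (\<phi> n)) x) e'"
        using anti[OF e'(1) _ that] e'(2)[of k] unfolding dist_norm by simp
      also have "\<dots> < \<epsilon>" using k n dist_triangle[of "flow (s k + real (\<phi> n)) x" e' "flow (s k) y"] by linarith
      finally show ?thesis .
    qed
    then show "\<forall>\<^sub>F t in at_top. dist (flow t x) e' < \<epsilon>" by (auto simp: eventually_at_top_linorder)
  qed
  then show ?thesis using e'(1) by blast
qed

end

section \<open>Spectral gap of the graph Laplacian\<close>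

lemma laplacian_mult:
  fixes W :: "real^'N^'N"
  shows "(laplacian W *v v) $ i = (\<Sum>j\<in>UNIV. W $ i $ j * (v $ i - v $ j))"
proof -
  have "(laplacian W *v v) $ i = (\<Sum>j\<in>UNIV. ((if i = j then (W *v 1) $ i else 0) - W $ i $ j) * v $ j)"
    by (simp add: matrix_vector_mult_def laplacian_def)
  also have "\<dots> = (\<Sum>j\<in>UNIV. (if i = j then (W *v 1) $ i * v $ j else 0) - W $ i $ j * v $ j)"
    by (intro sum.cong) (auto simp: algebra_simps)
  also have "\<dots> = (W *v 1) $ i * v $ i - (\<Sum>j\<in>UNIV. W $ i $ j * v $ j)"
    by (simp add: sum_subtractf sum.delta')
  also have "\<dots> = (\<Sum>j\<in>UNIV. W $ i $ j * (v $ i - v $ j))"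
    by (simp add: matrix_vector_mult_def sum_distrib_right right_diff_distrib sum_subtractf)
  finally show ?thesis .
qed

lemma laplacian_mult_1: "laplacian W *v 1 = 0"
  by (simp add: vec_eq_iff laplacian_mult)

lemma transpose_laplacian:
  assumes "transpose W = W" shows "transpose (laplacian W) = laplacian W"
proof -
  have "W $ i $ j = W $ j $ i" for i j using assms by (metis transpose_def vec_lambda_beta)
  then show ?thesis by (auto simp: vec_eq_iff transpose_def laplacian_def)
qed

lemma laplacian_symmetric_inner:
  assumes "transpose W = W" shows "(laplacian W *v u) \<bullet> v = u \<bullet> (laplacian W *v v)"
  by (metis assms dot_lmul_matrix transpose_laplacian transpose_matrix_vector)

text \<open>Dirichlet form of the graph: the double sum is added to itself with the indices
  exchanged, using the symmetry of \<open>W\<close>.\<close>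

lemma laplacian_quadratic:
  fixes W :: "real^'N^'N"
  assumes W: "transpose W = W"
  shows "v \<bullet> (laplacian W *v v) = (\<Sum>i\<in>UNIV. \<Sum>j\<in>UNIV. W $ i $ j * (v $ i - v $ j)\<^sup>2) / 2"
proof -
  have sym: "W $ i $ j = W $ j $ i" for i j using W by (metis transpose_def vec_lambda_beta)
  have arith: "a * (w * (a - b)) + b * (w * (b - a)) = w * (a - b)\<^sup>2" for a b w :: real
    by (simp add: power2_eq_square algebra_simps)
  have "v \<bullet> (laplacian W *v v) = (\<Sum>i\<in>UNIV. \<Sum>j\<in>UNIV. v $ i * (W $ i $ j * (v $ i - v $ j)))" (is "_ = ?a")
    by (simp add: inner_vec_def laplacian_mult sum_distrib_left)
  moreover have "?a = (\<Sum>i\<in>UNIV. \<Sum>j\<in>UNIV. v $ j * (W $ i $ j * (v $ j - v $ i)))"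
    by (subst sum.swap) (simp add: sym)
  then have "?a + ?a = (\<Sum>i\<in>UNIV. \<Sum>j\<in>UNIV. v $ i * (W $ i $ j * (v $ i - v $ j)) + v $ j * (W $ i $ j * (v $ j - v $ i)))"
    by (simp add: sum.distrib)
  also have "\<dots> = (\<Sum>i\<in>UNIV. \<Sum>j\<in>UNIV. W $ i $ j * (v $ i - v $ j)\<^sup>2)"
    by (simp only: arith)
  ultimately show ?thesis by simp
qed

lemma inner_1_sum: "(1 :: real^'N) \<bullet> v = (\<Sum>i\<in>UNIV. v $ i)"
  by (simp add: inner_vec_def)

lemma laplacian_1_inner:
  assumes "transpose W = W" shows "1 \<bullet> (laplacian W *v v) = 0"
  using laplacian_symmetric_inner[OF assms, of 1 v] by (simp add: laplacian_mult_1)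

locale weighted_graph =
  fixes W :: "real^'N^'N" and E :: "('N \<times> 'N) set"
  assumes sym: "transpose W = W" and conn: "\<And>i j. (i, j) \<in> E\<^sup>*"
    and pos: "\<And>i j. (i, j) \<in> E \<Longrightarrow> 0 < W $ i $ j" and zero: "\<And>i j. (i, j) \<notin> E \<Longrightarrow> W $ i $ j = 0"
begin

abbreviation L where "L \<equiv> laplacian W"

lemma W_nonneg: "0 \<le> W $ i $ j" using pos[of i j] zero[of i j] by (cases "(i, j) \<in> E") auto

lemma L_nonneg: "0 \<le> v \<bullet> (L *v v)"
  unfolding laplacian_quadratic[OF sym] by (intro divide_nonneg_nonneg sum_nonneg mult_nonneg_nonneg W_nonneg) auto

text \<open>A vanishing sum of nonnegative edge terms makes \<open>v\<close> equal across every
  edge, hence everywhere by connectedness.\<close>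

lemma L_kernel:
  assumes "v \<bullet> (L *v v) = 0" obtains c where "v = c *\<^sub>R 1"
proof -
  have "(\<Sum>i\<in>UNIV. \<Sum>j\<in>UNIV. W $ i $ j * (v $ i - v $ j)\<^sup>2) = 0"
    using assms unfolding laplacian_quadratic[OF sym] by simp
  then have 0: "W $ i $ j * (v $ i - v $ j)\<^sup>2 = 0" for i j
    by (subst (asm) sum_nonneg_eq_0_iff; (intro sum_nonneg mult_nonneg_nonneg W_nonneg)?; simp)
      (subst (asm) sum_nonneg_eq_0_iff; (intro mult_nonneg_nonneg W_nonneg)?; simp)
  have edge: "v $ i = v $ j" if "(i, j) \<in> E" for i j using 0[of i j] pos[OF that] by simp
  have "v $ i = v $ j" for i j using conn[of i j] by (induction rule: rtrancl_induct) (auto simp: edge)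
  then have "v = (v $ undefined) *\<^sub>R 1" by (simp add: vec_eq_iff)
  then show ?thesis by (rule that)
qed

lemma L_kernel': "L *v v = 0 \<Longrightarrow> \<exists>c. v = c *\<^sub>R 1"
  using L_kernel[of v] by auto

text \<open>The minimum of the quadratic form over unit vectors orthogonal to 1 exists by
  compactness; the minimiser is an eigenvector by first-order optimality, and connectedness makes
  the minimum positive.\<close>

lemma Rayleigh_minimum:
  assumes "CARD('N) \<ge> 2"
  obtains m v where "m > 0" "v \<noteq> 0" "1 \<bullet> v = 0" "L *v v = m *\<^sub>R v"
    "\<And>u. 1 \<bullet> u = 0 \<Longrightarrow> m * (norm u)\<^sup>2 \<le> u \<bullet> (L *v u)"
proof -
  let ?B = "sphere 0 1 \<inter> {v :: real^'N. 1 \<bullet> v = 0}"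
  obtain i j :: 'N where ij: "i \<noteq> j" using assms
    by (metis (mono_tags) One_nat_def UNIV_I card_le_Suc0_iff_eq finite not_less_eq_eq numeral_2_eq_2)
  \<comment> \<open>Two distinct agents supply a nonzero vector whose entries sum to zero.\<close>
  have "norm (axis i 1 - axis j 1 :: real^'N) \<noteq> 0" using ij by (simp add: axis_eq_axis)
  then have "(axis i 1 - axis j 1) /\<^sub>R norm (axis i 1 - axis j 1 :: real^'N) \<in> ?B"
    by (simp add: inner_diff_right inner_axis)
  then have ne: "?B \<noteq> {}" by blast
  have comp: "compact ?B" by (intro compact_Int_closed compact_sphere closed_hyperplane)
  have "continuous_on ?B (\<lambda>v. v \<bullet> (L *v v))" by (intro continuous_intros matrix_vector_mult_linear_continuous_on)
  then obtain v where v: "v \<in> ?B" "\<And>u. u \<in> ?B \<Longrightarrow> v \<bullet> (L *v v) \<le> u \<bullet> (L *v u)"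
    using continuous_attains_inf[OF comp ne] by blast
  define m where "m = v \<bullet> (L *v v)"
  have vn: "norm v = 1" "v \<noteq> 0" "1 \<bullet> v = 0" using v(1) by auto
  have min: "m * (norm u)\<^sup>2 \<le> u \<bullet> (L *v u)" if "1 \<bullet> u = 0" for u
  proof (cases "u = 0")
    case False
    then have "m \<le> (u /\<^sub>R norm u) \<bullet> (L *v (u /\<^sub>R norm u))" unfolding m_def using that by (intro v(2)) auto
    also have "\<dots> = (u \<bullet> (L *v u)) / (norm u)\<^sup>2"
      by (simp add: matrix_vector_mult_scaleR power2_eq_square divide_simps)
    finally show ?thesis using False by (simp add: field_simps)
  qed simp
  define w where "w = L *v v - m *\<^sub>R v"
  have w1: "1 \<bullet> w = 0" unfolding w_def by (simp add: inner_diff_right laplacian_1_inner[OF sym] vn)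
  have quad: "0 \<le> 2 * t * (w \<bullet> w) + t\<^sup>2 * (w \<bullet> (L *v w) - m * (norm w)\<^sup>2)" for t
  proof -
    have "m * (norm (v + t *\<^sub>R w))\<^sup>2 \<le> (v + t *\<^sub>R w) \<bullet> (L *v (v + t *\<^sub>R w))"
      by (rule min) (simp add: inner_add_right vn w1)
    moreover have "(v + t *\<^sub>R w) \<bullet> (L *v (v + t *\<^sub>R w)) = m + 2 * t * (w \<bullet> (L *v v)) + t\<^sup>2 * (w \<bullet> (L *v w))"
      using laplacian_symmetric_inner[OF sym, of v w]
      by (simp add: m_def matrix_vector_right_distrib matrix_vector_mult_scaleR inner_add_left inner_add_right
          power2_eq_square algebra_simps inner_commute)
    moreover have "m * (norm (v + t *\<^sub>R w))\<^sup>2 = m + 2 * t * (w \<bullet> (m *\<^sub>R v)) + t\<^sup>2 * (m * (norm w)\<^sup>2)"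
    proof -
      have "(norm (v + t *\<^sub>R w))\<^sup>2 = (norm v)\<^sup>2 + 2 * t * (w \<bullet> v) + t\<^sup>2 * (norm w)\<^sup>2"
        unfolding power2_norm_eq_inner by (simp add: inner_add_left inner_add_right inner_commute power2_eq_square algebra_simps)
      then show ?thesis using vn by (simp add: algebra_simps)
    qed
    ultimately show ?thesis by (simp add: w_def inner_diff_right algebra_simps)
  qed
  have "w = 0"
  proof (rule ccontr)
    assume "w \<noteq> 0"
    \<comment> \<open>Evaluating the quadratic inequality at \<open>t = - (a / b)\<close> gives at
      most \<open>- (a * a / b)\<close>; the summand 1 in \<open>b\<close> keeps it
      positive.\<close>
    define a where "a = w \<bullet> w"
    define b where "b = \<bar>w \<bullet> (L *v w) - m * (norm w)\<^sup>2\<bar> + 1"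
    have ab: "a > 0" "b > 0" using \<open>w \<noteq> 0\<close> unfolding a_def b_def by auto
    have "0 \<le> 2 * (- (a / b)) * a + (- (a / b))\<^sup>2 * (w \<bullet> (L *v w) - m * (norm w)\<^sup>2)"
      unfolding a_def by (rule quad)
    also have "\<dots> \<le> 2 * (- (a / b)) * a + (- (a / b))\<^sup>2 * b"
      unfolding b_def by (intro add_left_mono mult_left_mono) auto
    also have "\<dots> = - (a * a / b)" using ab by (simp add: power2_eq_square field_simps)
    also have "\<dots> < 0" using ab by simp
    finally show False by simp
  qed
  then have eig: "L *v v = m *\<^sub>R v" unfolding w_def by simp
  have "m \<noteq> 0"
  proof
    assume "m = 0"
    then obtain c where c: "v = c *\<^sub>R 1" using L_kernel[of v] m_def by auto
    have "1 \<bullet> v = c * real CARD('N)" unfolding c by (simp add: inner_1_sum)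
    then show False using vn c by simp
  qed
  moreover have "m \<ge> 0" unfolding m_def by (rule L_nonneg)
  ultimately show ?thesis using that[of m v] vn eig min by simp
qed

lemma eigenvectors_orthogonal:
  assumes "L *v u = a *\<^sub>R u" "L *v v = b *\<^sub>R v" "a \<noteq> b" shows "u \<bullet> v = 0"
  using laplacian_symmetric_inner[OF sym, of u v] assms by simp

text \<open>Eigenvectors of distinct eigenvalues are orthogonal by symmetry, and a set of pairwise
  orthogonal vectors is finite.\<close>

lemma finite_eigenvalues: "finite (eigenvalues L)"
proof -
  have "\<forall>e\<in>eigenvalues L. \<exists>v. v \<noteq> 0 \<and> L *v v = e *\<^sub>R v" by (auto simp: eigenvalues_def)
  then obtain f where f: "\<And>e. e \<in> eigenvalues L \<Longrightarrow> f e \<noteq> 0 \<and> L *v f e = e *\<^sub>R f e" by metis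
  have "pairwise orthogonal (f ` eigenvalues L)"
    using f eigenvectors_orthogonal by (auto simp: pairwise_def orthogonal_def) metis
  then have "finite (f ` eigenvalues L)" by (rule pairwise_orthogonal_imp_finite)
  moreover have "inj_on f (eigenvalues L)"
    by (rule inj_onI) (metis f scaleR_cancel_right)
  ultimately show ?thesis by (rule finite_imageD)
qed

text \<open>Connects the list definition with the Rayleigh minimum \<open>m\<close>: the kernel is
  spanned by 1, so 0 occurs once in the multiset, and all other eigenvalues are at least
  \<open>m\<close>. The sorted list thus starts with 0 and \<open>m\<close>, and its entry at index
  1 is \<open>m\<close>.\<close>

proposition second_eigenvalue_laplacian:
  assumes N: "CARD('N) \<ge> 2"
  shows "second_eigenvalue L > 0"
    and "\<And>v. 1 \<bullet> v = 0 \<Longrightarrow> second_eigenvalue L * (norm v)\<^sup>2 \<le> v \<bullet> (L *v v)"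
proof -
  obtain m v where m: "m > 0" and v: "v \<noteq> 0" "1 \<bullet> v = 0" "L *v v = m *\<^sub>R v"
    and min: "\<And>u. 1 \<bullet> u = 0 \<Longrightarrow> m * (norm u)\<^sup>2 \<le> u \<bullet> (L *v u)"
    using Rayleigh_minimum[OF N] by metis
  define M where "M = (\<Sum>e\<in>eigenvalues L. replicate_mset (dim (eigenspace L e)) e)"
  have cnt: "count M e = (if e \<in> eigenvalues L then dim (eigenspace L e) else 0)" for e
    unfolding M_def count_sum using finite_eigenvalues by (simp add: sum.delta')
  have mem: "e \<in># M \<Longrightarrow> e \<in> eigenvalues L" for e
    using cnt[of e] by (auto simp: count_greater_zero_iff[symmetric] split: if_splits)
  have "m \<in> eigenvalues L" using v by (auto simp: eigenvalues_def)
  moreover have "0 < dim (eigenspace L m)"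
  proof (rule gr0I)
    assume "dim (eigenspace L m) = 0"
    then show False using v by (auto simp: dim_eq_0 eigenspace_def)
  qed
  ultimately have mM: "m \<in># M" using cnt[of m] by (simp add: count_greater_zero_iff[symmetric])
  have one: "(1 :: real^'N) \<noteq> 0" by simp
  have "eigenspace L 0 = span {1}"
    using L_kernel' by (auto simp: eigenspace_def span_singleton matrix_vector_mult_scaleR laplacian_mult_1)
  then have "dim (eigenspace L 0) = 1" using one by (simp add: dim_span dim_singleton)
  moreover have "0 \<in> eigenvalues L" using laplacian_mult_1[of W] one by (auto simp: eigenvalues_def intro!: exI[of _ 1])
  ultimately have c0: "count M 0 = 1" using cnt[of 0] by simp
  have big: "e \<ge> m" if e: "e \<in> eigenvalues L" "e \<noteq> 0" for e
  proof -
    obtain u where u: "u \<noteq> 0" "L *v u = e *\<^sub>R u" using e by (auto simp: eigenvalues_def)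
    have "1 \<bullet> u = 0" using eigenvectors_orthogonal[of 1 0 u e] u e by (simp add: laplacian_mult_1)
    from min[OF this] have "m * (norm u)\<^sup>2 \<le> e * (norm u)\<^sup>2" by (simp add: u power2_norm_eq_inner)
    then show ?thesis using u by simp
  qed
  define M' where "M' = M - {#0#} - {#m#}"
  have M: "M = add_mset 0 (add_mset m M')"
  proof -
    have "0 \<in># M" using c0 by (simp add: count_greater_zero_iff[symmetric])
    moreover have "m \<in># M - {#0#}" using mM m by (simp add: in_diff_count)
    ultimately show ?thesis unfolding M'_def by (simp only: insert_DiffM)
  qed
  have M'_ge: "e \<ge> m" if "e \<in># M'" for e
  proof (rule big)
    have "e \<in># M" using that M by simp
    then show "e \<in> eigenvalues L" by (rule mem)
    have "count M 0 = Suc (count M' 0)" using M m by simp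
    then have "count M' 0 = 0" using c0 by simp
    then show "e \<noteq> 0" using that by (auto simp: count_eq_zero_iff)
  qed
  have "sorted_list_of_multiset (add_mset m M') = m # sorted_list_of_multiset M'"
    by (simp add: insort_is_Cons M'_ge)
  then have "sorted_list_of_multiset M = 0 # m # sorted_list_of_multiset M'"
    unfolding M using m by (simp add: less_imp_le)
  then have "second_eigenvalue L = m" unfolding second_eigenvalue_def sorted_eigenvalues_def M_def[symmetric] by simp
  then show "second_eigenvalue L > 0"
    "\<And>v. 1 \<bullet> v = 0 \<Longrightarrow> second_eigenvalue L * (norm v)\<^sup>2 \<le> v \<bullet> (L *v v)" using m min by auto
qed

text \<open>The rank-one summand \<open>(1 \<bullet> u) *\<^sub>R 1\<close> makes the singular
  Laplacian injective, hence surjective; for a right-hand side orthogonal to 1 it vanishes at the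
  solution.\<close>

lemma L_range:
  assumes "1 \<bullet> v = 0" shows "\<exists>u. L *v u = v"
proof -
  define f where "f u = L *v u + (1 \<bullet> u) *\<^sub>R 1" for u
  have lin: "linear f"
    unfolding f_def by (intro linear_compose_add matrix_vector_mul_linear bounded_linear.linear
        bounded_linear_compose[OF bounded_linear_scaleR_left bounded_linear_inner_right])
  have 1: "1 \<bullet> f u = (1 \<bullet> u) * real CARD('N)" for u
  proof -
    have "(1 :: real^'N) \<bullet> 1 = real CARD('N)" by (simp add: inner_1_sum)
    then show ?thesis unfolding f_def by (simp add: inner_add_right laplacian_1_inner[OF sym])
  qed
  have "u = 0" if "f u = 0" for u
  proof -
    have u1: "1 \<bullet> u = 0" using 1[of u] that by simp
    then have "L *v u = 0" using that unfolding f_def by simp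
    then obtain c where c: "u = c *\<^sub>R 1" using L_kernel' by blast
    then show ?thesis using u1 by (simp add: inner_1_sum)
  qed
  then have "inj f" using lin by (simp add: linear_injective_0)
  then obtain u where u: "f u = v" using linear_injective_imp_surjective[OF lin] by (metis surjD)
  then have "1 \<bullet> u = 0" using 1[of u] assms by simp
  then show ?thesis using u unfolding f_def by auto
qed

end

section \<open>Existence of multipliers\<close>

text \<open>Solutions are fixed points of the projected step \<open>f\<close>, a contraction by
  strong monotonicity. The step size \<open>\<mu> / k\<^sup>2\<close> minimises the squared
  contraction factor \<open>1 - 2 * \<tau> * \<mu> + \<tau>\<^sup>2 * k\<^sup>2\<close>.\<close>

lemma variational_inequality_solution:
  fixes G :: "'a::euclidean_space \<Rightarrow> 'a"
  assumes C: "closed C" "convex C" "C \<noteq> {}" and \<mu>: "\<mu> > 0"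
    and mono: "\<And>x y. (x - y) \<bullet> (G x - G y) \<ge> \<mu> * (norm (x - y))\<^sup>2"
    and Lip: "\<And>x y. norm (G x - G y) \<le> l * norm (x - y)"
  shows "\<exists>x\<in>C. \<forall>y\<in>C. 0 \<le> G x \<bullet> (y - x)"
proof -
  \<comment> \<open>The maximum with \<mu> provides a positive Lipschitz constant with
    \<open>\<mu> / k \<le> 1\<close>, so that the argument of the square root in \<open>c\<close> is
    nonnegative.\<close>
  define k where "k = max l \<mu>"
  have k: "k > 0" "\<mu> \<le> k" "l \<le> k" using \<mu> unfolding k_def by auto
  have Lip': "norm (G x - G y) \<le> k * norm (x - y)" for x y
    using Lip[of x y] mult_right_mono[OF k(3), of "norm (x - y)"] by simp
  define \<tau> where "\<tau> = \<mu> / k\<^sup>2"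
  have \<tau>: "\<tau> > 0" unfolding \<tau>_def using \<mu> k by simp
  define f where "f x = closest_point C (x - \<tau> *\<^sub>R G x)" for x
  define c where "c = sqrt (1 - (\<mu> / k)\<^sup>2)"
  have muk: "0 < \<mu> / k" "\<mu> / k \<le> 1" using \<mu> k by auto
  then have "0 < (\<mu> / k)\<^sup>2" "(\<mu> / k)\<^sup>2 \<le> 1" by (intro zero_less_power power_le_one; linarith)+
  then have c: "0 \<le> c" "c < 1" "c\<^sup>2 = 1 - (\<mu> / k)\<^sup>2" unfolding c_def by (auto simp: real_sqrt_lt_1_iff)
  have contr: "norm (f x - f y) \<le> c * norm (x - y)" for x y
  proof -
    have "norm (f x - f y) \<le> norm ((x - \<tau> *\<^sub>R G x) - (y - \<tau> *\<^sub>R G y))"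
      unfolding f_def using closest_point_lipschitz[OF C(2,1,3)] by (simp add: dist_norm)
    also have "\<dots> \<le> c * norm (x - y)"
    proof (rule power2_le_imp_le)
      have "(norm ((x - \<tau> *\<^sub>R G x) - (y - \<tau> *\<^sub>R G y)))\<^sup>2 = (norm ((x - y) - \<tau> *\<^sub>R (G x - G y)))\<^sup>2"
        by (simp add: algebra_simps)
      also have "\<dots> = (norm (x - y))\<^sup>2 - 2 * \<tau> * ((x - y) \<bullet> (G x - G y)) + \<tau>\<^sup>2 * (norm (G x - G y))\<^sup>2"
        unfolding power2_norm_eq_inner by (simp add: inner_diff_left inner_diff_right inner_commute power2_eq_square algebra_simps)
      also have "\<dots> \<le> (norm (x - y))\<^sup>2 - 2 * \<tau> * (\<mu> * (norm (x - y))\<^sup>2) + \<tau>\<^sup>2 * (k * norm (x - y))\<^sup>2"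
        using \<tau> mono[of x y] Lip'[of x y] by (intro add_mono diff_mono mult_left_mono power_mono) auto
      also have "\<dots> = (1 - 2 * \<tau> * \<mu> + \<tau>\<^sup>2 * k\<^sup>2) * (norm (x - y))\<^sup>2" by (simp add: power_mult_distrib algebra_simps)
      also have "1 - 2 * \<tau> * \<mu> + \<tau>\<^sup>2 * k\<^sup>2 = c\<^sup>2" unfolding c(3) \<tau>_def using k by (simp add: power2_eq_square field_simps)
      finally show "(norm ((x - \<tau> *\<^sub>R G x) - (y - \<tau> *\<^sub>R G y)))\<^sup>2 \<le> (c * norm (x - y))\<^sup>2"
        by (simp add: power_mult_distrib)
    qed (use c in simp)
    finally show ?thesis .
  qed
  have "\<exists>!x\<in>C. f x = x"
  proof (rule Banach_fix)
    show "complete C" using C(1) by (simp add: complete_eq_closed)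
    show "f ` C \<subseteq> C" unfolding f_def using closest_point_in_set[OF C(1,3)] by blast
    show "\<And>x y. x \<in> C \<Longrightarrow> y \<in> C \<Longrightarrow> dist (f x) (f y) \<le> c * dist x y" using contr by (simp add: dist_norm)
  qed (use c C in auto)
  then obtain x where x: "x \<in> C" "f x = x" by blast
  have "0 \<le> G x \<bullet> (y - x)" if "y \<in> C" for y
  proof -
    have "(x - \<tau> *\<^sub>R G x - x) \<bullet> (y - x) \<le> 0"
      using closest_point_dot[OF C(2,1) that, of "x - \<tau> *\<^sub>R G x"] x(2) unfolding f_def by simp
    then have "0 \<le> \<tau> * (G x \<bullet> (y - x))" by simp
    then show ?thesis using \<tau> by (simp add: zero_le_mult_iff)
  qed
  then show ?thesis using x by blast
qed

text \<open>Used to discard the part of a constraint force orthogonal to the affine hull of the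
  constraint set, which does no work along the set and for which no bound is available.\<close>

lemma orthogonal_projection_exists:
  fixes M :: "'a::euclidean_space set"
  assumes "subspace M"
  obtains Q where "linear Q" "\<And>v. Q v \<in> M" "\<And>v d. d \<in> M \<Longrightarrow> Q v \<bullet> d = v \<bullet> d"
proof -
  obtain B where B: "B \<subseteq> M" "pairwise orthogonal B" "\<And>x. x \<in> B \<Longrightarrow> norm x = 1" "independent B" "span B = M"
    using orthonormal_basis_subspace[OF assms] by metis
  have fin: "finite B" using B(4) by (rule independent_imp_finite)
  define Q where "Q v = (\<Sum>b\<in>B. (v \<bullet> b) *\<^sub>R b)" for v
  have "linear Q" unfolding Q_def
    by (intro linear_compose_sum ballI bounded_linear.linear bounded_linear_scaleR_left[THEN bounded_linear_compose]
        bounded_linear_inner_left)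
  moreover have "Q v \<in> M" for v unfolding Q_def B(5)[symmetric] by (intro span_sum span_scale span_base)
  moreover have "Q v \<bullet> d = v \<bullet> d" if "d \<in> M" for v d
  proof -
    have "d \<in> span B" using that B(5) by simp
    then show ?thesis
    proof (induction rule: span_induct_alt)
      case (step c b d)
      have "(\<Sum>b'\<in>B. (v \<bullet> b') * (b' \<bullet> b)) = (\<Sum>b'\<in>B. if b' = b then v \<bullet> b else 0)"
        using B(2,3) step(1) by (intro sum.cong) (auto simp: pairwise_def orthogonal_def norm_eq_1)
      then have "Q v \<bullet> b = v \<bullet> b" unfolding Q_def using step(1) fin by (simp add: inner_sum_left sum.delta')
      then show ?case using step by (simp add: inner_add_right)
    qed simp
  qed
  ultimately show ?thesis using that by blast
qed

lemma transpose_mult_sum: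
  fixes A :: "real^'k^'m"
  shows "transpose A *v l = (\<Sum>i\<in>UNIV. l $ i *\<^sub>R A $ i)"
  by (simp add: vec_eq_iff matrix_vector_mult_def transpose_def mult.commute)

lemma transpose_mult_inner:
  fixes A :: "real^'k^'m"
  shows "(transpose A *v l) \<bullet> x = l \<bullet> (A *v x)"
  by (metis dot_lmul_matrix inner_commute transpose_matrix_vector)

text \<open>The coefficients need not converge, or even stay bounded, along the sequence; closedness
  of a finitely generated cone supplies new coefficients for the limit.\<close>

lemma finite_cone_closed:
  fixes v :: "'i \<Rightarrow> 'a::euclidean_space"
  assumes I: "finite I" and lim: "f \<longlonglongrightarrow> q"
    and f: "\<forall>\<^sub>F n in sequentially. \<exists>c. (\<forall>i\<in>I. c i \<ge> 0) \<and> f n = (\<Sum>i\<in>I. c i *\<^sub>R v i)"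
  shows "\<exists>c. (\<forall>i\<in>I. c i \<ge> (0::real)) \<and> q = (\<Sum>i\<in>I. c i *\<^sub>R v i)"
proof -
  let ?H = "convex_cone hull (v ` I)"
  have H: "convex_cone ?H" by (rule convex_cone_convex_cone_hull)
  have "(\<Sum>i\<in>J. c i *\<^sub>R v i) \<in> ?H" if "finite J" "J \<subseteq> I" "\<forall>i\<in>I. c i \<ge> (0::real)" for c J
    using that
  proof (induction J rule: finite_induct)
    case empty
    then show ?case using convex_cone_contains_0[OF H] by simp
  next
    case (insert j J)
    have "v j \<in> ?H" using insert by (intro hull_inc) auto
    then have "c j *\<^sub>R v j \<in> ?H" using insert H by (intro convex_cone_scaleR) auto
    then show ?case using insert convex_cone_add[OF H] by simp
  qed
  then have "\<forall>\<^sub>F n in sequentially. f n \<in> ?H"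
    by (intro eventually_mono[OF f]) (use I in auto)
  moreover have "closed ?H" using I by (intro closed_convex_cone_hull) auto
  ultimately have q: "q \<in> ?H" using lim by (intro Lim_in_closed_set) auto
  let ?S = "{\<Sum>i\<in>I. c i *\<^sub>R v i |c. \<forall>i\<in>I. c i \<ge> 0}"
  have "?H \<subseteq> ?S"
  proof (rule hull_minimal)
    show "v ` I \<subseteq> ?S"
    proof clarify
      fix j assume "j \<in> I"
      have "v j = (\<Sum>i\<in>I. if i = j then v j else 0)" using \<open>j \<in> I\<close> I by simp
      also have "\<dots> = (\<Sum>i\<in>I. (if i = j then 1 else 0) *\<^sub>R v i)" by (intro sum.cong) auto
      finally show "\<exists>c. v j = (\<Sum>i\<in>I. c i *\<^sub>R v i) \<and> (\<forall>i\<in>I. c i \<ge> 0)"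
        by (intro exI[of _ "\<lambda>i. if i = j then 1 else 0"]) auto
    qed
    show "convex_cone ?S"
      unfolding convex_cone_iff
    proof (intro conjI ballI allI impI)
      show "0 \<in> ?S" by (auto intro!: exI[of _ "\<lambda>_. 0"])
    next
      fix x y assume "x \<in> ?S" "y \<in> ?S"
      then obtain c d where "x = (\<Sum>i\<in>I. c i *\<^sub>R v i)" "y = (\<Sum>i\<in>I. d i *\<^sub>R v i)" "\<forall>i\<in>I. c i \<ge> 0" "\<forall>i\<in>I. d i \<ge> 0" by auto
      then show "x + y \<in> ?S"
        by (intro CollectI exI[of _ "\<lambda>i. c i + d i"]) (auto simp: sum.distrib scaleR_left_distrib)
    next
      fix x and r :: real assume "x \<in> ?S" "r \<ge> 0"
      then obtain c where "x = (\<Sum>i\<in>I. c i *\<^sub>R v i)" "\<forall>i\<in>I. c i \<ge> 0" by auto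
      then show "r *\<^sub>R x \<in> ?S"
        using \<open>r \<ge> 0\<close> by (intro CollectI exI[of _ "\<lambda>i. r * c i"]) (auto simp: scaleR_sum_right)
    qed
  qed
  then show ?thesis using q by blast
qed

lemma vec_inner_le_0:
  fixes u v :: "real^'m" assumes "0 \<le> u" "v \<le> 0" shows "u \<bullet> v \<le> 0"
  using assms unfolding inner_vec_def less_eq_vec_def
  by (auto intro!: sum_nonpos simp: mult_nonneg_nonpos)

text \<open>Penalty method. Testing the penalised variational inequality at points around a relative
  interior feasible point bounds the penalty forces along the affine hull of C; since finitely
  generated cones are closed, their limit is again a combination of active constraint normals.\<close>

proposition multiplier_exists:
  fixes F :: "real^'k \<Rightarrow> real^'k" and A :: "real^'k^'m" and \<beta> :: "real^'m"
  assumes C: "closed C" "convex C" and \<mu>: "\<mu> > 0"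
    and mono: "\<And>x y. (x - y) \<bullet> (F x - F y) \<ge> \<mu> * (norm (x - y))\<^sup>2"
    and Lip: "\<And>x y. norm (F x - F y) \<le> l * norm (x - y)"
    and x0: "x0 \<in> rel_interior C" "A *v x0 \<le> \<beta>"
  shows "\<exists>x \<nu>. x \<in> C \<and> A *v x \<le> \<beta> \<and> 0 \<le> \<nu> \<and> \<nu> \<bullet> (A *v x - \<beta>) = 0 \<and>
    (\<forall>y\<in>C. 0 \<le> (F x + transpose A *v \<nu>) \<bullet> (y - x))"
proof -
  have x0C: "x0 \<in> C" using x0 rel_interior_subset by blast
  then have ne: "C \<noteq> {}" by blast
  \<comment> \<open>Positive part of the constraint violation; \<open>transpose A *v p x\<close> is
    the gradient of half its squared norm.\<close>
  define p :: "real^'k \<Rightarrow> real^'m" where "p x = (\<chi> i. max 0 ((A *v x - \<beta>) $ i))" for x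
  have p0: "0 \<le> p x" for x by (simp add: p_def less_eq_vec_def)
  have pp: "p x \<bullet> (A *v x - \<beta>) = (norm (p x))\<^sup>2" for x
    unfolding power2_norm_eq_inner inner_vec_def by (intro sum.cong) (auto simp: p_def max_def)
  have pmono: "0 \<le> (A *v x - A *v y) \<bullet> (p x - p y)" for x y
    unfolding inner_vec_def
  proof (rule sum_nonneg)
    fix i
    have "0 \<le> (a - b) * (max 0 a - max 0 b)" for a b :: real
      by (cases "a \<le> b") (auto simp: max_def mult_nonpos_nonpos)
    from this[of "(A *v x - \<beta>) $ i" "(A *v y - \<beta>) $ i"]
    show "0 \<le> (A *v x - A *v y) $ i \<bullet> (p x - p y) $ i" by (simp add: p_def)
  qed
  have pLip: "norm (p x - p y) \<le> norm (A *v x - A *v y)" for x y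
  proof (rule norm_le_componentwise_cart)
    fix i
    have "\<bar>max 0 a - max 0 b\<bar> \<le> \<bar>a - b\<bar>" for a b :: real by (auto simp: max_def)
    from this[of "(A *v x - \<beta>) $ i" "(A *v y - \<beta>) $ i"]
    show "norm ((p x - p y) $ i) \<le> norm ((A *v x - A *v y) $ i)" by (simp add: p_def)
  qed
  obtain KA where KA: "KA > 0" "\<And>x. norm (A *v x) \<le> norm x * KA"
    using bounded_linear.pos_bounded[OF matrix_vector_mul_bounded_linear[of A]] by blast
  obtain KT where KT: "KT > 0" "\<And>x. norm (transpose A *v x) \<le> norm x * KT"
    using bounded_linear.pos_bounded[OF matrix_vector_mul_bounded_linear[of "transpose A"]] by blast
  have "\<exists>x\<in>C. \<forall>y\<in>C. 0 \<le> (F x + transpose A *v (real (Suc n) *\<^sub>R p x)) \<bullet> (y - x)" for n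
  proof (rule variational_inequality_solution[OF C ne \<mu>, where l = "l + real (Suc n) * KT * KA"])
    let ?r = "real (Suc n)"
    let ?G = "\<lambda>x. F x + transpose A *v (?r *\<^sub>R p x)"
    fix x y
    have d: "?G x - ?G y = (F x - F y) + transpose A *v (?r *\<^sub>R (p x - p y))"
      by (simp add: matrix_vector_mult_diff_distrib scaleR_diff_right)
    have "0 \<le> ?r * ((p x - p y) \<bullet> (A *v x - A *v y))"
      using pmono[of x y] by (intro mult_nonneg_nonneg) (auto simp: inner_commute)
    then have "0 \<le> (x - y) \<bullet> (transpose A *v (?r *\<^sub>R (p x - p y)))"
      unfolding inner_commute[of "x - y"] transpose_mult_inner by (simp add: matrix_vector_mult_diff_distrib)
    then show "(x - y) \<bullet> (?G x - ?G y) \<ge> \<mu> * (norm (x - y))\<^sup>2"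
      unfolding d inner_add_right using mono[of x y] by linarith
    have "norm (transpose A *v (?r *\<^sub>R (p x - p y))) \<le> ?r * norm (p x - p y) * KT"
      using KT(2)[of "?r *\<^sub>R (p x - p y)"] by simp
    also have "norm (p x - p y) \<le> norm (x - y) * KA"
      using pLip[of x y] KA(2)[of "x - y"] by (simp add: matrix_vector_mult_diff_distrib)
    finally have "norm (transpose A *v (?r *\<^sub>R (p x - p y))) \<le> ?r * (norm (x - y) * KA) * KT"
      using KT(1) by simp
    then show "norm (?G x - ?G y) \<le> (l + ?r * KT * KA) * norm (x - y)"
      unfolding d using Lip[of x y] by (intro order_trans[OF norm_triangle_ineq]) (simp add: algebra_simps)
  qed
  then obtain x where x: "\<And>n. x n \<in> C"
    "\<And>n y. y \<in> C \<Longrightarrow> 0 \<le> (F (x n) + transpose A *v (real (Suc n) *\<^sub>R p (x n))) \<bullet> (y - x n)" by metis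
  define \<Lambda> where "\<Lambda> n = real (Suc n) *\<^sub>R p (x n)" for n
  have \<Lambda>0: "0 \<le> \<Lambda> n" for n using p0[of "x n"] by (simp add: \<Lambda>_def less_eq_vec_def)
  have VI: "0 \<le> (F (x n) + transpose A *v \<Lambda> n) \<bullet> (y - x n)" if "y \<in> C" for n y
    using x(2)[OF that] unfolding \<Lambda>_def .
  have "\<Lambda> n \<bullet> (A *v x0 - \<beta>) \<le> 0" for n using x0(2) by (intro vec_inner_le_0 \<Lambda>0) (simp add: less_eq_vec_def)
  moreover have "\<Lambda> n \<bullet> (A *v x n - \<beta>) = real (Suc n) * (norm (p (x n)))\<^sup>2" for n by (simp add: \<Lambda>_def pp)
  \<comment> \<open>Since \<open>x0\<close> is feasible and the penalty weights are nonnegative,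
    testing at \<open>x0\<close> gives the penalty force a favourable sign, and even leaves the
    weighted violation at \<open>x n\<close>.\<close>
  ultimately have force: "(transpose A *v \<Lambda> n) \<bullet> (x0 - x n) \<le> - (real (Suc n) * (norm (p (x n)))\<^sup>2)" for n
    unfolding transpose_mult_inner matrix_vector_mult_diff_distrib
    by (smt (verit) inner_diff_right)
  then have force0: "(transpose A *v \<Lambda> n) \<bullet> (x0 - x n) \<le> 0" for n
    by (smt (verit) mult_nonneg_nonneg of_nat_0_le_iff zero_le_power2)
  define R where "R = norm (F x0) / \<mu>"
  have R0: "R \<ge> 0" unfolding R_def using \<mu> by simp
  have xR: "norm (x n - x0) \<le> R" for n
  proof -
    have "0 \<le> F (x n) \<bullet> (x0 - x n)" using VI[OF x0C, of n] force0[of n] by (simp add: inner_add_left)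
    then have "\<mu> * (norm (x n - x0))\<^sup>2 \<le> F x0 \<bullet> (x0 - x n)"
      using mono[of "x n" x0] by (simp add: algebra_simps inner_commute)
    also have "\<dots> \<le> norm (F x0) * norm (x n - x0)"
      using norm_cauchy_schwarz[of "F x0" "x0 - x n"] by (simp add: norm_minus_commute)
    finally have "\<mu> * norm (x n - x0) * norm (x n - x0) \<le> norm (F x0) * norm (x n - x0)" by (simp add: power2_eq_square mult.assoc)
    then have "\<mu> * norm (x n - x0) \<le> norm (F x0)" by (cases "x n = x0") auto
    then show ?thesis unfolding R_def using \<mu> by (simp add: field_simps)
  qed
  define D where "D = norm (F x0) + \<bar>l\<bar> * R"
  have FD: "norm (F (x n)) \<le> D" for n
  proof -
    have "norm (F (x n)) \<le> norm (F x0) + norm (F (x n) - F x0)" by norm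
    also have "norm (F (x n) - F x0) \<le> \<bar>l\<bar> * norm (x n - x0)"
      using Lip[of "x n" x0] mult_right_mono[OF abs_ge_self norm_ge_zero] by (rule order_trans)
    also have "\<bar>l\<bar> * norm (x n - x0) \<le> \<bar>l\<bar> * R" by (intro mult_left_mono xR) simp
    finally show ?thesis unfolding D_def by simp
  qed
  have D0: "D \<ge> 0" unfolding D_def using R0 by simp
  have psmall: "(norm (p (x n)))\<^sup>2 \<le> D * R * inverse (real (Suc n))" for n
  proof -
    have "real (Suc n) * (norm (p (x n)))\<^sup>2 \<le> F (x n) \<bullet> (x0 - x n)"
      using VI[OF x0C, of n] force[of n] by (simp add: inner_add_left)
    also have "\<dots> \<le> norm (F (x n)) * norm (x0 - x n)" by (rule norm_cauchy_schwarz)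
    also have "\<dots> \<le> D * R" using FD xR D0 by (intro mult_mono) (auto simp: norm_minus_commute)
    finally show ?thesis by (simp add: field_simps)
  qed
  define M where "M = (\<lambda>y. y - x0) ` (affine hull C)"
  have M: "subspace M" unfolding M_def using affine_diffs_subspace_subtract[OF affine_affine_hull, of x0 C] x0C
    by (simp add: hull_inc)
  have CM: "y - z \<in> M" if "y \<in> C" "z \<in> C" for y z
  proof -
    have "y - x0 \<in> M" "z - x0 \<in> M" unfolding M_def using that by (auto intro: hull_inc)
    then show ?thesis using subspace_diff[OF M] by fastforce
  qed
  obtain \<epsilon> where \<epsilon>: "\<epsilon> > 0" "cball x0 \<epsilon> \<inter> affine hull C \<subseteq> C" using x0(1) by (auto simp: mem_rel_interior_cball)
  have dC: "x0 + d \<in> C" if "d \<in> M" "norm d \<le> \<epsilon>" for d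
  proof -
    have "x0 + d \<in> cball x0 \<epsilon>" using that(2) by (simp add: dist_norm)
    moreover have "x0 + d \<in> affine hull C" using that(1) unfolding M_def by auto
    ultimately show ?thesis using \<epsilon>(2) by blast
  qed
  obtain Q where Q: "linear Q" "\<And>v. Q v \<in> M" "\<And>v d. d \<in> M \<Longrightarrow> Q v \<bullet> d = v \<bullet> d"
    using orthogonal_projection_exists[OF M] by metis
  define q where "q n = Q (transpose A *v \<Lambda> n)" for n
  have qb: "norm (q n) \<le> D * (\<epsilon> + R) / \<epsilon>" for n
  proof (cases "q n = 0")
    case True
    then show ?thesis using D0 R0 \<epsilon> by simp
  next
    case False
    \<comment> \<open>The test point moves from \<open>x0\<close> against the projected force by the
      full radius \<epsilon>, so that the variational inequality bounds \<epsilon> times the norm of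
      that force.\<close>
    define d where "d = - (\<epsilon> / norm (q n)) *\<^sub>R q n"
    have d: "d \<in> M" "norm d = \<epsilon>" unfolding d_def q_def using Q(2) M False \<epsilon>
      by (auto intro: subspace_scale subspace_neg simp: q_def)
    have "0 \<le> (F (x n) + transpose A *v \<Lambda> n) \<bullet> (x0 + d - x n)" using d by (intro VI dC) auto
    also have "\<dots> = F (x n) \<bullet> (x0 + d - x n) + (transpose A *v \<Lambda> n) \<bullet> (x0 - x n) + (transpose A *v \<Lambda> n) \<bullet> d"
      by (simp add: algebra_simps)
    also have "(transpose A *v \<Lambda> n) \<bullet> d = q n \<bullet> d" unfolding q_def by (rule Q(3)[OF d(1), symmetric])
    also have "q n \<bullet> d = - \<epsilon> * norm (q n)" unfolding d_def using False by (simp add: dot_square_norm power2_eq_square)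
    finally have "\<epsilon> * norm (q n) \<le> F (x n) \<bullet> (x0 + d - x n)" using force0[of n] by linarith
    also have "\<dots> \<le> norm (F (x n)) * norm (x0 + d - x n)" by (rule norm_cauchy_schwarz)
    also have "\<dots> \<le> D * (\<epsilon> + R)"
    proof (intro mult_mono FD)
      have "norm (x0 + d - x n) \<le> norm d + norm (x n - x0)" by norm
      then show "norm (x0 + d - x n) \<le> \<epsilon> + R" using d(2) xR[of n] by linarith
    qed (use D0 in auto)
    finally show ?thesis using \<epsilon> by (simp add: field_simps)
  qed
  have "bounded (range (\<lambda>n. (x n, q n)))"
  proof (rule boundedI, clarify)
    fix n
    have "norm (x n) \<le> norm x0 + norm (x n - x0)" by norm
    then show "norm (x n, q n) \<le> (norm x0 + R) + D * (\<epsilon> + R) / \<epsilon>"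
      using xR[of n] qb[of n] by (intro order_trans[OF norm_Pair_le]) linarith
  qed
  then obtain z r where r: "strict_mono (r :: nat \<Rightarrow> nat)" and z: "((\<lambda>n. (x n, q n)) \<circ> r) \<longlonglongrightarrow> z"
    using bounded_imp_convergent_subsequence by blast
  define xs where "xs = fst z"
  define qs where "qs = snd z"
  have xl: "(\<lambda>n. x (r n)) \<longlonglongrightarrow> xs" using tendsto_fst[OF z] by (simp add: o_def xs_def)
  have ql: "(\<lambda>n. q (r n)) \<longlonglongrightarrow> qs" using tendsto_snd[OF z] by (simp add: o_def qs_def)
  have xsC: "xs \<in> C" using C(1) _ xl by (rule closed_sequentially) (rule x)
  have Al: "(\<lambda>n. (A *v x (r n) - \<beta>) $ i) \<longlonglongrightarrow> (A *v xs - \<beta>) $ i" for i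
    by (intro tendsto_intros bounded_linear.tendsto[OF matrix_vector_mul_bounded_linear] xl)
  have feas: "(A *v xs - \<beta>) $ i \<le> 0" for i
  proof -
    have "(\<lambda>n. D * R * inverse (real (Suc n))) \<longlonglongrightarrow> D * R * 0"
      by (intro tendsto_intros LIMSEQ_inverse_real_of_nat)
    then have "(\<lambda>n. D * R * inverse (real (Suc n))) \<longlonglongrightarrow> 0" by simp
    moreover have "\<forall>\<^sub>F n in sequentially. norm ((norm (p (x n)))\<^sup>2) \<le> D * R * inverse (real (Suc n))"
      unfolding real_norm_def abs_power2 by (intro always_eventually allI psmall)
    ultimately have "(\<lambda>n. (norm (p (x n)))\<^sup>2) \<longlonglongrightarrow> 0" by (rule Lim_null_comparison[rotated])
    then have "(\<lambda>n. sqrt ((norm (p (x n)))\<^sup>2)) \<longlonglongrightarrow> sqrt 0" by (rule tendsto_real_sqrt)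
    then have "(\<lambda>n. p (x n)) \<longlonglongrightarrow> 0" by (simp add: tendsto_norm_zero_iff)
    then have "(\<lambda>n. p (x (r n))) \<longlonglongrightarrow> 0" using r by (rule LIMSEQ_subseq_LIMSEQ[unfolded o_def])
    then have "(\<lambda>n. p (x (r n)) $ i) \<longlonglongrightarrow> 0 $ i" by (rule tendsto_vec_nth)
    moreover have "(A *v x (r n) - \<beta>) $ i \<le> p (x (r n)) $ i" for n by (simp add: p_def)
    ultimately show ?thesis using tendsto_le[OF trivial_limit_sequentially _ Al] by fastforce
  qed
  define I where "I = {i. (A *v xs - \<beta>) $ i = 0}"
  \<comment> \<open>Constraints inactive at the limit are eventually strict, so their penalty
    weights vanish and only active normals contribute.\<close>
  have "\<forall>\<^sub>F n in sequentially. \<forall>i\<in>- I. (A *v x (r n) - \<beta>) $ i < 0"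
  proof (subst eventually_ball_finite_distrib, simp, intro ballI)
    fix i assume "i \<in> - I"
    then have "(A *v xs - \<beta>) $ i < 0" using feas[of i] unfolding I_def by auto
    then show "\<forall>\<^sub>F n in sequentially. (A *v x (r n) - \<beta>) $ i < 0" by (rule order_tendstoD(2)[OF Al])
  qed
  then have "\<forall>\<^sub>F n in sequentially. \<exists>c. (\<forall>i\<in>I. c i \<ge> 0) \<and> q (r n) = (\<Sum>i\<in>I. c i *\<^sub>R Q (A $ i))"
  proof eventually_elim
    case (elim n)
    have "\<Lambda> (r n) $ i = 0" if "i \<in> - I" for i
      using bspec[OF elim that] by (simp add: \<Lambda>_def p_def max_def)
    then have "(\<Sum>i\<in>UNIV. \<Lambda> (r n) $ i *\<^sub>R Q (A $ i)) = (\<Sum>i\<in>I. \<Lambda> (r n) $ i *\<^sub>R Q (A $ i))"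
      by (intro sum.mono_neutral_right) auto
    moreover have "q (r n) = (\<Sum>i\<in>UNIV. \<Lambda> (r n) $ i *\<^sub>R Q (A $ i))"
      unfolding q_def transpose_mult_sum by (simp add: linear_sum[OF Q(1)] linear_scale[OF Q(1)])
    ultimately show ?case using \<Lambda>0[of "r n"] by (intro exI[of _ "\<lambda>i. \<Lambda> (r n) $ i"]) (auto simp: less_eq_vec_def)
  qed
  then obtain c where c: "\<And>i. i \<in> I \<Longrightarrow> c i \<ge> 0" "qs = (\<Sum>i\<in>I. c i *\<^sub>R Q (A $ i))"
    using finite_cone_closed[OF _ ql, of I "\<lambda>i. Q (A $ i)"] by auto
  define \<nu> :: "real^'m" where "\<nu> = (\<chi> i. if i \<in> I then c i else 0)"
  have "Q (transpose A *v \<nu>) = (\<Sum>i\<in>UNIV. \<nu> $ i *\<^sub>R Q (A $ i))"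
    unfolding transpose_mult_sum by (simp add: linear_sum[OF Q(1)] linear_scale[OF Q(1)])
  also have "\<dots> = (\<Sum>i\<in>I. c i *\<^sub>R Q (A $ i))"
    unfolding \<nu>_def by (intro sum.mono_neutral_cong_right) auto
  finally have Q\<nu>: "Q (transpose A *v \<nu>) = qs" using c(2) by simp
  have "0 \<le> (F xs + transpose A *v \<nu>) \<bullet> (y - xs)" if y: "y \<in> C" for y
  proof -
    have Fl: "(\<lambda>n. F (x (r n))) \<longlonglongrightarrow> F xs"
    proof -
      have "(\<lambda>n. l * norm (x (r n) - xs)) \<longlonglongrightarrow> l * norm (xs - xs)" by (intro tendsto_intros xl)
      then have "(\<lambda>n. l * norm (x (r n) - xs)) \<longlonglongrightarrow> 0" by simp
      then have "(\<lambda>n. F (x (r n)) - F xs) \<longlonglongrightarrow> 0"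
        by (rule Lim_null_comparison[rotated]) (simp add: Lip)
      then show ?thesis by (simp add: LIM_zero_iff)
    qed
    \<comment> \<open>Differences of points of \<open>C\<close> lie in \<open>M\<close>, where a
      force and its projection act alike.\<close>
    have "(F (x n) + q n) \<bullet> (y - x n) = (F (x n) + transpose A *v \<Lambda> n) \<bullet> (y - x n)" for n
      using Q(3)[OF CM[OF y x(1)], of "transpose A *v \<Lambda> n" n] by (simp add: q_def inner_add_left)
    then have "0 \<le> (F (x n) + q n) \<bullet> (y - x n)" for n using VI[OF y] by simp
    moreover have "(\<lambda>n. (F (x (r n)) + q (r n)) \<bullet> (y - x (r n))) \<longlonglongrightarrow> (F xs + qs) \<bullet> (y - xs)"
      by (intro tendsto_intros Fl xl ql)
    ultimately have "0 \<le> (F xs + qs) \<bullet> (y - xs)" by (intro LIMSEQ_le_const) auto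
    also have "qs \<bullet> (y - xs) = (transpose A *v \<nu>) \<bullet> (y - xs)"
      unfolding Q\<nu>[symmetric] by (rule Q(3)[OF CM[OF y xsC]])
    then have "(F xs + qs) \<bullet> (y - xs) = (F xs + transpose A *v \<nu>) \<bullet> (y - xs)" by (simp add: inner_add_left)
    finally show ?thesis .
  qed
  moreover have "0 \<le> \<nu>" using c(1) by (auto simp: \<nu>_def less_eq_vec_def)
  moreover have "\<nu> \<bullet> (A *v xs - \<beta>) = 0" unfolding inner_vec_def by (rule sum.neutral) (auto simp: \<nu>_def I_def)
  moreover have "A *v xs \<le> \<beta>" using feas by (simp add: less_eq_vec_def)
  ultimately show ?thesis using xsC by blast
qed

section \<open>Stacked vectors\<close>

declare transpose_matrix_vector [simp del]

text \<open>A stacked vector is read as one vector over the agents for each coordinate. A Kronecker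
  product with the identity acts on these columns separately, which reduces stacked statements to
  facts about the Laplacian.\<close>

definition column_of :: "real^('N::finite \<times> 'c::finite) \<Rightarrow> 'c \<Rightarrow> real^'N"
  where "column_of X k = (\<chi> i. X $ (i, k))"

lemma column_of_nth [simp]: "column_of X k $ i = X $ (i, k)"
  by (simp add: column_of_def)

lemma sum_UNIV_prod: "(\<Sum>p\<in>UNIV. f p) = (\<Sum>i\<in>UNIV. \<Sum>k\<in>UNIV. f (i, k))"
  by (simp add: sum.cartesian_product flip: UNIV_Times_UNIV)

lemma inner_columns: "X \<bullet> Y = (\<Sum>k\<in>UNIV. column_of X k \<bullet> column_of Y k)"
  unfolding inner_vec_def sum_UNIV_prod by (subst sum.swap) simp

lemma norm_sq_columns: "(norm X)\<^sup>2 = (\<Sum>k\<in>UNIV. (norm (column_of X k))\<^sup>2)"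
  by (simp add: power2_norm_eq_inner inner_columns)

lemma column_of_kron_mat:
  "column_of (kron_mat M (mat 1) *v X) k = M *v column_of X k"
proof -
  have "(\<Sum>j\<in>UNIV. \<Sum>l\<in>UNIV. M $ i $ j * mat 1 $ k $ l * X $ (j, l)) = (\<Sum>j\<in>UNIV. M $ i $ j * X $ (j, k))" for i
  proof (rule sum.cong[OF refl])
    fix j
    have "(\<Sum>l\<in>UNIV. M $ i $ j * mat 1 $ k $ l * X $ (j, l)) = (\<Sum>l\<in>UNIV. if k = l then M $ i $ j * X $ (j, l) else 0)"
      by (intro sum.cong) (auto simp: mat_def)
    then show "(\<Sum>l\<in>UNIV. M $ i $ j * mat 1 $ k $ l * X $ (j, l)) = M $ i $ j * X $ (j, k)" by simp
  qed
  then show ?thesis by (simp add: vec_eq_iff matrix_vector_mult_def kron_mat_def sum_UNIV_prod)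
qed

lemma column_of_kron_vec: "column_of (kron_vec 1 x) k = x $ k *\<^sub>R 1"
  by (simp add: vec_eq_iff kron_vec_def)

lemma column_of_0: "column_of 0 k = 0"
  by (simp add: vec_eq_iff)

lemma column_of_diff: "column_of (X - Y) k = column_of X k - column_of Y k"
  by (simp add: vec_eq_iff)

lemma stack_eqI: "(\<And>k. column_of X k = column_of Y k) \<Longrightarrow> X = Y"
  unfolding vec_eq_iff by (metis column_of_nth surj_pair)

lemma inner_kron_vec: "V \<bullet> kron_vec 1 u = (\<Sum>k\<in>UNIV. (1 \<bullet> column_of V k) * u $ k)"
  unfolding inner_columns column_of_kron_vec by (simp add: inner_commute mult.commute)

lemma kron_vec_diff: "kron_vec (1 :: real^'N) x - kron_vec 1 y = kron_vec 1 (x - y)"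
  by (simp add: vec_eq_iff kron_vec_def)

lemma estimate_kron_vec: "estimate (kron_vec 1 x) i = x"
  by (simp add: vec_eq_iff estimate_def kron_vec_def)

lemma ext_pseudo_grad_kron_vec: "ext_pseudo_grad own J (kron_vec 1 x) = pseudo_grad own J x"
  by (simp add: ext_pseudo_grad_def pseudo_grad_def estimate_kron_vec)

lemma sel_mat_mult: "(sel_mat own *v X) $ k = X $ (own k, k)"
  by (simp add: matrix_vector_mult_def sel_mat_def if_distrib[of "\<lambda>a. a * _"] cong: if_cong)

lemma transpose_sel_mat_mult: "(transpose (sel_mat own) *v x) $ (i, k) = (if own k = i then x $ k else 0)"
proof -
  have "(transpose (sel_mat own) *v x) $ (i, k) = (\<Sum>l\<in>UNIV. if l = k then (if own k = i then x $ k else 0) else 0)"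
    unfolding matrix_vector_mult_def transpose_def sel_mat_def vec_lambda_beta by (intro sum.cong) auto
  then show ?thesis by simp
qed

lemma rem_mat_mult: "(rem_mat own *v X) $ (i, k) = (if own k = i then 0 else X $ (i, k))"
proof -
  have "(rem_mat own *v X) $ (i, k) = (\<Sum>q\<in>UNIV. if q = (i, k) then (if own k = i then 0 else X $ (i, k)) else 0)"
    unfolding matrix_vector_mult_def rem_mat_def vec_lambda_beta by (intro sum.cong) auto
  then show ?thesis by simp
qed

lemma transpose_rem_mat: "transpose (rem_mat own) = rem_mat own"
  by (auto simp: vec_eq_iff transpose_def rem_mat_def)

lemma sel_mat_kron_vec: "sel_mat own *v kron_vec 1 x = x"
  by (simp add: vec_eq_iff sel_mat_mult kron_vec_def)

lemma sel_mat_transpose: "sel_mat own *v (transpose (sel_mat own) *v x) = x"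
  by (simp add: vec_eq_iff sel_mat_mult transpose_sel_mat_mult)

lemma sel_mat_rem_mat: "sel_mat own *v (rem_mat own *v X) = 0"
  by (simp add: vec_eq_iff sel_mat_mult rem_mat_mult)

lemma sel_rem_decomposition:
  "transpose (sel_mat own) *v (sel_mat own *v X) + rem_mat own *v (rem_mat own *v X) = X"
  by (auto simp: vec_eq_iff sel_mat_mult transpose_sel_mat_mult rem_mat_mult)

lemma norm_transpose_sel_mat: "norm (transpose (sel_mat own) *v x) = norm x"
  by (simp add: norm_eq_sqrt_inner transpose_mult_inner sel_mat_transpose)

lemma norm_sel_mat_le: "norm (sel_mat own *v X) \<le> norm X"
proof -
  let ?x = "sel_mat own *v X"
  have "norm ?x * norm ?x = (transpose (sel_mat own) *v ?x) \<bullet> X"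
    by (simp add: transpose_mult_inner dot_square_norm power2_eq_square)
  also have "\<dots> \<le> norm ?x * norm X"
    using norm_cauchy_schwarz[of "transpose (sel_mat own) *v ?x" X] by (simp add: norm_transpose_sel_mat)
  finally show ?thesis by (cases "?x = 0") auto
qed

lemma transpose_diag_blocks_kron_vec: "transpose (diag_blocks own A) *v kron_vec 1 l = transpose A *v l"
proof -
  have "(\<Sum>j\<in>UNIV. \<Sum>i\<in>UNIV. (if own k = i then A $ j $ k else 0) * l $ j) = (\<Sum>j\<in>UNIV. A $ j $ k * l $ j)" for k
    by (simp add: if_distrib[of "\<lambda>a. a * _"] cong: if_cong)
  then have "(\<Sum>i\<in>UNIV. \<Sum>j\<in>UNIV. (if own k = i then A $ j $ k else 0) * l $ j) = (\<Sum>j\<in>UNIV. A $ j $ k * l $ j)" for k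
    by (subst sum.swap)
  then show ?thesis
    by (simp add: vec_eq_iff matrix_vector_mult_def transpose_def diag_blocks_def kron_vec_def sum_UNIV_prod
        cong: if_cong)
qed

text \<open>Summation over the agents recovers the coupled constraint from the local blocks, since
  each coordinate has exactly one owner.\<close>

lemma one_inner_column_diag_blocks: "1 \<bullet> column_of (diag_blocks own A *v x) j = (A *v x) $ j"
proof -
  have "(\<Sum>k\<in>UNIV. \<Sum>i\<in>UNIV. (if own k = i then A $ j $ k else 0) * x $ k) = (\<Sum>k\<in>UNIV. A $ j $ k * x $ k)"
    by (simp add: if_distrib[of "\<lambda>a. a * _"] cong: if_cong)
  then have "(\<Sum>i\<in>UNIV. \<Sum>k\<in>UNIV. (if own k = i then A $ j $ k else 0) * x $ k) = (\<Sum>k\<in>UNIV. A $ j $ k * x $ k)"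
    by (subst sum.swap)
  then show ?thesis by (simp add: inner_1_sum matrix_vector_mult_def diag_blocks_def cong: if_cong)
qed

lemma one_inner_column_stack_vec: "1 \<bullet> column_of (stack_vec b) j = (\<Sum>i\<in>UNIV. b i) $ j"
  by (simp add: inner_1_sum stack_vec_def)

lemma closed_stack_set: "(\<And>i. closed (\<Omega>s i)) \<Longrightarrow> closed (stack_set own \<Omega>s)"
  and convex_stack_set: "(\<And>i. convex (\<Omega>s i)) \<Longrightarrow> convex (stack_set own \<Omega>s)"
proof -
  have lin: "linear (block own i)" for i
    by (intro linearI) (auto simp: block_def vec_eq_iff)
  have eq: "stack_set own \<Omega>s = (\<Inter>i. block own i -` \<Omega>s i)" by (auto simp: stack_set_def)
  show "closed (stack_set own \<Omega>s)" if "\<And>i. closed (\<Omega>s i)"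
    unfolding eq using that lin by (intro closed_INT ballI continuous_closed_vimage linear_continuous_at) (auto simp: linear_conv_bounded_linear)
  show "convex (stack_set own \<Omega>s)" if "\<And>i. convex (\<Omega>s i)"
    unfolding eq using that lin by (intro convex_INT convex_linear_vimage) auto
qed

lemma closed_nonneg_orthant: "closed nonneg_orthant"
  and convex_nonneg_orthant: "convex nonneg_orthant"
proof -
  have eq: "(nonneg_orthant :: (real^'q) set) = (\<Inter>i. {v. 0 \<le> v $ i})"
    by (auto simp: nonneg_orthant_def less_eq_vec_def)
  show "closed (nonneg_orthant :: (real^'q) set)"
    unfolding eq by (intro closed_INT ballI closed_Collect_le continuous_intros)
  have "{v. 0 \<le> v $ i} = {v :: real^'q. axis i 1 \<bullet> v \<ge> 0}" for i by (simp add: inner_axis')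
  then have "convex {v :: real^'q. 0 \<le> v $ i}" for i using convex_halfspace_ge[of 0 "axis i 1"] by metis
  then show "convex (nonneg_orthant :: (real^'q) set)" unfolding eq by (intro convex_INT) auto
qed

lemma closed_state_set: "closed (stack_set own \<Omega>s) \<Longrightarrow> closed (state_set own \<Omega>s)"
  and convex_state_set: "convex (stack_set own \<Omega>s) \<Longrightarrow> convex (state_set own \<Omega>s)"
proof -
  have eq: "{X. sel_mat own *v X \<in> stack_set own \<Omega>s} = (\<lambda>X. sel_mat own *v X) -` stack_set own \<Omega>s" by auto
  show "closed (state_set own \<Omega>s)" if "closed (stack_set own \<Omega>s)"
    unfolding state_set_def eq using that
    by (intro closed_Times closed_nonneg_orthant closed_UNIV continuous_closed_vimage linear_continuous_at
        matrix_vector_mul_bounded_linear)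
  show "convex (state_set own \<Omega>s)" if "convex (stack_set own \<Omega>s)"
    unfolding state_set_def eq using that
    by (intro convex_Times convex_nonneg_orthant convex_UNIV convex_linear_vimage matrix_vector_mul_linear)
qed

context weighted_graph begin

abbreviation Lap :: "real^('N \<times> 'c::finite) \<Rightarrow> real^('N \<times> 'c)" where
  "Lap X \<equiv> kron_mat L (mat 1 :: real^'c^'c) *v X"

lemma Lap_inner: "Lap X \<bullet> Y = X \<bullet> Lap Y"
  unfolding inner_columns column_of_kron_mat by (simp add: laplacian_symmetric_inner[OF sym])

lemma Lap_kron_vec: "Lap (kron_vec 1 x) = 0"
  by (rule stack_eqI) (simp add: column_of_kron_mat column_of_kron_vec matrix_vector_mult_scaleR laplacian_mult_1 column_of_0)

lemma Lap_nonneg: "0 \<le> X \<bullet> Lap X"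
  unfolding inner_columns column_of_kron_mat by (intro sum_nonneg L_nonneg)

lemma Lap_kernel:
  assumes "X \<bullet> Lap X = 0" obtains x where "X = kron_vec 1 x"
proof -
  have "column_of X k \<bullet> (L *v column_of X k) = 0" for k
    using assms unfolding inner_columns column_of_kron_mat by (subst (asm) sum_nonneg_eq_0_iff) (auto simp: L_nonneg)
  then have "\<exists>c. column_of X k = c *\<^sub>R 1" for k using L_kernel by metis
  then obtain c where "\<And>k. column_of X k = c k *\<^sub>R 1" by metis
  then have "X = kron_vec 1 (\<chi> k. c k)" by (intro stack_eqI) (simp add: column_of_kron_vec)
  then show ?thesis by (rule that)
qed

lemma one_inner_column_Lap: "1 \<bullet> column_of (Lap X) k = 0"
  by (simp add: column_of_kron_mat laplacian_1_inner[OF sym])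

lemma Lap_range:
  fixes V :: "real^('N \<times> 'c::finite)"
  assumes "\<And>k. 1 \<bullet> column_of V k = 0" shows "\<exists>U. Lap U = V"
proof -
  obtain u where u: "\<And>k. L *v u k = column_of V k" using L_range[OF assms] by metis
  define U :: "real^('N \<times> 'c)" where "U = (\<chi> p. u (snd p) $ fst p)"
  have "column_of U k = u k" for k by (simp add: U_def vec_eq_iff)
  then have "Lap U = V" by (intro stack_eqI) (simp add: column_of_kron_mat u)
  then show ?thesis ..
qed

definition average :: "real^('N \<times> 'c::finite) \<Rightarrow> real^'c" where
  "average X = (\<chi> k. (1 \<bullet> column_of X k) / real CARD('N))"

text \<open>Complement of the consensus part: its columns are orthogonal to 1, where the spectral
  gap acts.\<close>

definition disagreement :: "real^('N \<times> 'c::finite) \<Rightarrow> real^('N \<times> 'c)" where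
  "disagreement X = X - kron_vec 1 (average X)"

lemma one_inner_column_disagreement: "1 \<bullet> column_of (disagreement X) k = 0"
proof -
  have "(1 :: real^'N) \<bullet> 1 = real CARD('N)" by (simp add: inner_1_sum)
  then show ?thesis
    unfolding disagreement_def column_of_diff column_of_kron_vec by (simp add: inner_diff_right average_def)
qed

lemma Lap_spectral_gap:
  assumes "CARD('N) \<ge> 2"
  shows "second_eigenvalue L * (norm (disagreement X))\<^sup>2 \<le> X \<bullet> Lap X"
proof -
  have "second_eigenvalue L * (norm (disagreement X))\<^sup>2 \<le> disagreement X \<bullet> Lap (disagreement X)"
    unfolding norm_sq_columns inner_columns column_of_kron_mat sum_distrib_left
    by (intro sum_mono second_eigenvalue_laplacian(2)[OF assms] one_inner_column_disagreement)
  also have "\<dots> = disagreement X \<bullet> Lap X"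
    by (simp add: disagreement_def matrix_vector_mult_diff_distrib Lap_kron_vec)
  also have "\<dots> = X \<bullet> Lap X"
    unfolding disagreement_def inner_diff_left Lap_inner[symmetric, of "kron_vec 1 (average X)"] by (simp add: Lap_kron_vec)
  finally show ?thesis .
qed

lemma bounded_linear_average: "bounded_linear (average :: real^('N \<times> 'c::finite) \<Rightarrow> _)"
proof -
  have "linear (average :: real^('N \<times> 'c) \<Rightarrow> _)"
    by (intro linearI) (auto simp: average_def vec_eq_iff inner_1_sum sum.distrib add_divide_distrib
        sum_distrib_left[symmetric])
  then show ?thesis by (simp add: linear_conv_bounded_linear)
qed

lemma bounded_linear_disagreement: "bounded_linear (disagreement :: real^('N \<times> 'c::finite) \<Rightarrow> _)"
proof -
  have "linear (kron_vec (1 :: real^'N) :: real^'c \<Rightarrow> _)"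
    by (intro linearI) (auto simp: kron_vec_def vec_eq_iff)
  then have "bounded_linear (kron_vec (1 :: real^'N) :: real^'c \<Rightarrow> _)" by (simp add: linear_conv_bounded_linear)
  then show ?thesis unfolding disagreement_def[abs_def]
    by (intro bounded_linear_sub bounded_linear_ident bounded_linear_compose[OF _ bounded_linear_average])
qed

end

section \<open>Dissipativity of the game dynamics\<close>

text \<open>Shifting \<open>l\<close> along an axis gives the sign; the test points
  \<open>2 *\<^sub>R l\<close> and 0 give complementarity.\<close>

lemma normal_cone_nonneg_orthant:
  assumes "n \<in> normal_cone nonneg_orthant l"
  shows "n \<le> 0" and "n \<bullet> l = 0"
proof -
  have l: "0 \<le> l" and n: "\<And>y. 0 \<le> y \<Longrightarrow> n \<bullet> (y - l) \<le> 0"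
    using assms by (auto simp: normal_cone_def nonneg_orthant_def split: if_splits)
  have "n $ i \<le> 0" for i
  proof -
    have "0 \<le> l + axis i 1" using l by (auto simp: less_eq_vec_def axis_def)
    from n[OF this] show ?thesis by (simp add: inner_axis)
  qed
  then show "n \<le> 0" by (simp add: less_eq_vec_def)
  have "0 \<le> 2 *\<^sub>R l" using l by (simp add: less_eq_vec_def)
  from n[OF this] n[of 0] show "n \<bullet> l = 0" by (simp add: inner_diff_right)
qed

text \<open>For feasible \<open>y\<close> the multiplier term
  \<open>l \<bullet> (A *v (y - x))\<close> is nonpositive by complementarity, so the variational
  inequality with multiplier implies the one for the pseudo-gradient alone.\<close>

lemma KKT_imp_v_GNE:
  assumes "KKT own J \<Omega>s A b x l" shows "v_GNE own J \<Omega>s A b x"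
proof -
  let ?F = "pseudo_grad own J x" and ?\<beta> = "\<Sum>i\<in>UNIV. b i"
  have 1: "- (?F + transpose A *v l) \<in> normal_cone (stack_set own \<Omega>s) x"
    and 2: "A *v x - ?\<beta> \<in> normal_cone nonneg_orthant l"
  proof -
    obtain v where "v \<in> normal_cone (stack_set own \<Omega>s) x" "?F + transpose A *v l + v = 0"
      using assms unfolding KKT_def by auto
    then show "- (?F + transpose A *v l) \<in> normal_cone (stack_set own \<Omega>s) x"
      by (metis minus_unique)
    obtain v where "v \<in> normal_cone nonneg_orthant l" "- (A *v x - ?\<beta>) + v = 0"
      using assms unfolding KKT_def by auto
    then show "A *v x - ?\<beta> \<in> normal_cone nonneg_orthant l" by (metis add.inverse_inverse minus_unique)
  qed
  have l: "0 \<le> l" using 2 by (auto simp: normal_cone_def nonneg_orthant_def split: if_splits)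
  have x: "x \<in> stack_set own \<Omega>s" using 1 by (auto simp: normal_cone_def split: if_splits)
  have "0 \<le> ?F \<bullet> (y - x)" if y: "y \<in> feasible_set own \<Omega>s A b" for y
  proof -
    have "- (?F + transpose A *v l) \<bullet> (y - x) \<le> 0" using 1 y x by (auto simp: normal_cone_def feasible_set_def)
    then have "0 \<le> ?F \<bullet> (y - x) + l \<bullet> (A *v (y - x))"
      by (simp only: inner_minus_left inner_add_left transpose_mult_inner)
    also have "l \<bullet> (A *v (y - x)) = l \<bullet> (A *v y - ?\<beta>) - (A *v x - ?\<beta>) \<bullet> l"
      by (simp add: matrix_vector_mult_diff_distrib algebra_simps inner_commute)
    also have "\<dots> \<le> 0"
      using normal_cone_nonneg_orthant(2)[OF 2] y l vec_inner_le_0[OF l, of "A *v y - ?\<beta>"]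
      by (auto simp: feasible_set_def less_eq_vec_def)
    finally show ?thesis by simp
  qed
  moreover have "A *v x \<le> ?\<beta>" using normal_cone_nonneg_orthant(1)[OF 2] by (simp add: less_eq_vec_def)
  ultimately show ?thesis using x unfolding v_GNE_def feasible_set_def by blast
qed

text \<open>\<open>\<alpha>\<close> is determinant over trace of the symmetric 2 by 2 matrix of the
  form, a lower bound for its smaller eigenvalue that avoids square roots.\<close>

lemma positive_quadratic_form:
  fixes a p s t \<mu> :: real
  assumes "\<mu> > 0" "s\<^sup>2 < 4 * \<mu> * t"
  defines "\<alpha> \<equiv> (4 * \<mu> * t - s\<^sup>2) / (4 * (\<mu> + t))"
  shows "\<alpha> > 0" and "\<alpha> * (a\<^sup>2 + p\<^sup>2) \<le> \<mu> * a\<^sup>2 - s * a * p + t * p\<^sup>2"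
proof -
  have "0 \<le> s\<^sup>2" by simp
  then have "0 < 4 * \<mu> * t" using assms(2) by linarith
  then have t: "t > 0" using assms(1) by (simp add: zero_less_mult_iff)
  show "\<alpha> > 0" unfolding \<alpha>_def using assms t by simp
  define d where "d = 4 * (\<mu> + t)"
  have "d \<noteq> 0" unfolding d_def using assms t by simp
  then have "\<alpha> * d = 4 * \<mu> * t - s\<^sup>2" unfolding \<alpha>_def d_def[symmetric] by simp
  then have \<alpha>: "4 * \<alpha> * (\<mu> + t) = 4 * \<mu> * t - s\<^sup>2" by (simp add: d_def mult.assoc mult.left_commute)
  have "\<alpha> * (\<mu> + t) \<le> \<mu> * t" using \<alpha> \<open>0 \<le> s\<^sup>2\<close> by linarith
  also have "\<dots> < \<mu> * (\<mu> + t)" using assms t by (intro mult_strict_left_mono) auto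
  finally have "\<alpha> < \<mu>" by (rule mult_right_less_imp_less) (use t assms(1) in simp)
  then have m: "\<mu> - \<alpha> > 0" by simp
  \<comment> \<open>The characteristic polynomial at \<open>\<alpha>\<close> equals
    \<open>\<alpha>\<^sup>2\<close>, because trace times \<open>\<alpha>\<close> is the determinant;
    completing the square then shows that the shifted form is nonnegative.\<close>
  have "(\<mu> - \<alpha>) * (t - \<alpha>) - s\<^sup>2 / 4 = \<alpha>\<^sup>2" using \<alpha> by (simp add: algebra_simps power2_eq_square)
  then have "(\<mu> - \<alpha>) * ((\<mu> - \<alpha>) * a\<^sup>2 - s * a * p + (t - \<alpha>) * p\<^sup>2) = ((\<mu> - \<alpha>) * a - s * p / 2)\<^sup>2 + \<alpha>\<^sup>2 * p\<^sup>2"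
    by (simp add: power2_eq_square algebra_simps flip: \<open>_ = \<alpha>\<^sup>2\<close>)
  then have "0 \<le> (\<mu> - \<alpha>) * ((\<mu> - \<alpha>) * a\<^sup>2 - s * a * p + (t - \<alpha>) * p\<^sup>2)" by simp
  then have "0 \<le> (\<mu> - \<alpha>) * a\<^sup>2 - s * a * p + (t - \<alpha>) * p\<^sup>2" using m by (simp add: zero_le_mult_iff)
  then show "\<alpha> * (a\<^sup>2 + p\<^sup>2) \<le> \<mu> * a\<^sup>2 - s * a * p + t * p\<^sup>2" by (simp add: algebra_simps)
qed

lemma kron_vec_nonneg_iff: "0 \<le> kron_vec (1 :: real^'N) l \<longleftrightarrow> 0 \<le> l"
  by (simp add: less_eq_vec_def kron_vec_def)

locale primal_dual_game = weighted_graph W E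
  for W :: "real^'N^'N" and E :: "('N \<times> 'N) set" +
  fixes own :: "'k::finite \<Rightarrow> 'N" and J :: "'N \<Rightarrow> real^'k \<Rightarrow> real" and \<Omega>s :: "'N \<Rightarrow> (real^'k) set"
    and A :: "real^'k^'m::finite" and b :: "'N \<Rightarrow> real^'m" and \<mu> \<theta>\<^sub>0 \<theta> c :: real
  assumes agents: "CARD('N) \<ge> 2"
    and local_sets: "\<And>i. closed (\<Omega>s i)" "\<And>i. convex (\<Omega>s i)"
    and slater: "slater own \<Omega>s A b"
    and \<mu>: "0 < \<mu>"
    and monotone: "\<And>x y. (x - y) \<bullet> (pseudo_grad own J x - pseudo_grad own J y) \<ge> \<mu> * (norm (x - y))\<^sup>2"
    and lipschitz: "\<And>x y. norm (pseudo_grad own J x - pseudo_grad own J y) \<le> \<theta>\<^sub>0 * norm (x - y)"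
    and ext_lipschitz: "\<mu> \<le> \<theta>"
      "\<And>X Y. norm (ext_pseudo_grad own J X - ext_pseudo_grad own J Y) \<le> \<theta> * norm (X - Y)"
    and gain: "c > ((\<theta>\<^sub>0 + \<theta>)\<^sup>2 + 4 * \<mu> * \<theta>) / (4 * \<mu> * second_eigenvalue (laplacian W))"
begin

abbreviation "F \<equiv> pseudo_grad own J"
abbreviation "EF \<equiv> ext_pseudo_grad own J"
abbreviation "\<Omega> \<equiv> stack_set own \<Omega>s"
abbreviation "\<Xi> \<equiv> state_set own \<Omega>s :: ('N, 'k, 'm) state set"
abbreviation "R \<equiv> sel_mat own"
abbreviation "\<Lambda> \<equiv> diag_blocks own A"
abbreviation "dyn \<equiv> dynamics own J \<Omega>s A b L c"
abbreviation "\<beta> \<equiv> \<Sum>i\<in>UNIV. b i"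

lemma stack_set: "closed \<Omega>" "convex \<Omega>" "\<Omega> \<noteq> {}"
proof -
  show "closed \<Omega>" "convex \<Omega>" by (intro closed_stack_set convex_stack_set local_sets)+
  show "\<Omega> \<noteq> {}" using slater rel_interior_subset unfolding slater_def by blast
qed

lemma mem_state_set: "(X, Z, Y) \<in> \<Xi> \<longleftrightarrow> R *v X \<in> \<Omega> \<and> 0 \<le> Y"
  by (simp add: state_set_def nonneg_orthant_def)

lemma state_set: "closed \<Xi>" "convex \<Xi>" "\<Xi> \<noteq> {}"
proof -
  show "closed \<Xi>" "convex \<Xi>" by (intro closed_state_set convex_state_set stack_set)+
  obtain x where "x \<in> \<Omega>" using stack_set(3) by blast
  then have "(kron_vec 1 x, 0, 0) \<in> \<Xi>" by (simp add: mem_state_set sel_mat_kron_vec)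
  then show "\<Xi> \<noteq> {}" by blast
qed

text \<open>The drift before projection. The coupling term \<open>c *\<^sub>R Lap X\<close> appears
  undivided, because its selected and removed coordinates together recover the whole vector.\<close>

definition G :: "('N, 'k, 'm) state \<Rightarrow> ('N, 'k, 'm) state" where
  "G = (\<lambda>(X, Z, Y). (- (transpose R *v (EF X + transpose \<Lambda> *v Y) + c *\<^sub>R Lap X), Lap Y,
    \<Lambda> *v (R *v X) - stack_vec b - Lap Y - Lap Z))"

lemma dynamics_components:
  "R *v fst (dyn (X, Z, Y))
    = tangent_proj \<Omega> (R *v X) (- (EF X + transpose \<Lambda> *v Y + c *\<^sub>R (R *v Lap X)))"
  "fst (snd (dyn (X, Z, Y))) = Lap Y"
  "snd (snd (dyn (X, Z, Y)))
    = tangent_proj nonneg_orthant Y (\<Lambda> *v (R *v X) - stack_vec b - Lap Y - Lap Z)"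
  unfolding dynamics_def Let_def transpose_rem_mat
  by (simp_all add: matrix_vector_right_distrib sel_mat_transpose sel_mat_rem_mat)

text \<open>The blockwise formula is verified to be a single projection by tangency, normality and
  orthogonality: the residual lives only in the own decisions and the multipliers, where it is the
  residual of the two separate projections.\<close>

lemma dynamics_eq_tangent_proj:
  assumes w: "w \<in> \<Xi>"
  shows "dyn w = tangent_proj \<Xi> w (G w)"
proof -
  obtain X Z Y where XZY: "w = (X, Z, Y)" by (cases w)
  have RX: "R *v X \<in> \<Omega>" and Y: "Y \<in> nonneg_orthant"
    using w unfolding XZY by (auto simp: state_set_def)
  define q where "q = - (EF X + transpose \<Lambda> *v Y + c *\<^sub>R (R *v Lap X))"
  define d where "d = tangent_proj \<Omega> (R *v X) q"
  define v where "v = \<Lambda> *v (R *v X) - stack_vec b - Lap Y - Lap Z"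
  define dY where "dY = tangent_proj nonneg_orthant Y v"
  define s where "s = rem_mat own *v (rem_mat own *v (- (c *\<^sub>R Lap X)))"
  have dyn: "dyn w = (transpose R *v d + s, Lap Y, dY)"
    unfolding XZY dynamics_def Let_def transpose_rem_mat d_def q_def dY_def v_def s_def
    by (simp add: matrix_vector_mult_scaleR vec.neg)
  have Rs: "R *v s = 0" unfolding s_def by (rule sel_mat_rem_mat)
  have "- (c *\<^sub>R Lap X) = transpose R *v (R *v (- (c *\<^sub>R Lap X))) + s"
    unfolding s_def by (rule sel_rem_decomposition[symmetric])
  then have "- (transpose R *v (EF X + transpose \<Lambda> *v Y) + c *\<^sub>R Lap X) = transpose R *v q + s"
    unfolding q_def by (simp add: matrix_vector_right_distrib matrix_vector_mult_scaleR vec.neg algebra_simps)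
  then have Gd: "G w - (transpose R *v d + s, Lap Y, dY) = (transpose R *v (q - d), 0, v - dY)"
    unfolding XZY G_def v_def by (simp add: matrix_vector_mult_diff_distrib)
  have dn: "q - d \<in> normal_cone \<Omega> (R *v X)" "(q - d) \<bullet> d = 0"
    unfolding d_def by (intro tangent_proj_normal stack_set RX)+
  have Yn: "v - dY \<in> normal_cone nonneg_orthant Y" "(v - dY) \<bullet> dY = 0"
    unfolding dY_def by (intro tangent_proj_normal convex_nonneg_orthant Y)+
  show ?thesis unfolding dyn
  proof (rule tangent_proj_unique[OF state_set(2), symmetric])
    have "(transpose R *v d, 0, 0) \<in> tangent_cone \<Xi> w"
    proof (rule tangent_cone_linear_image[where S = \<Omega> and x = "R *v X" and f = "\<lambda>d. (transpose R *v d, 0, 0)"])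
      show "bounded_linear (\<lambda>d. (transpose R *v d, 0 :: real^('N \<times> 'm), 0 :: real^('N \<times> 'm)))"
        by (intro bounded_linear_Pair bounded_linear_zero matrix_vector_mul_bounded_linear)
      show "w + (transpose R *v (s - R *v X), 0, 0) \<in> \<Xi>" if "s \<in> \<Omega>" for s
        using that Y unfolding XZY
        by (simp add: mem_state_set matrix_vector_right_distrib sel_mat_transpose nonneg_orthant_def)
      show "d \<in> tangent_cone \<Omega> (R *v X)" unfolding d_def by (rule tangent_proj_in[OF stack_set(3)])
    qed
    moreover have "(0, 0, dY) \<in> tangent_cone \<Xi> w"
    proof (rule tangent_cone_linear_image[where S = nonneg_orthant and x = Y and f = "\<lambda>d. (0, 0, d)"])
      show "bounded_linear (\<lambda>d. (0 :: real^('N \<times> 'k), 0 :: real^('N \<times> 'm), d))"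
        by (intro bounded_linear_Pair bounded_linear_zero bounded_linear_ident)
      show "w + (0, 0, s - Y) \<in> \<Xi>" if "s \<in> nonneg_orthant" for s
        using that RX unfolding XZY by (simp add: mem_state_set nonneg_orthant_def)
      show "dY \<in> tangent_cone nonneg_orthant Y" unfolding dY_def using Y by (intro tangent_proj_in) auto
    qed
    \<comment> \<open>The estimates of other agents' decisions and z are unconstrained, so a full
      step in this direction stays in \<Xi>.\<close>
    moreover have "(s, Lap Y, 0) \<in> tangent_cone \<Xi> w"
    proof -
      have "w + (s, Lap Y, 0) \<in> \<Xi>" using RX Y unfolding XZY
        by (simp add: mem_state_set matrix_vector_right_distrib Rs nonneg_orthant_def)
      from tangent_cone_direction[OF this, of 1 w] show ?thesis by simp
    qed
    ultimately have "((transpose R *v d, 0, 0) + (0, 0, dY)) + (s, Lap Y, 0) \<in> tangent_cone \<Xi> w"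
      by (intro tangent_cone_add state_set)
    then show "(transpose R *v d + s, Lap Y, dY) \<in> tangent_cone \<Xi> w" by simp
    show "G w - (transpose R *v d + s, Lap Y, dY) \<in> normal_cone \<Xi> w"
    proof -
      have "(transpose R *v (q - d)) \<bullet> (X' - X) + (v - dY) \<bullet> (Y' - Y) \<le> 0" if "(X', Z', Y') \<in> \<Xi>" for X' Z' Y'
      proof -
        have "(q - d) \<bullet> (R *v X' - R *v X) \<le> 0" "(v - dY) \<bullet> (Y' - Y) \<le> 0"
          using that dn(1) Yn(1) RX Y by (auto simp: normal_cone_def mem_state_set nonneg_orthant_def)
        then show ?thesis unfolding transpose_mult_inner by (simp add: matrix_vector_mult_diff_distrib)
      qed
      then show ?thesis unfolding Gd normal_cone_def using w by (auto simp: XZY)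
    qed
    show "(G w - (transpose R *v d + s, Lap Y, dY)) \<bullet> (transpose R *v d + s, Lap Y, dY) = 0"
      unfolding Gd using dn(2) Yn(2)
      by (simp add: transpose_mult_inner matrix_vector_right_distrib sel_mat_transpose Rs)
  qed
qed

lemma G_Lipschitz: "\<exists>K\<ge>0. \<forall>w w'. norm (G w - G w') \<le> K * norm (w - w')"
proof -
  define H :: "('N, 'k, 'm) state \<Rightarrow> ('N, 'k, 'm) state" where
    "H = (\<lambda>(X, Z, Y). (- (transpose R *v (transpose \<Lambda> *v Y) + c *\<^sub>R Lap X), Lap Y,
      \<Lambda> *v (R *v X) - Lap Y - Lap Z))"
  have "linear H"
    by (intro linearI) (auto simp: H_def matrix_vector_right_distrib matrix_vector_mult_scaleR algebra_simps)
  then obtain B where B: "B > 0" "\<And>w. norm (H w) \<le> norm w * B"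
    using bounded_linear.pos_bounded linear_conv_bounded_linear by blast
  have \<theta>: "\<theta> > 0" using \<mu> ext_lipschitz(1) by linarith
  have "norm (G w - G w') \<le> (B + \<theta>) * norm (w - w')" for w w'
  proof -
    obtain X Z Y X' Z' Y' where w: "w = (X, Z, Y)" "w' = (X', Z', Y')" by (cases w, cases w')
    have "G w - G w' = H (w - w') + (- (transpose R *v (EF X - EF X')), 0, 0)"
      unfolding w G_def H_def by (simp add: matrix_vector_right_distrib matrix_vector_mult_diff_distrib algebra_simps)
    also have "norm \<dots> \<le> norm (H (w - w')) + norm (EF X - EF X')"
      by (intro order_trans[OF norm_triangle_ineq]) (simp add: norm_Pair norm_transpose_sel_mat)
    also have "norm (EF X - EF X') \<le> \<theta> * norm (X - X')" by (rule ext_lipschitz)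
    also have "norm (X - X') \<le> norm (w - w')" unfolding w using norm_fst_le[of "X - X'"] by simp
    finally show ?thesis using B(2)[of "w - w'"] \<theta> by (simp add: algebra_simps)
  qed
  then show ?thesis using B(1) \<theta> by (intro exI[of _ "B + \<theta>"]) auto
qed

lemma G_consensus:
  "G (kron_vec 1 x, Z, kron_vec 1 l) = (- (transpose R *v (F x + transpose A *v l)), 0, \<Lambda> *v x - stack_vec b - Lap Z)"
  by (simp add: G_def ext_pseudo_grad_kron_vec transpose_diag_blocks_kron_vec Lap_kron_vec sel_mat_kron_vec)

text \<open>Two kinds of test points suffice: own decisions moved inside \<Omega> with the other
  estimates fixed, and multipliers moved in consensus. In the latter case summing over the agents
  removes \<open>Lap Z\<close> and restores the global constraint.\<close>

lemma KKT_of_normal_cone: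
  assumes n: "G (kron_vec 1 x, Z, kron_vec 1 l) \<in> normal_cone \<Xi> (kron_vec 1 x, Z, kron_vec 1 l)"
  shows "KKT own J \<Omega>s A b x l"
proof -
  let ?e = "(kron_vec 1 x, Z, kron_vec 1 l)" and ?V = "\<Lambda> *v x - stack_vec b - Lap Z"
  have e: "?e \<in> \<Xi>" and n': "\<And>w. w \<in> \<Xi> \<Longrightarrow> G ?e \<bullet> (w - ?e) \<le> 0"
    using n by (auto simp: normal_cone_def split: if_splits)
  have x: "x \<in> \<Omega>" and l: "0 \<le> l"
  proof -
    show "x \<in> \<Omega>" using e by (simp add: mem_state_set sel_mat_kron_vec)
    show "0 \<le> l" using e by (simp add: mem_state_set kron_vec_nonneg_iff)
  qed
  have "- (F x + transpose A *v l) \<in> normal_cone \<Omega> x"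
  proof -
    have "- (F x + transpose A *v l) \<bullet> (y - x) \<le> 0" if y: "y \<in> \<Omega>" for y
    proof -
      have "(kron_vec 1 x + transpose R *v (y - x), Z, kron_vec 1 l) \<in> \<Xi>"
        using y e by (simp add: mem_state_set matrix_vector_right_distrib sel_mat_transpose sel_mat_kron_vec)
      from n'[OF this] have "- ((transpose R *v (F x + transpose A *v l)) \<bullet> (transpose R *v (y - x))) \<le> 0"
        unfolding G_consensus by simp
      then show ?thesis unfolding transpose_mult_inner[of R] sel_mat_transpose by (simp only: inner_minus_left)
    qed
    then show ?thesis using x by (simp add: normal_cone_def)
  qed
  then have 1: "0 \<in> (\<lambda>v. F x + transpose A *v l + v) ` normal_cone \<Omega> x" by (rule rev_image_eqI) simp
  have "A *v x - \<beta> \<in> normal_cone nonneg_orthant l"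
  proof -
    have "(A *v x - \<beta>) \<bullet> (y - l) \<le> 0" if y: "0 \<le> y" for y
    proof -
      have "(kron_vec 1 x, Z, kron_vec 1 y) \<in> \<Xi>"
        using x y by (simp add: mem_state_set sel_mat_kron_vec kron_vec_nonneg_iff)
      from n'[OF this] have "?V \<bullet> kron_vec 1 (y - l) \<le> 0" unfolding G_consensus by (simp add: kron_vec_diff)
      also have "?V \<bullet> kron_vec 1 (y - l) = (A *v x - \<beta>) \<bullet> (y - l)"
        unfolding inner_kron_vec column_of_diff inner_diff_right one_inner_column_diag_blocks
          one_inner_column_stack_vec one_inner_column_Lap by (simp add: inner_vec_def right_diff_distrib sum_subtractf)
      finally show ?thesis .
    qed
    then show ?thesis using l by (simp add: normal_cone_def nonneg_orthant_def)
  qed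
  then have 2: "0 \<in> (\<lambda>v. - (A *v x - \<beta>) + v) ` normal_cone nonneg_orthant l" by (rule rev_image_eqI) simp
  show ?thesis unfolding KKT_def using 1 2 by blast
qed

text \<open>Given a KKT pair, it remains to find z. The Laplacian reaches every stack whose columns
  sum to zero, so z can be chosen to spread the residual of the coupled constraint evenly over the
  agents.\<close>

lemma equilibrium_exists:
  "\<exists>x Z l. G (kron_vec 1 x, Z, kron_vec 1 l) \<in> normal_cone \<Xi> (kron_vec 1 x, Z, kron_vec 1 l)"
proof -
  obtain x0 where x0: "x0 \<in> rel_interior \<Omega>" "A *v x0 \<le> \<beta>" using slater unfolding slater_def by blast
  obtain x l where x: "x \<in> \<Omega>" "A *v x \<le> \<beta>" and l: "0 \<le> l" "l \<bullet> (A *v x - \<beta>) = 0"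
    and VI: "\<And>y. y \<in> \<Omega> \<Longrightarrow> 0 \<le> (F x + transpose A *v l) \<bullet> (y - x)"
    using multiplier_exists[OF stack_set(1,2) \<mu> monotone lipschitz x0] by blast
  let ?n = "real CARD('N)"
  define V where "V = \<Lambda> *v x - stack_vec b - kron_vec 1 ((1 / ?n) *\<^sub>R (A *v x - \<beta>))"
  have one: "(1 :: real^'N) \<bullet> 1 = ?n" by (simp add: inner_1_sum)
  have "1 \<bullet> column_of V j = 0" for j
    unfolding V_def column_of_diff inner_diff_right one_inner_column_diag_blocks one_inner_column_stack_vec
      column_of_kron_vec by (simp add: one)
  then obtain Z where "Lap Z = V" using Lap_range by blast
  then have Z: "\<Lambda> *v x - stack_vec b - Lap Z = kron_vec 1 ((1 / ?n) *\<^sub>R (A *v x - \<beta>))" unfolding V_def by simp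
  let ?e = "(kron_vec 1 x, Z, kron_vec 1 l)"
  have e: "?e \<in> \<Xi>" using x l by (simp add: mem_state_set sel_mat_kron_vec kron_vec_nonneg_iff)
  have "G ?e \<bullet> ((X', Z', Y') - ?e) \<le> 0" if w: "(X', Z', Y') \<in> \<Xi>" for X' Z' Y'
  proof -
    have "0 \<le> (F x + transpose A *v l) \<bullet> (R *v X' - x)" using w by (intro VI) (simp add: mem_state_set)
    then have 1: "- (transpose R *v (F x + transpose A *v l)) \<bullet> (X' - kron_vec 1 x) \<le> 0"
      unfolding inner_minus_left transpose_mult_inner[of R] matrix_vector_mult_diff_distrib sel_mat_kron_vec by simp
    have "(Y' - kron_vec 1 l) \<bullet> kron_vec 1 (A *v x - \<beta>)
        = (\<Sum>j\<in>UNIV. (1 \<bullet> column_of Y' j) * (A *v x - \<beta>) $ j) - ?n * (l \<bullet> (A *v x - \<beta>))"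
      unfolding inner_kron_vec column_of_diff inner_diff_right column_of_kron_vec
      by (simp add: one inner_vec_def sum_subtractf[symmetric] sum_distrib_left algebra_simps)
    also have "\<dots> \<le> 0"
    proof -
      have "(1 \<bullet> column_of Y' j) * (A *v x - \<beta>) $ j \<le> 0" for j
        using w x(2) unfolding inner_1_sum
        by (intro mult_nonneg_nonpos sum_nonneg) (auto simp: mem_state_set less_eq_vec_def)
      then show ?thesis unfolding l(2) by (simp add: sum_nonpos)
    qed
    finally have "(1 / ?n) * ((Y' - kron_vec 1 l) \<bullet> kron_vec 1 (A *v x - \<beta>)) \<le> 0" by (intro mult_nonneg_nonpos) auto
    moreover have "kron_vec (1 :: real^'N) ((1 / ?n) *\<^sub>R (A *v x - \<beta>)) = (1 / ?n) *\<^sub>R kron_vec 1 (A *v x - \<beta>)"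
      by (simp add: vec_eq_iff kron_vec_def)
    ultimately have 2: "kron_vec 1 ((1 / ?n) *\<^sub>R (A *v x - \<beta>)) \<bullet> (Y' - kron_vec 1 l) \<le> 0"
      by (simp add: inner_commute)
    show ?thesis unfolding G_consensus Z using 1 2 by simp
  qed
  then have "G ?e \<in> normal_cone \<Xi> ?e" using e by (auto simp: normal_cone_def)
  then show ?thesis by blast
qed

text \<open>The constant of \<open>positive_quadratic_form\<close> with
  \<open>s = \<theta>\<^sub>0 + \<theta>\<close> and
  \<open>t = c * second_eigenvalue L - \<theta>\<close>.\<close>

definition \<gamma> where
  "\<gamma> = (4 * \<mu> * (c * second_eigenvalue L - \<theta>) - (\<theta>\<^sub>0 + \<theta>)\<^sup>2) / (4 * (\<mu> + (c * second_eigenvalue L - \<theta>)))"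

text \<open>Vanishing of this quantity fixes the decisions and forces the multipliers to agree, but
  leaves their common value and z free.\<close>

definition dissipation :: "real^'k \<Rightarrow> ('N, 'k, 'm) state \<Rightarrow> real" where
  "dissipation x = (\<lambda>(X, Z, Y). \<gamma> * ((norm (average X - x))\<^sup>2 + (norm (disagreement X))\<^sup>2) + Y \<bullet> Lap Y)"

lemma gain': "(\<theta>\<^sub>0 + \<theta>)\<^sup>2 < 4 * \<mu> * (c * second_eigenvalue L - \<theta>)"
proof -
  have "0 < 4 * \<mu> * second_eigenvalue L" using \<mu> second_eigenvalue_laplacian(1)[OF agents] by simp
  from gain[unfolded pos_divide_less_eq[OF this]] show ?thesis by (simp add: algebra_simps)
qed

text \<open>Allows the spectral gap inequality to be multiplied by \<open>c\<close>.\<close>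

lemma gain_nonneg: "c \<ge> 0"
proof -
  have "0 \<le> (\<theta>\<^sub>0 + \<theta>)\<^sup>2" by simp
  then have "0 < 4 * \<mu> * (c * second_eigenvalue L - \<theta>)" using gain' by linarith
  then have "c * second_eigenvalue L > \<theta>" using \<mu> by (simp add: zero_less_mult_iff)
  then have "c * second_eigenvalue L > 0" using \<mu> ext_lipschitz(1) by linarith
  then show ?thesis using second_eigenvalue_laplacian(1)[OF agents] by (simp add: zero_less_mult_iff)
qed

text \<open>Write X as its average plus the disagreement. The monotonicity of F acts on the average, the
  spectral gap on the disagreement, and the gain condition makes the resulting quadratic form in the
  two norms positive definite.\<close>

lemma restricted_strong_monotonicity:
  "\<gamma> * ((norm (average X - x))\<^sup>2 + (norm (disagreement X))\<^sup>2)
    \<le> (R *v X - x) \<bullet> (EF X - F x) + c * (X \<bullet> Lap X)"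
proof -
  let ?a = "average X - x" and ?p = "disagreement X"
  define a where "a = norm ?a"
  define p where "p = norm ?p"
  have Xp: "X - kron_vec 1 (average X) = ?p" by (simp add: disagreement_def)
  have RX: "R *v X - x = R *v ?p + ?a"
    by (simp add: disagreement_def matrix_vector_mult_diff_distrib sel_mat_kron_vec)
  have Rp: "norm (R *v ?p) \<le> p" unfolding p_def by (rule norm_sel_mat_le)
  have 1: "norm (EF X - F (average X)) \<le> \<theta> * p"
    using ext_lipschitz(2)[of X "kron_vec 1 (average X)"] unfolding Xp ext_pseudo_grad_kron_vec p_def .
  have 2: "norm (F (average X) - F x) \<le> \<theta>\<^sub>0 * a" unfolding a_def by (rule lipschitz)
  have 3: "?a \<bullet> (F (average X) - F x) \<ge> \<mu> * a\<^sup>2" unfolding a_def by (rule monotone)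
  have ap: "a \<ge> 0" "p \<ge> 0" unfolding a_def p_def by auto
  have lower: "- (norm u * norm v) \<le> u \<bullet> v" for u v :: "real^'k"
    using Cauchy_Schwarz_ineq2[of u v] by linarith
  have "(R *v ?p) \<bullet> (EF X - F (average X)) \<ge> - (p * (\<theta> * p))"
    using lower[of "R *v ?p" "EF X - F (average X)"] mult_mono[OF Rp 1 ap(2)] by simp
  moreover have "(R *v ?p) \<bullet> (F (average X) - F x) \<ge> - (p * (\<theta>\<^sub>0 * a))"
    using lower[of "R *v ?p" "F (average X) - F x"] mult_mono[OF Rp 2 ap(2)] by simp
  moreover have "?a \<bullet> (EF X - F (average X)) \<ge> - (a * (\<theta> * p))"
    using lower[of ?a "EF X - F (average X)"] mult_left_mono[OF 1 ap(1)] unfolding a_def[symmetric] by linarith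
  \<comment> \<open>Both factors are split at the average; the four products yield the diagonal and
    the mixed terms of the quadratic form.\<close>
  moreover have "(R *v X - x) \<bullet> (EF X - F x) = (R *v ?p) \<bullet> (EF X - F (average X))
      + (R *v ?p) \<bullet> (F (average X) - F x) + ?a \<bullet> (EF X - F (average X)) + ?a \<bullet> (F (average X) - F x)"
    unfolding RX by (simp add: algebra_simps)
  moreover have "c * (second_eigenvalue L * p\<^sup>2) \<le> c * (X \<bullet> Lap X)"
    unfolding p_def by (intro mult_left_mono Lap_spectral_gap agents gain_nonneg)
  ultimately have "\<mu> * a\<^sup>2 - (\<theta>\<^sub>0 + \<theta>) * a * p + (c * second_eigenvalue L - \<theta>) * p\<^sup>2
      \<le> (R *v X - x) \<bullet> (EF X - F x) + c * (X \<bullet> Lap X)"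
    using 3 by (simp add: algebra_simps power2_eq_square)
  then show ?thesis
    using positive_quadratic_form(2)[OF \<mu> gain', of a p] unfolding \<gamma>_def a_def[symmetric] p_def[symmetric] by linarith
qed

lemma \<gamma>_pos: "\<gamma> > 0"
  unfolding \<gamma>_def by (rule positive_quadratic_form(1)[OF \<mu> gain'])

lemma dissipation_nonneg: "0 \<le> dissipation x w"
  unfolding dissipation_def using \<gamma>_pos by (auto split: prod.split intro!: add_nonneg_nonneg Lap_nonneg)

lemma dissipation_eq_0:
  assumes "dissipation x (X, Z, Y) = 0"
  shows "X = kron_vec 1 x" and "\<exists>l. Y = kron_vec 1 l"
proof -
  have "0 \<le> \<gamma> * ((norm (average X - x))\<^sup>2 + (norm (disagreement X))\<^sup>2)" using \<gamma>_pos by simp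
  moreover have "\<gamma> * ((norm (average X - x))\<^sup>2 + (norm (disagreement X))\<^sup>2) + Y \<bullet> Lap Y = 0"
    using assms unfolding dissipation_def by simp
  ultimately have "\<gamma> * ((norm (average X - x))\<^sup>2 + (norm (disagreement X))\<^sup>2) = 0" and Y: "Y \<bullet> Lap Y = 0"
    using Lap_nonneg[of Y] by linarith+
  then have "(norm (average X - x))\<^sup>2 + (norm (disagreement X))\<^sup>2 = 0" using \<gamma>_pos by simp
  then have "average X = x" "disagreement X = 0" by (simp_all add: add_nonneg_eq_0_iff)
  then show "X = kron_vec 1 x" by (simp add: disagreement_def)
  show "\<exists>l. Y = kron_vec 1 l" using Lap_kernel[OF Y] by blast
qed

lemma continuous_on_dissipation: "continuous_on UNIV (dissipation x)"
proof -
  have "dissipation x = (\<lambda>w. \<gamma> * ((norm (average (fst w) - x))\<^sup>2 + (norm (disagreement (fst w)))\<^sup>2)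
      + snd (snd w) \<bullet> Lap (snd (snd w)))"
    by (auto simp: dissipation_def)
  then show ?thesis
    by (simp only:) (intro continuous_intros bounded_linear.continuous_on[OF bounded_linear_average]
        bounded_linear.continuous_on[OF bounded_linear_disagreement]
        bounded_linear.continuous_on[OF matrix_vector_mul_bounded_linear])
qed

text \<open>The couplings of decisions with multipliers through \<open>\<Lambda>\<close> and of
  multipliers with z through the Laplacian are skew and cancel in the pairing. What remains is the
  restricted monotonicity in the decisions and the Laplacian form of the multipliers; normality of
  \<open>G e\<close> allows it to be subtracted.\<close>

lemma G_dissipative:
  assumes e: "e = (kron_vec 1 x, Z', kron_vec 1 l)" "G e \<in> normal_cone \<Xi> e" and w: "w \<in> \<Xi>"
  shows "(w - e) \<bullet> G w \<le> - dissipation x w"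
proof -
  obtain X Z Y where XZY: "w = (X, Z, Y)" by (cases w)
  have "G e \<bullet> (w - e) \<le> 0" using e(2) w by (auto simp: normal_cone_def split: if_splits)
  then have "(w - e) \<bullet> G w \<le> (w - e) \<bullet> (G w - G e)" by (simp add: inner_diff_right inner_commute)
  also have "\<dots> = - ((R *v X - x) \<bullet> (EF X - F x) + c * (X \<bullet> Lap X)) - Y \<bullet> Lap Y"
  proof -
    define dX where "dX = X - kron_vec 1 x"
    define dY where "dY = Y - kron_vec 1 l"
    define dZ where "dZ = Z - Z'"
    have LX: "Lap dX = Lap X" and LY: "Lap dY = Lap Y" and RX: "R *v dX = R *v X - x"
      unfolding dX_def dY_def by (simp_all add: matrix_vector_mult_diff_distrib Lap_kron_vec sel_mat_kron_vec)
    define u where "u = EF X - F x + transpose \<Lambda> *v dY"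
    have "G w - G e = (- (transpose R *v u + c *\<^sub>R Lap dX), Lap dY, \<Lambda> *v (R *v dX) - Lap dY - Lap dZ)"
      unfolding XZY e(1) G_def dX_def dY_def dZ_def u_def
      by (simp add: matrix_vector_right_distrib matrix_vector_mult_diff_distrib ext_pseudo_grad_kron_vec Lap_kron_vec algebra_simps)
    moreover have "w - e = (dX, dZ, dY)" unfolding XZY e(1) dX_def dY_def dZ_def by simp
    moreover have "dX \<bullet> (transpose R *v u) = (R *v dX) \<bullet> u" by (metis inner_commute transpose_mult_inner)
    ultimately have "(w - e) \<bullet> (G w - G e) = - ((R *v dX) \<bullet> u) - c * (dX \<bullet> Lap dX)
        + dZ \<bullet> Lap dY + dY \<bullet> (\<Lambda> *v (R *v dX)) - dY \<bullet> Lap dY - dY \<bullet> Lap dZ"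
      by (simp add: inner_diff_right inner_add_right)
    moreover have "(R *v dX) \<bullet> u = (R *v dX) \<bullet> (EF X - F x) + dY \<bullet> (\<Lambda> *v (R *v dX))"
      unfolding u_def inner_add_right by (metis inner_commute transpose_mult_inner)
    moreover have "dZ \<bullet> Lap dY = dY \<bullet> Lap dZ" by (metis Lap_inner inner_commute)
    ultimately have "(w - e) \<bullet> (G w - G e) = - ((R *v dX) \<bullet> (EF X - F x)) - c * (dX \<bullet> Lap dX) - dY \<bullet> Lap dY"
      by simp
    also have "dX \<bullet> Lap dX = X \<bullet> Lap X"
      unfolding LX unfolding dX_def inner_diff_left Lap_inner[symmetric, of "kron_vec 1 x"] Lap_kron_vec by simp
    also have "dY \<bullet> Lap dY = Y \<bullet> Lap Y"
      unfolding LY unfolding dY_def inner_diff_left Lap_inner[symmetric, of "kron_vec 1 l"] Lap_kron_vec by simp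
    finally show ?thesis unfolding RX by simp
  qed
  also have "\<dots> \<le> - dissipation x w"
    using restricted_strong_monotonicity[of X x] unfolding XZY dissipation_def by simp
  finally show ?thesis .
qed

end

section \<open>Convergence to the equilibrium\<close>

text \<open>\<open>G_Lipschitz\<close> only asserts that a constant exists; fixing it as a parameter
  allows the general flow to be instantiated.\<close>

locale primal_dual_flow = primal_dual_game W E own J \<Omega>s A b \<mu> \<theta>\<^sub>0 \<theta> c
  for W :: "real^'N^'N" and E and own :: "'k::finite \<Rightarrow> 'N" and J and \<Omega>s and A :: "real^'k^'m::finite"
    and b and \<mu> \<theta>\<^sub>0 \<theta> c +
  fixes K :: real
  assumes K: "0 \<le> K" "\<And>w w'. norm (G w - G w') \<le> K * norm (w - w')"
begin

sublocale projected_field \<Xi> G K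
  using state_set K by unfold_locales auto

text \<open>Stationarity in normal-cone form, combined with consensus, because dissipativity is
  established relative to such points.\<close>

definition equilibria where
  "equilibria = {e. (\<exists>x Z l. e = (kron_vec 1 x, Z, kron_vec 1 l)) \<and> G e \<in> normal_cone \<Xi> e}"

lemma equilibria_in: "e \<in> equilibria \<Longrightarrow> e \<in> \<Xi>"
  by (auto simp: equilibria_def normal_cone_def split: if_splits)

text \<open>If an orbit keeps a constant distance to an equilibrium, then its dissipation vanishes, so it
  is in consensus and only the multipliers may still move, driven by the constant vector h.\<close>

lemma constant_distance_accumulates:
  assumes e: "e \<in> equilibria" and w: "w \<in> \<Xi>"
    and const: "\<And>t. t \<ge> 0 \<Longrightarrow> norm (flow t w - e) = norm (w - e)"
  shows "\<exists>e'\<in>equilibria. \<exists>s. (\<forall>n. s n \<ge> 0) \<and> (\<lambda>n::nat. flow (s n) w) \<longlonglongrightarrow> e'"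
proof -
  obtain x Z' l where e': "e = (kron_vec 1 x, Z', kron_vec 1 l)" "G e \<in> normal_cone \<Xi> e"
    using e unfolding equilibria_def by blast
  have diss0: "dissipation x (flow t w) = 0" if "t \<ge> 0" for t
    by (rule dissipation_vanishes[OF equilibria_in[OF e] G_dissipative[OF e'] continuous_on_dissipation
          dissipation_nonneg w that const])
  have X: "fst (flow t w) = kron_vec 1 x" and Y: "\<exists>l. snd (snd (flow t w)) = kron_vec 1 l" if "t \<ge> 0" for t
  proof -
    have "dissipation x (fst (flow t w), fst (snd (flow t w)), snd (snd (flow t w))) = 0" using diss0[OF that] by simp
    from dissipation_eq_0[OF this]
    show "fst (flow t w) = kron_vec 1 x" "\<exists>l. snd (snd (flow t w)) = kron_vec 1 l" .
  qed
  have der: "AE t in lebesgue. 0 \<le> t \<longrightarrow> ((\<lambda>t. flow t w) has_vector_derivative field (flow t w)) (at t within {0..})"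
    using flow_caratheodory[OF w] unfolding caratheodory_solution_def by blast
  \<comment> \<open>Restricted to times of differentiability: there the derivative of the constant
    first component must vanish.\<close>
  have field_fst: "fst (field (flow t w)) = 0"
    if t: "t \<ge> 0" and d: "((\<lambda>t. flow t w) has_vector_derivative field (flow t w)) (at t within {0..})" for t
  proof (rule vector_derivative_unique_within)
    show "at t within {0..} \<noteq> bot"
    proof -
      have "at t within {t..} \<le> at t within {0..}" using t by (intro at_le) auto
      then show ?thesis by (metis at_within_Ici_at_right bot.extremum_uniqueI trivial_limit_at_right_real)
    qed
    show "((\<lambda>t. fst (flow t w)) has_vector_derivative fst (field (flow t w))) (at t within {0..})"
      by (rule bounded_linear.has_vector_derivative[OF bounded_linear_fst d])
    show "((\<lambda>t. fst (flow t w)) has_vector_derivative 0) (at t within {0..})"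
      by (rule has_vector_derivative_transform[of _ _ _ "\<lambda>_. kron_vec 1 x"]) (use t X in auto)
  qed
  have field_snd: "fst (snd (field (flow t w))) = 0" if t: "t \<ge> 0" for t
  proof -
    have "fst (snd (field (flow t w))) = Lap (snd (snd (flow t w)))"
      using dynamics_eq_tangent_proj[OF flow_in[OF t w]]
        dynamics_components(2)[of "fst (flow t w)" "fst (snd (flow t w))" "snd (snd (flow t w))"] by simp
    then show ?thesis using Y[OF t] by (auto simp: Lap_kron_vec)
  qed
  have Z: "fst (snd (flow t w)) = fst (snd w)" if t: "t \<ge> 0" for t
  proof -
    let ?z = "\<lambda>t. fst (snd (flow t w)) - fst (snd w)"
    have "(norm (?z t))\<^sup>2 + 2 * 0 * (t - 0) \<le> (norm (?z 0))\<^sup>2"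
    proof (rule ac_energy_decay)
      show "ac_on 0 t ?z"
      proof (rule ac_Lipschitz_pullback[OF ac_flow[OF w t], where C = 1])
        fix u v :: real assume "u \<le> v"
        have "norm (fst (snd p)) \<le> norm p" for p :: "('N, 'k, 'm) state"
          using norm_fst_le[of "fst (snd p)" "snd (snd p)"] norm_snd_le[of "snd p" "fst p"] by simp
        from this[of "flow v w - flow u w"] show "norm (?z v - ?z u) \<le> 1 * (norm (flow v w - flow u w) + (v - u))" using \<open>u \<le> v\<close> by simp
      qed
      show "AE \<tau> in lebesgue. 0 \<le> \<tau> \<longrightarrow> \<tau> < t \<longrightarrow>
          (\<exists>d. (?z has_vector_derivative d) (at \<tau> within {0..}) \<and> ?z \<tau> \<bullet> d \<le> - 0)"
        using der
      proof (rule AE_mp, intro AE_I2 impI)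
        fix \<tau> assume "0 \<le> \<tau> \<longrightarrow> ((\<lambda>t. flow t w) has_vector_derivative field (flow \<tau> w)) (at \<tau> within {0..})" and \<tau>: "0 \<le> \<tau>"
        then have "((\<lambda>t. fst (snd (flow t w))) has_vector_derivative fst (snd (field (flow \<tau> w)))) (at \<tau> within {0..})"
          by (intro bounded_linear.has_vector_derivative[OF bounded_linear_compose[OF bounded_linear_fst bounded_linear_snd]]) simp
        then have "(?z has_vector_derivative 0) (at \<tau> within {0..})"
          unfolding field_snd[OF \<tau>] by (auto intro: derivative_eq_intros)
        then show "\<exists>d. (?z has_vector_derivative d) (at \<tau> within {0..}) \<and> ?z \<tau> \<bullet> d \<le> - 0" by (intro exI[of _ 0]) simp
      qed
    qed (use t in auto)
    then show ?thesis by (simp add: flow_0[OF w])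
  qed
  \<comment> \<open>In consensus the multiplier drift depends on the state only through the
    decisions and z, both frozen, so it is constant in time. The first component can be set to zero
    because the field vanishes there.\<close>
  define h where "h = (0 :: real^('N \<times> 'k), 0 :: real^('N \<times> 'm), \<Lambda> *v x - stack_vec b - Lap (fst (snd w)))"
  have speed: "AE t in lebesgue. 0 \<le> t \<longrightarrow> (norm (field (flow t w)))\<^sup>2 \<le> h \<bullet> field (flow t w)"
    using der
  proof (rule AE_mp, intro AE_I2 impI)
    fix t assume "0 \<le> t \<longrightarrow> ((\<lambda>t. flow t w) has_vector_derivative field (flow t w)) (at t within {0..})" and t: "0 \<le> t"
    then have "fst (field (flow t w)) = 0" "fst (snd (field (flow t w))) = 0" using field_fst field_snd by auto
    then obtain d where d: "field (flow t w) = (0, 0, d)" by (metis prod.collapse)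
    obtain l where "flow t w = (kron_vec 1 x, fst (snd w), kron_vec 1 l)"
      using X[OF t] Y[OF t] Z[OF t] by (metis prod.collapse)
    then have "(G (flow t w) - h) \<bullet> field (flow t w) = 0" unfolding d h_def by (simp add: G_consensus)
    moreover have "(G (flow t w) - field (flow t w)) \<bullet> field (flow t w) = 0"
      by (intro tangent_proj_normal state_set flow_in t w)
    ultimately show "(norm (field (flow t w)))\<^sup>2 \<le> h \<bullet> field (flow t w)"
      by (simp add: inner_diff_left power2_norm_eq_inner)
  qed
  have bdd: "norm (flow t w) \<le> norm (w - e) + norm e" if "t \<ge> 0" for t
    using const[OF that] norm_triangle_sub[of "flow t w" e] by simp
  from flow_stationary_limit[OF w bdd speed] obtain e' s where e': "e' \<in> \<Xi>" "G e' \<in> normal_cone \<Xi> e'"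
    "\<And>n. s n \<ge> 0" and lim: "(\<lambda>n. flow (s n) w) \<longlonglongrightarrow> e'"
    by blast
  \<comment> \<open>Continuity of the dissipation carries consensus over to the limit.\<close>
  have "(\<lambda>n. dissipation x (flow (s n) w)) \<longlonglongrightarrow> dissipation x e'"
    using continuous_on_tendsto_compose[OF continuous_on_dissipation lim] by simp
  then have "dissipation x e' = 0" using diss0[OF e'(3)] by (simp add: LIMSEQ_const_iff)
  then have "\<exists>x Z l. e' = (kron_vec 1 x, Z, kron_vec 1 l)"
    using dissipation_eq_0 by (metis prod.collapse)
  then have "e' \<in> equilibria" using e'(2) unfolding equilibria_def by blast
  then show ?thesis using e'(3) lim by blast
qed

proposition flow_converges_to_equilibrium:
  assumes "w \<in> \<Xi>" shows "\<exists>e\<in>equilibria. ((\<lambda>t. flow t w) \<longlongrightarrow> e) at_top"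
proof (rule flow_converges[OF assms])
  show "equilibria \<noteq> {}" using equilibrium_exists unfolding equilibria_def by blast
  show "norm (flow t y - e) \<le> norm (y - e)" if e: "e \<in> equilibria" and "y \<in> \<Xi>" "t \<ge> 0" for e y t
  proof -
    obtain x Z' l where "e = (kron_vec 1 x, Z', kron_vec 1 l)" "G e \<in> normal_cone \<Xi> e"
      using e unfolding equilibria_def by blast
    from flow_nonexpanding[OF equilibria_in[OF e] G_dissipative[OF this] continuous_on_dissipation
        dissipation_nonneg that(2,3)] show ?thesis .
  qed
qed (rule constant_distance_accumulates)

lemma flow_solves_dynamics:
  assumes w: "w \<in> \<Xi>"
  shows "caratheodory_solution (dyn) (\<lambda>t. flow t w)"
  using flow_caratheodory[OF w] dynamics_eq_tangent_proj[OF flow_in[OF _ w]]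
  unfolding caratheodory_solution_def by simp

text \<open>The identification of the dynamics with a projection onto the tangent cone of \<Xi> is
  available on \<Xi> only. The selected decisions and the multipliers, however, move in the tangent
  cones of \<Omega> and of the orthant at every state, so the invariance criterion is applied to
  these two linear images.\<close>

lemma solution_stays_in_state_set:
  assumes u: "caratheodory_solution (dyn) u" and u0: "u 0 \<in> \<Xi>" and t: "t \<ge> 0"
  shows "u t \<in> \<Xi>"
proof -
  have ac: "ac_on 0 T u" if "T \<ge> 0" for T
    using u that unfolding caratheodory_solution_def by blast
  have der: "AE t in lebesgue. 0 \<le> t \<longrightarrow> (u has_vector_derivative dyn (u t)) (at t within {0..})"
    using u unfolding caratheodory_solution_def by blast
  have stays: "f (u t) \<in> S"
    if f: "bounded_linear f" and S: "closed S" "convex S" and f0: "f (u 0) \<in> S"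
      and T: "\<And>w. f (dyn w) \<in> tangent_cone S (f w)"
    for f :: "('N, 'k, 'm) state \<Rightarrow> 'b::euclidean_space" and S
  proof (rule stays_in_closed_convex[where u = "\<lambda>t. f (u t)", OF S _ _ f0 t])
    obtain B where B: "B > 0" "\<And>w. norm (f w) \<le> norm w * B" using bounded_linear.pos_bounded[OF f] by blast
    show "ac_on 0 T (\<lambda>t. f (u t))" if "T \<ge> 0" for T
    proof (rule ac_Lipschitz_pullback[OF ac[OF that], where C = B])
      fix r s :: real assume "r \<le> s"
      have "norm (f (u s) - f (u r)) \<le> B * norm (u s - u r)"
        using B(2)[of "u s - u r"] by (simp add: linear_diff[OF bounded_linear.linear[OF f]] mult.commute)
      also have "\<dots> \<le> B * (norm (u s - u r) + (s - r))" using B(1) \<open>r \<le> s\<close> by simp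
      finally show "norm (f (u s) - f (u r)) \<le> B * (norm (u s - u r) + (s - r))" .
    qed
    show "AE t in lebesgue. 0 \<le> t \<longrightarrow> (\<exists>d\<in>tangent_cone S (f (u t)). ((\<lambda>t. f (u t)) has_vector_derivative d) (at t within {0..}))"
      using der
    proof (rule AE_mp, intro AE_I2 impI)
      fix t assume "0 \<le> t \<longrightarrow> (u has_vector_derivative dyn (u t)) (at t within {0..})" "0 \<le> t"
      then have "(u has_vector_derivative dyn (u t)) (at t within {0..})" by blast
      from bounded_linear.has_vector_derivative[OF f this] T[of "u t"]
      show "\<exists>d\<in>tangent_cone S (f (u t)). ((\<lambda>t. f (u t)) has_vector_derivative d) (at t within {0..})" by blast
    qed
  qed
  have ne: "(nonneg_orthant :: (real^('N \<times> 'm)) set) \<noteq> {}" by (auto simp: nonneg_orthant_def)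
  have "R *v fst (u t) \<in> \<Omega>"
  proof (rule stays)
    show "bounded_linear (\<lambda>w. R *v fst w)"
      by (intro bounded_linear_compose[OF matrix_vector_mul_bounded_linear bounded_linear_fst])
    show "R *v fst (u 0) \<in> \<Omega>" using u0 by (cases "u 0") (simp add: mem_state_set)
    show "R *v fst (dyn w) \<in> tangent_cone \<Omega> (R *v fst w)" for w
      by (cases w) (simp add: dynamics_components tangent_proj_in stack_set)
  qed (intro stack_set)+
  moreover have "snd (snd (u t)) \<in> nonneg_orthant"
  proof (rule stays)
    show "bounded_linear (\<lambda>w. snd (snd w))" by (intro bounded_linear_compose[OF bounded_linear_snd bounded_linear_snd])
    show "snd (snd (u 0)) \<in> nonneg_orthant" using u0 by (cases "u 0") (simp add: mem_state_set nonneg_orthant_def)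
    show "snd (snd (dyn w)) \<in> tangent_cone nonneg_orthant (snd (snd w))" for w
      by (cases w) (simp add: dynamics_components tangent_proj_in ne)
  qed (intro closed_nonneg_orthant convex_nonneg_orthant)+
  ultimately show ?thesis by (cases "u t") (simp add: mem_state_set nonneg_orthant_def)
qed

lemma solution_unique:
  assumes u: "caratheodory_solution (dyn) u" and u0: "u 0 \<in> \<Xi>" and t: "t \<ge> 0"
  shows "u t = flow t (u 0)"
proof (rule caratheodory_unique[OF _ _ t])
  show in\<Xi>: "u t \<in> \<Xi>" if "t \<ge> 0" for t using solution_stays_in_state_set[OF u u0 that] .
  show "caratheodory_solution field u"
    using u dynamics_eq_tangent_proj[OF in\<Xi>] unfolding caratheodory_solution_def by simp
qed

lemma v_GNE_unique:
  assumes "v_GNE own J \<Omega>s A b x" "v_GNE own J \<Omega>s A b y" shows "y = x"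
proof -
  have "0 \<le> F x \<bullet> (y - x)" "0 \<le> F y \<bullet> (x - y)" using assms unfolding v_GNE_def by auto
  then have "\<mu> * (norm (x - y))\<^sup>2 \<le> 0"
    using monotone[of x y] by (simp add: algebra_simps inner_commute)
  then show ?thesis using \<mu> by (simp add: mult_le_0_iff)
qed

end

theorem theorem1:
  fixes own :: "'k::finite \<Rightarrow> 'N::finite"
    and J :: "'N \<Rightarrow> real^'k \<Rightarrow> real"
    and \<Omega>s :: "'N \<Rightarrow> (real^'k) set"
    and A :: "real^'k^'m::finite"
    and b :: "'N \<Rightarrow> real^'m"
    and E :: "('N \<times> 'N) set"
    and W :: "real^'N^'N"
    and \<mu> \<theta>\<^sub>0 \<theta> c :: real
    and w0 :: "('N, 'k, 'm) state"
  assumes agents: "CARD('N) \<ge> 2"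
    and local_sets: "\<And>i. \<Omega>s i \<subseteq> block_space own i" "\<And>i. \<Omega>s i \<noteq> {}"
      "\<And>i. closed (\<Omega>s i)" "\<And>i. convex (\<Omega>s i)"
    and feasible: "feasible_set own \<Omega>s A b \<noteq> {}" "slater own \<Omega>s A b"
    and costs: "\<And>i. continuously_differentiable (J i)"
      "\<And>i x. convex_on UNIV (\<lambda>y. J i (with_block own i y x))"
    and constants: "0 < \<mu>" "0 < \<theta>\<^sub>0"
    and monotone: "\<And>x y. (x - y) \<bullet> (pseudo_grad own J x - pseudo_grad own J y)
      \<ge> \<mu> * (norm (x - y))\<^sup>2"
    and lipschitz: "\<And>x y. norm (pseudo_grad own J x - pseudo_grad own J y) \<le> \<theta>\<^sub>0 * norm (x - y)"
    and graph: "sym E" "\<And>i j. (i, j) \<in> E\<^sup>*"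
    and weights: "transpose W = W" "\<And>i j. (i, j) \<in> E \<Longrightarrow> 0 < W $ i $ j"
      "\<And>i j. (i, j) \<notin> E \<Longrightarrow> W $ i $ j = 0"
    and ext_lipschitz: "\<mu> \<le> \<theta>" "\<theta> \<le> \<theta>\<^sub>0"
      "\<And>X Y. norm (ext_pseudo_grad own J X - ext_pseudo_grad own J Y) \<le> \<theta> * norm (X - Y)"
    and gain: "c > ((\<theta>\<^sub>0 + \<theta>)\<^sup>2 + 4 * \<mu> * \<theta>) / (4 * \<mu> * second_eigenvalue (laplacian W))"
    and initial: "w0 \<in> state_set own \<Omega>s"
  shows "\<exists>w. caratheodory_solution (dynamics own J \<Omega>s A b (laplacian W) c) w \<and> w 0 = w0 \<and>
    (\<forall>w'. caratheodory_solution (dynamics own J \<Omega>s A b (laplacian W) c) w' \<and> w' 0 = w0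
      \<longrightarrow> (\<forall>t\<ge>0. w' t = w t)) \<and>
    (\<forall>t\<ge>0. w t \<in> state_set own \<Omega>s) \<and>
    (\<exists>X Z Y x l. (w \<longlongrightarrow> (X, Z, Y)) at_top \<and>
      equilibrium own J \<Omega>s A b (laplacian W) c (X, Z, Y) \<and>
      X = kron_vec (1 :: real^'N) x \<and> Y = kron_vec (1 :: real^'N) l \<and>
      KKT own J \<Omega>s A b x l \<and>
      v_GNE own J \<Omega>s A b x \<and> (\<forall>y. v_GNE own J \<Omega>s A b y \<longrightarrow> y = x))"
proof -
  interpret game: primal_dual_game W E own J \<Omega>s A b \<mu> \<theta>\<^sub>0 \<theta> c
    using assms by unfold_locales blast+
  obtain K where "0 \<le> K" "\<And>w w'. norm (game.G w - game.G w') \<le> K * norm (w - w')"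
    using game.G_Lipschitz by blast
  then interpret flow: primal_dual_flow W E own J \<Omega>s A b \<mu> \<theta>\<^sub>0 \<theta> c K by unfold_locales
  let ?w = "\<lambda>t. flow.flow t w0"
  obtain e where e: "e \<in> flow.equilibria" "(?w \<longlongrightarrow> e) at_top"
    using flow.flow_converges_to_equilibrium[OF initial] by blast
  then obtain x Z l where xl: "e = (kron_vec 1 x, Z, kron_vec 1 l)"
    and n: "game.G e \<in> normal_cone (state_set own \<Omega>s) e"
    unfolding flow.equilibria_def by blast
  have e_in: "e \<in> state_set own \<Omega>s" by (rule flow.equilibria_in[OF e(1)])
  have eq: "equilibrium own J \<Omega>s A b (laplacian W) c e"
    unfolding equilibrium_def game.dynamics_eq_tangent_proj[OF e_in]
    using e_in n tangent_proj_eq_0_iff[OF game.state_set(2) e_in] by blast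
  have KKT: "KKT own J \<Omega>s A b x l" using game.KKT_of_normal_cone n unfolding xl by blast
  then have v: "v_GNE own J \<Omega>s A b x" by (rule KKT_imp_v_GNE)
  show ?thesis
  proof (intro exI[of _ ?w] conjI allI impI)
    show "caratheodory_solution (dynamics own J \<Omega>s A b (laplacian W) c) ?w"
      by (rule flow.flow_solves_dynamics[OF initial])
    show "?w 0 = w0" by (rule flow.flow_0[OF initial])
    show "w' t = ?w t"
      if "caratheodory_solution (dynamics own J \<Omega>s A b (laplacian W) c) w' \<and> w' 0 = w0" "0 \<le> t" for w' t
      using flow.solution_unique[of w' t] that initial by simp
    show "?w t \<in> state_set own \<Omega>s" if "0 \<le> t" for t by (rule flow.flow_in[OF that initial])
    show "\<exists>X Z Y x l. (?w \<longlongrightarrow> (X, Z, Y)) at_top \<and>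
      equilibrium own J \<Omega>s A b (laplacian W) c (X, Z, Y) \<and>
      X = kron_vec (1 :: real^'N) x \<and> Y = kron_vec (1 :: real^'N) l \<and>
      KKT own J \<Omega>s A b x l \<and>
      v_GNE own J \<Omega>s A b x \<and> (\<forall>y. v_GNE own J \<Omega>s A b y \<longrightarrow> y = x)"
      using e(2) eq KKT v flow.v_GNE_unique[OF v] unfolding xl by blast
  qed
qed

end
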